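(* Let $\mathcal A\subset \mathcal D'_{L^\infty}(\mathbb R,X)$ be $C^\infty$-uniformly closed, closed under addition, and such that $f*\varphi\in\mathcal A$ for all $f\in\mathcal A$, $\varphi\in\mathcal D(\mathbb R,\mathbb K)$. Then for $T\in\mathcal D'(\mathbb R,X)$ the following statements are equivalent: (a) $T\in\mathcal D'_{\mathcal A}(\mathbb R,X)$, i.e. $T*\varphi\in\mathcal A$ for each $\varphi\in\mathcal D(\mathbb R,\mathbb K)$; (b) there exist $F,G\in\mathcal A\cap C(\mathbb R,X)$ and an integer $n\ge 0$ such that $T=F+G^{(n)}$ (distribution derivative); (c) there exist $m\in\mathbb N$, $k_1,\dots,k_m\in\mathbb N_0$ and $F_1,\dots,F_m\in\mathcal A$ with $T=F_1^{(k_1)}+\cdots+F_m^{(k_m)}$; (d) $T\in(\mathcal D_{L^1})'(\mathbb R,X)$ and there exists a sequence $(\phi_n)_{n\in\mathbb N}\subset\mathcal A\cap C^\infty(\mathbb R,X)$ with $\phi_n\to T$ in $(\mathcal D_{L^1})'(\mathbb R,X)$; (e) there exists a sequence $(\phi_n)\subset\mathcal A$ such that $\phi_n\to T$ uniformly on each $U\subset\mathcal D(\mathbb R,\mathbb K)$ which is bounded in $\mathcal D_{L^1}(\mathbb R,\mathbb K)$; (f) $T\in$ closure of $\mathcal A$ in $(\mathcal D_{L^1})'(\mathbb R,X)$.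
   Context: $X$ is a Banach space over $\mathbb K=\mathbb R$ or $\mathbb C$. $\mathcal D(\mathbb R,\mathbb K)$: Schwartz test functions; $\mathcal D'(\mathbb R,X)$: linear continuous maps $\mathcal D(\mathbb R,\mathbb K)\to X$; locally Bochner integrable functions are identified with the distributions they define. $(T*\varphi)(x)=T(y\mapsto\varphi(x-y))$, a $C^\infty$ function. For $\mathcal B\subset\mathcal D'(\mathbb R,X)$, $\mathcal D'_{\mathcal B}(\mathbb R,X)=\{T\in\mathcal D'(\mathbb R,X):T*\varphi\in\mathcal B\ \forall\varphi\in\mathcal D(\mathbb R,\mathbb K)\}$; $\mathcal D'_{L^\infty}$ is the case $\mathcal B=L^\infty(\mathbb R,X)$. $C^\infty$-uniformly closed: if $(\phi_n)\subset\mathcal A\cap C^\infty(\mathbb R,X)$ and $\phi_n\to\phi$ uniformly on $\mathbb R$, then $\phi\in\mathcal A$. $\mathcal D_{L^1}(\mathbb R,\mathbb K)$ is the space of $\varphi\in C^\infty(\mathbb R,\mathbb K)$ with $\varphi^{(j)}\in L^1$ for all $j\ge0$, where $\varphi_m\to0$ means $\varphi_m^{(j)}\to0$ in $L^1$ for each $j$; $U\subset\mathcal D_{L^1}$ is bounded if $\sup_{\varphi\in U}\|\varphi^{(j)}\|_{L^1}<\infty$ for each $j$. $(\mathcal D_{L^1})'(\mathbb R,X)$ is the space of linear continuous maps $\mathcal D_{L^1}(\mathbb R,\mathbb K)\to X$, with topology given by the seminorms $\|T\|_V=\sup_{\varphi\in V}\|T(\varphi)\|$, $V$ bounded in $\mathcal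 D_{L^1}(\mathbb R,\mathbb K)$. For $T\in\mathcal D'(\mathbb R,X)$, "$T\in(\mathcal D_{L^1})'(\mathbb R,X)$" means that $T$ has a (unique) extension $\widetilde T\in(\mathcal D_{L^1})'(\mathbb R,X)$, and $T$ is then identified with $\widetilde T$; in this sense $\mathcal D'_{L^\infty}(\mathbb R,X)=(\mathcal D_{L^1})'(\mathbb R,X)$, so $\mathcal A$ is regarded as a subset of $(\mathcal D_{L^1})'(\mathbb R,X)$. *)

theory Defs
  imports "HOL-Analysis.Analysis"
begin

section \<open>Scalars and Banach spaces over them\<close>

text \<open>
  The scalar field is a type of sort \<open>{real_normed_field, euclidean_space}\<close>, that is, a
  finite-dimensional real field extension with multiplicative norm. By Frobenius' theorem this is,
  up to isometric isomorphism, exactly the field of real or the field of complex numbers.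
  A Banach space over it is a type of class \<open>banach\<close> (which carries the real structure) with a
  scalar multiplication that extends the real one.
\<close>

locale normed_scaling = vector_space smul
  for smul :: "'k::{real_normed_field,euclidean_space} \<Rightarrow> 'x::banach \<Rightarrow> 'x" +
  assumes norm_scale: "norm (smul c x) = norm c * norm x"
    and scale_of_real: "smul (of_real r) x = r *\<^sub>R x"

lemma normed_scaling_real: "normed_scaling (scaleR :: real \<Rightarrow> 'x::banach \<Rightarrow> 'x)"
  by unfold_locales (auto simp: algebra_simps)

lemma normed_scaling_complex: "normed_scaling ((*) :: complex \<Rightarrow> complex \<Rightarrow> complex)"
  by unfold_locales (auto simp: algebra_simps norm_mult scaleR_conv_of_real)

section \<open>Smooth functions and test functions\<close>

definition nderiv :: "nat \<Rightarrow> (real \<Rightarrow> 'a::real_normed_vector) \<Rightarrow> real \<Rightarrow> 'a" where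
  "nderiv n f = ((\<lambda>g x. vector_derivative g (at x)) ^^ n) f"

definition smooth :: "(real \<Rightarrow> 'a::real_normed_vector) \<Rightarrow> bool" where
  "smooth f \<longleftrightarrow> (\<forall>n x. nderiv n f differentiable (at x))"

definition test_funs :: "(real \<Rightarrow> 'k::real_normed_vector) set" where
  "test_funs = {\<phi>. smooth \<phi> \<and> compact (closure {x. \<phi> x \<noteq> 0})}"

definition test_null_seq :: "(nat \<Rightarrow> real \<Rightarrow> 'k::real_normed_vector) \<Rightarrow> bool" where
  "test_null_seq \<phi> \<longleftrightarrow> range \<phi> \<subseteq> test_funs \<and>
     (\<exists>K. compact K \<and> (\<forall>m. {x. \<phi> m x \<noteq> 0} \<subseteq> K)) \<and>
     (\<forall>j. uniform_limit UNIV (\<lambda>m. nderiv j (\<phi> m)) (\<lambda>_. 0) sequentially)"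

section \<open>Distributions\<close>

text \<open>
  A linear map on a set of functions is represented by a function that is \<open>undefined\<close> outside of
  that set, so that equality of linear maps is equality in HOL.
\<close>

definition linear_map_on ::
    "('k \<Rightarrow> 'x \<Rightarrow> 'x) \<Rightarrow> (real \<Rightarrow> 'k::real_normed_field) set \<Rightarrow> ((real \<Rightarrow> 'k) \<Rightarrow> 'x::real_normed_vector) \<Rightarrow> bool"
  where
  "linear_map_on smul D T \<longleftrightarrow> T \<in> extensional D \<and>
     (\<forall>\<phi>\<in>D. \<forall>\<psi>\<in>D. T (\<lambda>x. \<phi> x + \<psi> x) = T \<phi> + T \<psi>) \<and>
     (\<forall>c. \<forall>\<phi>\<in>D. T (\<lambda>x. c * \<phi> x) = smul c (T \<phi>))"

text \<open>
  The inductive limit topology of the test functions is bornological, hence a linear map on them is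
  continuous iff it is continuous along null sequences.
\<close>

definition distributions ::
    "('k \<Rightarrow> 'x \<Rightarrow> 'x) \<Rightarrow> ((real \<Rightarrow> 'k::real_normed_field) \<Rightarrow> 'x::real_normed_vector) set" where
  "distributions smul = {T. linear_map_on smul test_funs T \<and>
     (\<forall>\<phi>. test_null_seq \<phi> \<longrightarrow> (\<lambda>m. T (\<phi> m)) \<longlonglongrightarrow> 0)}"

text \<open>
  The distribution of a locally Bochner integrable function. The library's Bochner integral needs a
  second countable range, whereas \<open>'x\<close> may be non-separable. Hence the Henstock--Kurzweil integral
  is used, which coincides with the Bochner integral on all Bochner integrable functions.
\<close>

definition reg_dist ::
    "('k \<Rightarrow> 'x \<Rightarrow> 'x) \<Rightarrow> (real \<Rightarrow> 'x) \<Rightarrow> (real \<Rightarrow> 'k::real_normed_field) \<Rightarrow> 'x::real_normed_vector" where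
  "reg_dist smul f = (\<lambda>\<phi>\<in>test_funs. integral UNIV (\<lambda>x. smul (\<phi> x) (f x)))"

definition dist_plus ::
    "((real \<Rightarrow> 'k::real_normed_field) \<Rightarrow> 'x::real_normed_vector) \<Rightarrow> ((real \<Rightarrow> 'k) \<Rightarrow> 'x) \<Rightarrow> (real \<Rightarrow> 'k) \<Rightarrow> 'x" where
  "dist_plus S T = (\<lambda>\<phi>\<in>test_funs. S \<phi> + T \<phi>)"

definition dist_sum ::
    "('i \<Rightarrow> (real \<Rightarrow> 'k::real_normed_field) \<Rightarrow> 'x::real_normed_vector) \<Rightarrow> 'i set \<Rightarrow> (real \<Rightarrow> 'k) \<Rightarrow> 'x" where
  "dist_sum S I = (\<lambda>\<phi>\<in>test_funs. \<Sum>i\<in>I. S i \<phi>)"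

definition dist_deriv ::
    "nat \<Rightarrow> ((real \<Rightarrow> 'k::real_normed_field) \<Rightarrow> 'x::real_normed_vector) \<Rightarrow> (real \<Rightarrow> 'k) \<Rightarrow> 'x" where
  "dist_deriv n T = (\<lambda>\<phi>\<in>test_funs. (-1) ^ n *\<^sub>R T (nderiv n \<phi>))"

definition dist_conv ::
    "((real \<Rightarrow> 'k::real_normed_field) \<Rightarrow> 'x::real_normed_vector) \<Rightarrow> (real \<Rightarrow> 'k) \<Rightarrow> real \<Rightarrow> 'x" where
  "dist_conv T \<phi> x = T (\<lambda>y. \<phi> (x - y))"

text \<open>
  Sets of functions such as \<open>L\<^sup>\<infinity>\<close> are represented by the corresponding sets of distributions;
  a function \<open>f\<close> belongs to such a set \<open>B\<close> iff \<open>reg_dist smul f \<in> B\<close>.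
\<close>

definition D'_of ::
    "('k \<Rightarrow> 'x \<Rightarrow> 'x) \<Rightarrow> ((real \<Rightarrow> 'k) \<Rightarrow> 'x) set \<Rightarrow> ((real \<Rightarrow> 'k::real_normed_field) \<Rightarrow> 'x::real_normed_vector) set" where
  "D'_of smul B = {T \<in> distributions smul. \<forall>\<phi>\<in>test_funs. reg_dist smul (dist_conv T \<phi>) \<in> B}"

definition strongly_measurable :: "(real \<Rightarrow> 'x::real_normed_vector) \<Rightarrow> bool" where
  "strongly_measurable f \<longleftrightarrow>
     (\<exists>s. (\<forall>n. simple_function lebesgue (s n)) \<and> (AE x in lebesgue. (\<lambda>n. s n x) \<longlonglongrightarrow> f x))"

definition L_infinity ::
    "('k \<Rightarrow> 'x \<Rightarrow> 'x) \<Rightarrow> ((real \<Rightarrow> 'k::real_normed_field) \<Rightarrow> 'x::real_normed_vector) set" where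
  "L_infinity smul = reg_dist smul `
     {f. strongly_measurable f \<and> (\<exists>C. AE x in lebesgue. norm (f x) \<le> C)}"

definition smooth_uniformly_closed ::
    "('k \<Rightarrow> 'x \<Rightarrow> 'x) \<Rightarrow> ((real \<Rightarrow> 'k::real_normed_field) \<Rightarrow> 'x::real_normed_vector) set \<Rightarrow> bool" where
  "smooth_uniformly_closed smul A \<longleftrightarrow>
     (\<forall>\<phi>s \<phi>. (\<forall>n. smooth (\<phi>s n) \<and> reg_dist smul (\<phi>s n) \<in> A) \<and> uniform_limit UNIV \<phi>s \<phi> sequentially
        \<longrightarrow> reg_dist smul \<phi> \<in> A)"

section \<open>The space \<open>\<D>\<^sub>L\<^sub>1\<close> and its strong dual\<close>

definition DL1 :: "(real \<Rightarrow> 'k::{real_normed_field,euclidean_space}) set" where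
  "DL1 = {\<phi>. smooth \<phi> \<and> (\<forall>j. integrable lborel (nderiv j \<phi>))}"

definition DL1_norm :: "nat \<Rightarrow> (real \<Rightarrow> 'k::{real_normed_field,euclidean_space}) \<Rightarrow> real" where
  "DL1_norm j \<phi> = (LINT x|lborel. norm (nderiv j \<phi> x))"

definition DL1_null_seq :: "(nat \<Rightarrow> real \<Rightarrow> 'k::{real_normed_field,euclidean_space}) \<Rightarrow> bool" where
  "DL1_null_seq \<phi> \<longleftrightarrow> range \<phi> \<subseteq> DL1 \<and> (\<forall>j. (\<lambda>m. DL1_norm j (\<phi> m)) \<longlonglongrightarrow> 0)"

definition DL1_bounded :: "(real \<Rightarrow> 'k::{real_normed_field,euclidean_space}) set \<Rightarrow> bool" where
  "DL1_bounded U \<longleftrightarrow> U \<subseteq> DL1 \<and> (\<forall>j. bdd_above (DL1_norm j ` U))"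

definition DL1_dual ::
    "('k \<Rightarrow> 'x \<Rightarrow> 'x) \<Rightarrow> ((real \<Rightarrow> 'k::{real_normed_field,euclidean_space}) \<Rightarrow> 'x::real_normed_vector) set" where
  "DL1_dual smul = {S. linear_map_on smul DL1 S \<and>
     (\<forall>\<phi>. DL1_null_seq \<phi> \<longrightarrow> (\<lambda>m. S (\<phi> m)) \<longlonglongrightarrow> 0)}"

text \<open>The seminorms are \<open>ennreal\<close>-valued, so that the supremum over the empty set is zero.\<close>

definition DL1_dual_seminorm ::
    "(real \<Rightarrow> 'k) set \<Rightarrow> ((real \<Rightarrow> 'k::{real_normed_field,euclidean_space}) \<Rightarrow> 'x::real_normed_vector) \<Rightarrow> ennreal" where
  "DL1_dual_seminorm V S = (SUP \<phi>\<in>V. ennreal (norm (S \<phi>)))"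

definition DL1_dual_topology ::
    "('k \<Rightarrow> 'x \<Rightarrow> 'x) \<Rightarrow> ((real \<Rightarrow> 'k::{real_normed_field,euclidean_space}) \<Rightarrow> 'x::real_normed_vector) topology" where
  "DL1_dual_topology smul = topology_generated_by
     {{R \<in> DL1_dual smul. DL1_dual_seminorm V (\<lambda>\<phi>. R \<phi> - S \<phi>) < ennreal \<epsilon>} | S V \<epsilon>.
        S \<in> DL1_dual smul \<and> DL1_bounded V \<and> 0 < \<epsilon>}"

text \<open>The identification of a distribution with its (unique) continuous extension to \<open>DL1\<close>.\<close>

definition is_DL1_extension ::
    "('k \<Rightarrow> 'x \<Rightarrow> 'x) \<Rightarrow> ((real \<Rightarrow> 'k::{real_normed_field,euclidean_space}) \<Rightarrow> 'x::real_normed_vector)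
       \<Rightarrow> ((real \<Rightarrow> 'k) \<Rightarrow> 'x) \<Rightarrow> bool" where
  "is_DL1_extension smul T S \<longleftrightarrow> S \<in> DL1_dual smul \<and> (\<forall>\<phi>\<in>test_funs. S \<phi> = T \<phi>)"

definition DL1_extendable ::
    "('k \<Rightarrow> 'x \<Rightarrow> 'x) \<Rightarrow> ((real \<Rightarrow> 'k::{real_normed_field,euclidean_space}) \<Rightarrow> 'x::real_normed_vector) \<Rightarrow> bool" where
  "DL1_extendable smul T \<longleftrightarrow> (\<exists>S. is_DL1_extension smul T S)"

definition DL1_ext ::
    "('k \<Rightarrow> 'x \<Rightarrow> 'x) \<Rightarrow> ((real \<Rightarrow> 'k::{real_normed_field,euclidean_space}) \<Rightarrow> 'x::real_normed_vector)
       \<Rightarrow> (real \<Rightarrow> 'k) \<Rightarrow> 'x" where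
  "DL1_ext smul T = (THE S. is_DL1_extension smul T S)"

end

theory Submission
  imports Defs
begin

text \<open>
  The heart of the matter is the estimate
  \<open>norm ((T * \<phi>) x) \<le> C * Cnorm m \<phi>\<close> for all test functions \<open>\<phi>\<close> supported in \<open>[-1, 1]\<close> and
  all \<open>x\<close>, for one seminorm \<open>Cnorm m\<close> of the topology of uniform convergence of all derivatives
  (\<open>conv_estimate\<close>). If \<open>T * \<phi> \<in> A\<close> for every \<open>\<phi>\<close>, the inclusion of \<open>A\<close> in \<open>\<D>'\<close> of
  \<open>L\<^sup>\<infinity>\<close> says that every \<open>T * \<phi> * \<psi>\<close> is bounded. Two applications of the principle of
  uniform boundedness on the Frechet space of test functions supported in \<open>[-1, 1]\<close>, one in each
  of \<open>\<phi>\<close> and \<open>\<psi>\<close>, turn this into an estimate that is uniform in \<open>x\<close> and bilinear in the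
  seminorms (\<open>double_conv_estimate\<close>).

  The second ingredient plays the role of a parametrix. For every \<open>M\<close> there are a test function
  \<open>\<rho>\<close> of integral 1, test functions \<open>\<Theta> K\<close> and an order \<open>n\<close> such that the mollifiers
  \<open>\<rho>\<^sub>K x = 2 ^ K * \<rho> (2 ^ K * x)\<close> satisfy \<open>\<rho>\<^sub>K = \<rho> + (\<Theta> K)\<^sup>(\<^sup>n\<^sup>)\<close>, all supported in
  \<open>[-1, 1]\<close>, and \<open>\<Theta>\<close> is Cauchy for \<open>Cnorm M\<close> (\<open>mollifier_corrections\<close>). In the limit
  this would be the identity \<open>\<delta> = \<rho> + \<Theta>\<^sup>(\<^sup>n\<^sup>)\<close> with \<open>\<Theta>\<close> of class \<open>C\<^sup>M\<close>; the finite stages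
  have the advantage that only convolutions with test functions occur. Convolution gives
  \<open>T * \<rho>\<^sub>K = T * \<rho> + (T * \<Theta> K)\<^sup>(\<^sup>n\<^sup>)\<close>.
  Applied to the double convolutions, this identity removes \<open>\<psi>\<close> from the bilinear estimate and
  yields \<open>conv_estimate\<close>. Applied once more, with \<open>M\<close> taken from \<open>conv_estimate\<close>, it shows that the
  functions \<open>T * \<Theta> K \<in> A\<close> converge uniformly, so that their limit \<open>G\<close> lies in \<open>A\<close>. Since
  \<open>T * \<rho>\<^sub>K\<close> tends to \<open>T\<close>, this means \<open>T = F + G\<^sup>(\<^sup>n\<^sup>)\<close> with \<open>F = T * \<rho>\<close>. Moreover
  \<open>T * \<rho>\<^sub>K - T = (T * \<Theta> K - G)\<^sup>(\<^sup>n\<^sup>)\<close>, which on a test function \<open>\<psi>\<close> is at most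
  \<open>\<epsilon>\<^sub>K\<close> times the \<open>L\<^sup>1\<close> norm of \<open>\<psi>\<^sup>(\<^sup>n\<^sup>)\<close>, where \<open>\<epsilon>\<^sub>K\<close> tends to 0
  (\<open>structure_theorem\<close>). This is the representation by two continuous functions, the
  extendability of \<open>T\<close> to \<open>\<D>\<^sub>L\<^sub>1\<close>, and the approximation by smooth elements of \<open>A\<close> in the
  dual of \<open>\<D>\<^sub>L\<^sub>1\<close>, all at once. Every element of \<open>A\<close> satisfies the hypothesis on \<open>T\<close>, hence it
  extends to \<open>\<D>\<^sub>L\<^sub>1\<close> too.

  The way back is short. Convolution moves derivatives to the test function, which handles sums
  of derivatives (\<open>D'_of_sum_derivatives\<close>). For the approximation statements, the functions
  \<open>y \<mapsto> \<phi> (x - y)\<close>, \<open>x\<close> real, form a bounded subset of \<open>\<D>\<^sub>L\<^sub>1\<close>; approximating \<open>T\<close>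
  uniformly on this set is approximating \<open>T * \<phi>\<close> uniformly on the line, and \<open>A\<close> is closed under
  such limits (\<open>D'_of_if_approximable\<close>).
\<close>

section \<open>Iterated derivatives and smooth functions\<close>

lemma nderiv_0 [simp]: "nderiv 0 f = f"
  by (simp add: nderiv_def)

lemma nderiv_Suc: "nderiv (Suc n) f = (\<lambda>x. vector_derivative (nderiv n f) (at x))"
  by (simp add: nderiv_def)

lemma nderiv_nderiv: "nderiv m (nderiv n f) = nderiv (m + n) f"
  by (simp add: nderiv_def funpow_add)

lemma nderiv_has_vector_derivative:
  assumes "smooth f"
  shows "(nderiv n f has_vector_derivative nderiv (Suc n) f x) (at x)"
  using assms unfolding smooth_def nderiv_Suc by (simp add: vector_derivative_works)

lemma smooth_has_vector_derivative:
  assumes "smooth f"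
  shows "(f has_vector_derivative nderiv (Suc 0) f x) (at x)"
  using nderiv_has_vector_derivative[OF assms, of 0] by simp

lemma smooth_nderiv: "smooth f \<Longrightarrow> smooth (nderiv n f)"
  by (simp add: smooth_def nderiv_nderiv)

lemma smooth_continuous_nderiv: "smooth f \<Longrightarrow> continuous_on S (nderiv n f)"
  by (meson continuous_at_imp_continuous_on differentiable_imp_continuous_within smooth_def)

lemma smooth_continuous: "smooth f \<Longrightarrow> continuous_on S f"
  using smooth_continuous_nderiv[of f S 0] by simp

text \<open>
  A sequence of functions, each the derivative of its predecessor, both certifies smoothness and
  identifies all iterated derivatives. Exhibiting such a sequence is how derivatives of concrete
  functions are computed below.
\<close>

lemma derivative_tower:
  assumes "\<And>n x. (g n has_vector_derivative g (Suc n) x) (at x)"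
  shows "smooth (g 0)" and "nderiv n (g 0) = g n"
proof -
  have *: "nderiv n (g 0) = g n" for n
  proof (induction n)
    case (Suc n)
    then show ?case
      using assms by (auto simp: nderiv_Suc vector_derivative_at)
  qed simp
  show "nderiv n (g 0) = g n" by (rule *)
  show "smooth (g 0)"
    unfolding smooth_def * using assms differentiableI_vector by blast
qed

text \<open>
  A set of functions that contains a derivative of each of its members contains a whole tower above
  each of them. This gives smoothness where explicit formulas for the higher derivatives would be
  unwieldy.
\<close>

lemma smooth_coinduct:
  assumes "f \<in> C"
    and step: "\<And>f. f \<in> C \<Longrightarrow> \<exists>f'\<in>C. \<forall>x. (f has_vector_derivative f' x) (at x)"
  shows "smooth f"
proof -
  obtain d where d: "\<And>f. f \<in> C \<Longrightarrow> d f \<in> C \<and> (\<forall>x. (f has_vector_derivative d f x) (at x))"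
    using step by metis
  have "(d ^^ n) f \<in> C" for n
    by (induction n) (use d \<open>f \<in> C\<close> in auto)
  then have "((d ^^ n) f has_vector_derivative (d ^^ Suc n) f x) (at x)" for n x
    using d by simp
  from derivative_tower(1)[where g = "\<lambda>n. (d ^^ n) f", OF this] show ?thesis by simp
qed

lemma smooth_const [simp]: "smooth (\<lambda>x. c)"
  by (rule smooth_coinduct[where C = "range (\<lambda>c x. c)"]) (auto intro!: derivative_eq_intros)

lemma
  assumes "smooth f" "smooth g"
  shows smooth_add: "smooth (\<lambda>x. f x + g x)"
    and nderiv_add: "nderiv n (\<lambda>x. f x + g x) = (\<lambda>x. nderiv n f x + nderiv n g x)"
    and smooth_diff: "smooth (\<lambda>x. f x - g x)"
    and nderiv_diff: "nderiv n (\<lambda>x. f x - g x) = (\<lambda>x. nderiv n f x - nderiv n g x)"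
proof -
  have "((\<lambda>x. nderiv n f x + nderiv n g x) has_vector_derivative
          nderiv (Suc n) f x + nderiv (Suc n) g x) (at x)"
       "((\<lambda>x. nderiv n f x - nderiv n g x) has_vector_derivative
          nderiv (Suc n) f x - nderiv (Suc n) g x) (at x)" for n x
    by (intro has_vector_derivative_add has_vector_derivative_diff
        nderiv_has_vector_derivative assms)+
  note * = derivative_tower[where g = "\<lambda>n x. nderiv n f x + nderiv n g x", OF this(1)]
    derivative_tower[where g = "\<lambda>n x. nderiv n f x - nderiv n g x", OF this(2)]
  show "smooth (\<lambda>x. f x + g x)" "smooth (\<lambda>x. f x - g x)"
    using * by simp_all
  show "nderiv n (\<lambda>x. f x + g x) = (\<lambda>x. nderiv n f x + nderiv n g x)"
       "nderiv n (\<lambda>x. f x - g x) = (\<lambda>x. nderiv n f x - nderiv n g x)"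
    using *(2,4)[of n] by simp_all
qed

lemma
  assumes "smooth f" "bounded_linear h"
  shows smooth_linear: "smooth (\<lambda>x. h (f x))"
    and nderiv_linear: "nderiv n (\<lambda>x. h (f x)) = (\<lambda>x. h (nderiv n f x))"
proof -
  have "((\<lambda>x. h (nderiv n f x)) has_vector_derivative h (nderiv (Suc n) f x)) (at x)" for n x
    by (rule bounded_linear.has_vector_derivative[OF assms(2) nderiv_has_vector_derivative[OF assms(1)]])
  note * = derivative_tower[where g = "\<lambda>n x. h (nderiv n f x)", OF this]
  show "smooth (\<lambda>x. h (f x))" "nderiv n (\<lambda>x. h (f x)) = (\<lambda>x. h (nderiv n f x))"
    using *(1) *(2)[of n] by simp_all
qed

lemma
  assumes "smooth f"
  shows smooth_affine: "smooth (\<lambda>x. f (a * x + b))"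
    and nderiv_affine: "nderiv n (\<lambda>x. f (a * x + b)) = (\<lambda>x. a ^ n *\<^sub>R nderiv n f (a * x + b))"
proof -
  have "((\<lambda>x. a ^ n *\<^sub>R nderiv n f (a * x + b)) has_vector_derivative
          a ^ Suc n *\<^sub>R nderiv (Suc n) f (a * x + b)) (at x)" for n x
  proof -
    have "((\<lambda>x. a * x + b) has_vector_derivative a) (at x)"
      by (auto intro!: derivative_eq_intros)
    from vector_diff_chain_at[OF this nderiv_has_vector_derivative[OF assms, of n]]
    have "((\<lambda>x. nderiv n f (a * x + b)) has_vector_derivative a *\<^sub>R nderiv (Suc n) f (a * x + b)) (at x)"
      by (simp add: o_def)
    from bounded_linear.has_vector_derivative[OF bounded_linear_scaleR_right this, of "a ^ n"]
    show ?thesis by (simp add: mult.commute)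
  qed
  note * = derivative_tower[where g = "\<lambda>n x. a ^ n *\<^sub>R nderiv n f (a * x + b)", OF this]
  show "smooth (\<lambda>x. f (a * x + b))"
       "nderiv n (\<lambda>x. f (a * x + b)) = (\<lambda>x. a ^ n *\<^sub>R nderiv n f (a * x + b))"
    using *(1) *(2)[of n] by simp_all
qed

lemma
  assumes "smooth f"
  shows smooth_reflect: "smooth (\<lambda>y. f (x - y))"
    and nderiv_reflect: "nderiv n (\<lambda>y. f (x - y)) = (\<lambda>y. (-1) ^ n *\<^sub>R nderiv n f (x - y))"
  using smooth_affine[OF assms, of "-1" x] nderiv_affine[OF assms, of n "-1" x] by simp_all

text \<open>
  The product rule leads from products of smooth functions to sums of such products, and no
  further: the Leibniz formula can be avoided.
\<close>

inductive_set product_sums :: "(real \<Rightarrow> 'a::real_normed_algebra) set" where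
  prod: "smooth f \<Longrightarrow> smooth g \<Longrightarrow> (\<lambda>x. f x * g x) \<in> product_sums"
| sum: "u \<in> product_sums \<Longrightarrow> v \<in> product_sums \<Longrightarrow> (\<lambda>x. u x + v x) \<in> product_sums"

lemma smooth_mult:
  fixes f g :: "real \<Rightarrow> 'a::real_normed_algebra"
  assumes "smooth f" "smooth g"
  shows "smooth (\<lambda>x. f x * g x)"
proof (rule smooth_coinduct[where C = product_sums])
  show "(\<lambda>x. f x * g x) \<in> product_sums"
    using assms by (rule product_sums.prod)
next
  fix u :: "real \<Rightarrow> 'a"
  assume "u \<in> product_sums"
  then show "\<exists>u'\<in>product_sums. \<forall>x. (u has_vector_derivative u' x) (at x)"
  proof induction
    case (prod f g)
    then have "(\<lambda>x. f x * nderiv (Suc 0) g x + nderiv (Suc 0) f x * g x) \<in> product_sums"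
      by (intro product_sums.intros smooth_nderiv)
    moreover have "((\<lambda>x. f x * g x) has_vector_derivative
        f x * nderiv (Suc 0) g x + nderiv (Suc 0) f x * g x) (at x)" for x
      using prod by (intro has_vector_derivative_mult smooth_has_vector_derivative)
    ultimately show ?case by (intro bexI) auto
  next
    case (sum u v)
    then obtain u' v' where "u' \<in> product_sums" "\<And>x. (u has_vector_derivative u' x) (at x)"
      and "v' \<in> product_sums" "\<And>x. (v has_vector_derivative v' x) (at x)" by blast
    then show ?case
      by (intro bexI[of _ "\<lambda>x. u' x + v' x"] allI has_vector_derivative_add product_sums.sum)
  qed
qed

section \<open>Existence of test functions\<close>

text \<open>
  The derivative of \<open>exp (- 1 / x)\<close> involves powers of \<open>1 / x\<close>. Admitting these powers from the
  start yields a family whose linear span is closed under differentiation.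
\<close>

definition flat :: "nat \<Rightarrow> real \<Rightarrow> real" where
  "flat k x = (if 0 < x then exp (- inverse x) * inverse x ^ k else 0)"

text \<open>
  The crucial point is 0, where the difference quotient on the right is \<open>y ^ (k + 1) / exp y\<close> at
  \<open>y = 1 / h\<close>, which vanishes in the limit because the exponential beats every power.
\<close>

lemma flat_has_derivative:
  "(flat k has_real_derivative flat (k + 2) x - k * flat (k + 1) x) (at x)"
proof -
  consider "x > 0" | "x < 0" | "x = 0" by linarith
  then show ?thesis
  proof cases
    case 1
    have "((\<lambda>x. exp (- inverse x) * inverse x ^ k) has_real_derivative
        flat (k + 2) x - k * flat (k + 1) x) (at x)"
      using 1
      apply (auto intro!: derivative_eq_intros simp: flat_def field_simps power2_eq_square)
      apply (cases k; simp add: field_simps)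
      done
    moreover have "eventually (\<lambda>y. exp (- inverse y) * inverse y ^ k = flat k y) (nhds x)"
      using eventually_nhds_in_open[of "{0<..}" x] 1
      by (auto elim!: eventually_mono simp: flat_def)
    ultimately show ?thesis
      by (subst (asm) DERIV_cong_ev[OF refl _ refl]) auto
  next
    case 2
    have "eventually (\<lambda>y. 0 = flat k y) (nhds x)"
      using eventually_nhds_in_open[of "{..<0}" x] 2
      by (auto elim!: eventually_mono simp: flat_def)
    moreover have "((\<lambda>x. 0) has_real_derivative flat (k + 2) x - k * flat (k + 1) x) (at x)"
      using 2 by (simp add: flat_def)
    ultimately show ?thesis
      by (subst (asm) DERIV_cong_ev[OF refl _ refl]) auto
  next
    case 3
    have "((\<lambda>y. y ^ Suc k / exp y) \<longlongrightarrow> (0::real)) at_top"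
      by (rule tendsto_power_div_exp_0)
    from filterlim_compose[OF this filterlim_inverse_at_top_right]
    have "((\<lambda>y. inverse y ^ Suc k / exp (inverse y)) \<longlongrightarrow> (0::real)) (at_right 0)" .
    then have "((\<lambda>h. (flat k (0 + h) - flat k 0) / h) \<longlongrightarrow> 0) (at_right 0)"
      by (rule Lim_transform_eventually)
        (auto simp: eventually_at_right_field flat_def field_simps exp_minus intro!: exI[of _ 1])
    moreover have "((\<lambda>h. (flat k (0 + h) - flat k 0) / h) \<longlongrightarrow> 0) (at_left 0)"
      by (rule Lim_transform_eventually[OF tendsto_const])
        (auto simp: eventually_at_left_field flat_def intro!: exI[of _ "-1"])
    ultimately have "((\<lambda>h. (flat k (0 + h) - flat k 0) / h) \<longlongrightarrow> 0) (at 0)"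
      by (intro filterlim_split_at)
    then show ?thesis
      using 3 by (simp add: DERIV_def flat_def)
  qed
qed

inductive_set flat_combinations :: "(real \<Rightarrow> real) set" where
  single: "(\<lambda>x. c * flat k x) \<in> flat_combinations"
| sum: "u \<in> flat_combinations \<Longrightarrow> v \<in> flat_combinations \<Longrightarrow> (\<lambda>x. u x + v x) \<in> flat_combinations"

lemma smooth_flat: "smooth (flat 0)"
proof (rule smooth_coinduct[where C = flat_combinations])
  show "flat 0 \<in> flat_combinations"
    using flat_combinations.single[of 1 0] by simp
next
  fix u
  assume "u \<in> flat_combinations"
  then show "\<exists>u'\<in>flat_combinations. \<forall>x. (u has_vector_derivative u' x) (at x)"
  proof induction
    case (single c k)
    have "(\<lambda>x. c * flat (k + 2) x + (- c * k) * flat (k + 1) x) \<in> flat_combinations"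
      by (intro flat_combinations.intros)
    moreover have "((\<lambda>x. c * flat k x) has_vector_derivative
        c * flat (k + 2) x + (- c * k) * flat (k + 1) x) (at x)" for x
      using DERIV_cmult[OF flat_has_derivative, of c k x]
      by (simp add: has_real_derivative_iff_has_vector_derivative algebra_simps)
    ultimately show ?case by (intro bexI) auto
  next
    case (sum u v)
    then obtain u' v' where "u' \<in> flat_combinations" "\<And>x. (u has_vector_derivative u' x) (at x)"
      and "v' \<in> flat_combinations" "\<And>x. (v has_vector_derivative v' x) (at x)" by blast
    then show ?case
      by (intro bexI[of _ "\<lambda>x. u' x + v' x"] allI has_vector_derivative_add flat_combinations.sum)
  qed
qed

definition bump :: "real \<Rightarrow> real" where
  "bump x = flat 0 x * flat 0 (1 - x)"

lemma smooth_bump: "smooth bump"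
  unfolding bump_def[abs_def] by (intro smooth_mult smooth_flat smooth_reflect)

lemma bump_nonneg: "0 \<le> bump x"
  by (simp add: bump_def flat_def)

lemma bump_pos_iff: "bump x \<noteq> 0 \<longleftrightarrow> 0 < x \<and> x < 1"
  by (simp add: bump_def flat_def)

section \<open>Test functions with a fixed support and their seminorms\<close>

text \<open>
  For fixed \<open>R\<close> this is a Frechet space; the test functions are the union of these spaces.
\<close>

definition tests :: "real \<Rightarrow> (real \<Rightarrow> 'a::real_normed_vector) set" where
  "tests R = {\<phi>. smooth \<phi> \<and> (\<forall>x. R < \<bar>x\<bar> \<longrightarrow> \<phi> x = 0)}"

lemma tests_smooth: "\<phi> \<in> tests R \<Longrightarrow> smooth \<phi>"
  and tests_zero: "\<phi> \<in> tests R \<Longrightarrow> R < \<bar>x\<bar> \<Longrightarrow> \<phi> x = 0"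
  by (simp_all add: tests_def)

lemma tests_mono: "R \<le> R' \<Longrightarrow> tests R \<subseteq> tests R'"
  by (auto simp: tests_def)

lemma tests_test_funs: "\<phi> \<in> tests R \<Longrightarrow> \<phi> \<in> test_funs"
proof -
  assume \<phi>: "\<phi> \<in> tests R"
  then have "{x. \<phi> x \<noteq> 0} \<subseteq> cball 0 R"
    by (auto simp: tests_def not_less[symmetric])
  then have "closure {x. \<phi> x \<noteq> 0} \<subseteq> cball 0 R"
    by (simp add: closure_minimal)
  then have "compact (closure {x. \<phi> x \<noteq> 0})"
    by (meson bounded_cball bounded_subset closed_closure compact_eq_bounded_closed)
  with \<phi> show ?thesis by (simp add: test_funs_def tests_def)
qed

lemma test_funs_tests:
  assumes "\<phi> \<in> test_funs"
  obtains R where "0 < R" "\<phi> \<in> tests R"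
proof -
  have "bounded {x. \<phi> x \<noteq> 0}"
    using assms by (auto simp: test_funs_def intro: bounded_subset[OF compact_imp_bounded closure_subset])
  then obtain R where "0 < R" "\<And>x. \<phi> x \<noteq> 0 \<Longrightarrow> \<bar>x\<bar> \<le> R"
    by (auto simp: bounded_pos)
  then show ?thesis
    using that[of R] assms by (force simp: tests_def test_funs_def)
qed

lemma test_funs_smooth: "\<phi> \<in> test_funs \<Longrightarrow> smooth \<phi>"
  by (simp add: test_funs_def)

lemma tests_nderiv: "\<phi> \<in> tests R \<Longrightarrow> nderiv n \<phi> \<in> tests R"
proof -
  assume \<phi>: "\<phi> \<in> tests R"
  have "nderiv n \<phi> x = 0" if "R < \<bar>x\<bar>" for x
    using that
  proof (induction n arbitrary: x)
    case 0
    then show ?case using \<phi> by (simp add: tests_zero)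
  next
    case (Suc n)
    have "open {x::real. R < \<bar>x\<bar>}"
      by (intro open_Collect_less continuous_intros)
    then have "((\<lambda>x. 0) has_vector_derivative nderiv (Suc n) \<phi> x) (at x)"
      using Suc nderiv_has_vector_derivative[OF tests_smooth[OF \<phi>], of n x]
      by (rule_tac has_vector_derivative_transform_within_open[where S = "{x. R < \<bar>x\<bar>}" and f = "nderiv n \<phi>"]) simp_all
    from vector_derivative_unique_at[OF this has_vector_derivative_const]
    show ?case by simp
  qed
  with \<phi> show ?thesis by (simp add: tests_def smooth_nderiv)
qed

lemma test_funs_nderiv: "\<phi> \<in> test_funs \<Longrightarrow> nderiv n \<phi> \<in> test_funs"
  by (meson test_funs_tests tests_nderiv tests_test_funs)

lemma tests_add: "\<phi> \<in> tests R \<Longrightarrow> \<psi> \<in> tests R \<Longrightarrow> (\<lambda>x. \<phi> x + \<psi> x) \<in> tests R"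
  and tests_diff: "\<phi> \<in> tests R \<Longrightarrow> \<psi> \<in> tests R \<Longrightarrow> (\<lambda>x. \<phi> x - \<psi> x) \<in> tests R"
  by (simp_all add: tests_def smooth_add smooth_diff)

lemma tests_linear: "\<phi> \<in> tests R \<Longrightarrow> bounded_linear h \<Longrightarrow> (\<lambda>x. h (\<phi> x)) \<in> tests R"
  by (simp add: tests_def smooth_linear linear_simps(3))

lemma tests_scaleR: "\<phi> \<in> tests R \<Longrightarrow> (\<lambda>x. c *\<^sub>R \<phi> x) \<in> tests R"
  by (rule tests_linear[OF _ bounded_linear_scaleR_right])

lemma tests_cmult:
  fixes \<phi> :: "real \<Rightarrow> 'a::real_normed_algebra"
  shows "\<phi> \<in> tests R \<Longrightarrow> (\<lambda>x. c * \<phi> x) \<in> tests R"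
  by (rule tests_linear[OF _ bounded_linear_mult_right])

lemma tests_zero_fun: "(\<lambda>x. 0) \<in> tests R"
  by (simp add: tests_def)

lemma tests_sum: "finite I \<Longrightarrow> (\<And>i. i \<in> I \<Longrightarrow> \<phi> i \<in> tests R) \<Longrightarrow> (\<lambda>x. \<Sum>i\<in>I. \<phi> i x) \<in> tests R"
  by (induction I rule: finite_induct) (simp_all add: tests_zero_fun tests_add)

lemma tests_reflect: "\<phi> \<in> tests R \<Longrightarrow> (\<lambda>y. \<phi> (x - y)) \<in> tests (R + \<bar>x\<bar>)"
  by (auto simp: tests_def smooth_reflect)

lemma test_funs_reflect: "\<phi> \<in> test_funs \<Longrightarrow> (\<lambda>y. \<phi> (x - y)) \<in> test_funs"
  by (erule test_funs_tests) (rule tests_test_funs, erule tests_reflect)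

lemma tests_mult:
  fixes \<phi> :: "real \<Rightarrow> 'a::real_normed_algebra"
  shows "\<phi> \<in> tests R \<Longrightarrow> smooth f \<Longrightarrow> (\<lambda>x. \<phi> x * f x) \<in> tests R"
  by (auto simp: tests_def smooth_mult)

lemma test_funs_common:
  assumes "\<phi> \<in> test_funs" "\<psi> \<in> test_funs"
  obtains R where "0 < R" "\<phi> \<in> tests R" "\<psi> \<in> tests R"
proof -
  obtain R S where R: "0 < R" "\<phi> \<in> tests R" and S: "0 < S" "\<psi> \<in> tests S"
    using assms by (metis test_funs_tests)
  show ?thesis
    using R S tests_mono[of R "max R S"] tests_mono[of S "max R S"]
    by (intro that[of "max R S"]) auto
qed

lemma test_funs_add: "\<phi> \<in> test_funs \<Longrightarrow> \<psi> \<in> test_funs \<Longrightarrow> (\<lambda>x. \<phi> x + \<psi> x) \<in> test_funs"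
  by (erule (1) test_funs_common) (rule tests_test_funs, erule (1) tests_add)

lemma test_funs_cmult:
  fixes \<phi> :: "real \<Rightarrow> 'a::real_normed_algebra"
  shows "\<phi> \<in> test_funs \<Longrightarrow> (\<lambda>x. c * \<phi> x) \<in> test_funs"
  by (erule test_funs_tests) (rule tests_test_funs, erule tests_cmult)

definition supnorm :: "(real \<Rightarrow> 'a::real_normed_vector) \<Rightarrow> real" where
  "supnorm f = (SUP x. norm (f x))"

definition Cnorm :: "nat \<Rightarrow> (real \<Rightarrow> 'a::real_normed_vector) \<Rightarrow> real" where
  "Cnorm m \<phi> = (\<Sum>j\<le>m. supnorm (nderiv j \<phi>))"

lemma supnorm_le: "(\<And>x. norm (f x) \<le> c) \<Longrightarrow> supnorm f \<le> c"
  unfolding supnorm_def by (rule cSUP_least) auto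

lemma norm_le_supnorm:
  assumes "\<phi> \<in> tests R"
  shows "norm (\<phi> x) \<le> supnorm \<phi>"
proof -
  have "compact ((\<lambda>x. norm (\<phi> x)) ` {- R..R})"
    by (intro compact_continuous_image continuous_on_norm smooth_continuous tests_smooth[OF assms]) auto
  from compact_imp_bounded[OF this]
  obtain B where B: "0 < B" "\<And>x. x \<in> {- R..R} \<Longrightarrow> norm (\<phi> x) \<le> B"
    by (auto simp: bounded_pos)
  have "norm (\<phi> x) \<le> B" for x
  proof (cases "R < \<bar>x\<bar>")
    case True
    then show ?thesis using B tests_zero[OF assms] by simp
  next
    case False
    then show ?thesis by (intro B) (auto simp: not_less abs_le_iff)
  qed
  then have "bdd_above (range (\<lambda>x. norm (\<phi> x)))" by (intro bdd_aboveI[where M = B]) auto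
  then show ?thesis unfolding supnorm_def by (rule cSUP_upper[OF UNIV_I])
qed

lemma supnorm_nonneg: "\<phi> \<in> tests R \<Longrightarrow> 0 \<le> supnorm \<phi>"
  using norm_le_supnorm order_trans norm_ge_zero by blast

lemma Cnorm_nonneg: "\<phi> \<in> tests R \<Longrightarrow> 0 \<le> Cnorm m \<phi>"
  unfolding Cnorm_def by (meson sum_nonneg supnorm_nonneg tests_nderiv)

lemma norm_nderiv_le_Cnorm:
  assumes "\<phi> \<in> tests R" "j \<le> m"
  shows "norm (nderiv j \<phi> x) \<le> Cnorm m \<phi>"
proof -
  have "norm (nderiv j \<phi> x) \<le> supnorm (nderiv j \<phi>)"
    by (meson assms norm_le_supnorm tests_nderiv)
  also have "\<dots> \<le> Cnorm m \<phi>"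
    unfolding Cnorm_def using assms
    by (intro member_le_sum) (auto intro: supnorm_nonneg tests_nderiv)
  finally show ?thesis .
qed

lemma Cnorm_le:
  assumes "\<And>j x. j \<le> m \<Longrightarrow> norm (nderiv j \<phi> x) \<le> c"
  shows "Cnorm m \<phi> \<le> (m + 1) * c"
proof -
  have "Cnorm m \<phi> \<le> of_nat (card {..m}) * c"
    unfolding Cnorm_def using assms by (intro sum_bounded_above supnorm_le) auto
  then show ?thesis by (simp add: add.commute)
qed

lemma Cnorm_mono: "\<phi> \<in> tests R \<Longrightarrow> m \<le> m' \<Longrightarrow> Cnorm m \<phi> \<le> Cnorm m' \<phi>"
  unfolding Cnorm_def
  by (rule sum_mono2) (auto intro: supnorm_nonneg tests_nderiv)

lemma Cnorm_triangle:
  assumes "\<phi> \<in> tests R" "\<psi> \<in> tests R"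
  shows "Cnorm m (\<lambda>x. \<phi> x + \<psi> x) \<le> Cnorm m \<phi> + Cnorm m \<psi>"
    and "Cnorm m (\<lambda>x. \<phi> x - \<psi> x) \<le> Cnorm m \<phi> + Cnorm m \<psi>"
proof -
  have 1: "norm (nderiv j \<phi> x) \<le> supnorm (nderiv j \<phi>)" "norm (nderiv j \<psi> x) \<le> supnorm (nderiv j \<psi>)" for j x
    by (meson assms norm_le_supnorm tests_nderiv)+
  show "Cnorm m (\<lambda>x. \<phi> x + \<psi> x) \<le> Cnorm m \<phi> + Cnorm m \<psi>"
    unfolding Cnorm_def sum.distrib[symmetric]
    using assms 1 by (intro sum_mono supnorm_le)
      (simp add: nderiv_add tests_smooth add_mono norm_triangle_le)
  show "Cnorm m (\<lambda>x. \<phi> x - \<psi> x) \<le> Cnorm m \<phi> + Cnorm m \<psi>"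
    unfolding Cnorm_def sum.distrib[symmetric]
    using assms 1 by (intro sum_mono supnorm_le)
      (simp add: nderiv_diff tests_smooth add_mono norm_triangle_le_diff)
qed

lemma Cnorm_scaleR:
  assumes "\<phi> \<in> tests R"
  shows "Cnorm m (\<lambda>x. c *\<^sub>R \<phi> x) \<le> \<bar>c\<bar> * Cnorm m \<phi>"
  unfolding Cnorm_def sum_distrib_left
proof (intro sum_mono supnorm_le)
  fix j x
  have "norm (nderiv j \<phi> x) \<le> supnorm (nderiv j \<phi>)"
    by (meson assms norm_le_supnorm tests_nderiv)
  then show "norm (nderiv j (\<lambda>x. c *\<^sub>R \<phi> x) x) \<le> \<bar>c\<bar> * supnorm (nderiv j \<phi>)"
    using nderiv_linear[OF tests_smooth[OF assms] bounded_linear_scaleR_right, of j c]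
    by (simp add: mult_left_mono)
qed

lemma Cnorm_reflect:
  assumes "smooth \<phi>"
  shows "Cnorm m (\<lambda>y. \<phi> (x - y)) = Cnorm m \<phi>"
proof -
  have "supnorm (nderiv j (\<lambda>y. \<phi> (x - y))) = supnorm (nderiv j \<phi>)" for j
  proof -
    have "range (\<lambda>y. norm (nderiv j \<phi> (x - y))) = range (\<lambda>y. norm (nderiv j \<phi> y))"
      by (auto simp: image_iff) (metis diff_diff_eq2 add_diff_cancel_left')
    then show ?thesis
      by (simp add: supnorm_def nderiv_reflect[OF assms])
  qed
  then show ?thesis by (simp add: Cnorm_def)
qed

lemma Cnorm_nderiv:
  assumes "\<phi> \<in> tests R"
  shows "Cnorm m (nderiv n \<phi>) \<le> (m + 1) * Cnorm (m + n) \<phi>"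
  by (rule Cnorm_le) (simp add: nderiv_nderiv norm_nderiv_le_Cnorm[OF assms])

lemma tests_Lipschitz:
  assumes "\<phi> \<in> tests R"
  shows "norm (\<phi> x - \<phi> y) \<le> Cnorm 1 \<phi> * \<bar>x - y\<bar>"
proof -
  have "norm (\<phi> x - \<phi> y) \<le> Cnorm 1 \<phi> * norm (x - y)"
  proof (rule differentiable_bound[of UNIV])
    show "(\<phi> has_derivative (\<lambda>h. h *\<^sub>R nderiv (Suc 0) \<phi> z)) (at z)" for z
      using smooth_has_vector_derivative[OF tests_smooth[OF assms]] has_vector_derivative_def by blast
    show "onorm (\<lambda>h. h *\<^sub>R nderiv (Suc 0) \<phi> z) \<le> Cnorm 1 \<phi>" for z
      using norm_nderiv_le_Cnorm[OF assms, of "Suc 0" 1 z]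
      by (intro onorm_le) (simp add: mult.commute mult_left_mono)
  qed auto
  then show ?thesis by simp
qed

lemma tests_Taylor:
  assumes "\<phi> \<in> tests R"
  shows "norm (\<phi> (x + h) - \<phi> x - h *\<^sub>R nderiv 1 \<phi> x) \<le> Cnorm 2 \<phi> * h\<^sup>2"
proof -
  define S where "S = closed_segment x (x + h)"
  have "norm (\<phi> (x + h) - \<phi> x - (x + h - x) *\<^sub>R nderiv 1 \<phi> x) \<le> norm (x + h - x) * (Cnorm 2 \<phi> * \<bar>h\<bar>)"
  proof (rule vector_differentiable_bound_linearization[of S])
    show "(\<phi> has_vector_derivative nderiv 1 \<phi> z) (at z within S)" for z
      using smooth_has_vector_derivative[OF tests_smooth[OF assms]]
      by (simp add: has_vector_derivative_at_within)
    show "norm (nderiv 1 \<phi> z - nderiv 1 \<phi> x) \<le> Cnorm 2 \<phi> * \<bar>h\<bar>" if "z \<in> S" for z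
    proof -
      have "norm (nderiv 1 \<phi> z - nderiv 1 \<phi> x) \<le> Cnorm 2 \<phi> * norm (z - x)"
      proof (rule differentiable_bound[of UNIV])
        show "(nderiv 1 \<phi> has_derivative (\<lambda>h. h *\<^sub>R nderiv 2 \<phi> z)) (at z)" for z
          using nderiv_has_vector_derivative[OF tests_smooth[OF assms], of 1 z]
          by (simp add: has_vector_derivative_def numeral_2_eq_2)
        show "onorm (\<lambda>h. h *\<^sub>R nderiv 2 \<phi> z) \<le> Cnorm 2 \<phi>" for z
          using norm_nderiv_le_Cnorm[OF assms, of 2 2 z]
          by (intro onorm_le) (simp add: mult.commute mult_left_mono)
      qed auto
      also have "norm (z - x) \<le> \<bar>h\<bar>"
        using that by (auto simp: S_def closed_segment_eq_real_ivl split: if_splits)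
      finally show ?thesis
        using Cnorm_nonneg[OF assms] by (meson mult_left_mono order_trans \<open>norm (z - x) \<le> \<bar>h\<bar>\<close>
          \<open>norm (nderiv 1 \<phi> z - nderiv 1 \<phi> x) \<le> Cnorm 2 \<phi> * norm (z - x)\<close>)
    qed
  qed (auto simp: S_def)
  then show ?thesis by (simp add: power2_eq_square mult.commute mult.left_commute)
qed

text \<open>
  Continuity estimates of a distribution control functions like \<open>x \<mapsto> T (\<phi> (x - \<cdot>))\<close> through
  norms of test functions, where first order Taylor remainders are quadratic in the increment. This
  criterion turns such estimates into derivatives.
\<close>

lemma has_vector_derivative_quadratic:
  fixes u :: "real \<Rightarrow> 'a::real_normed_vector"
  assumes "\<And>h. x + h \<in> S \<Longrightarrow> \<bar>h\<bar> \<le> 1 \<Longrightarrow> norm (u (x + h) - u x - h *\<^sub>R v) \<le> C * h\<^sup>2"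
  shows "(u has_vector_derivative v) (at x within S)"
  unfolding has_vector_derivative_def has_derivative_within_alt
proof (intro conjI allI impI)
  fix e :: real
  assume "0 < e"
  define d where "d = min 1 (e / (\<bar>C\<bar> + 1))"
  have "0 < d" using \<open>0 < e\<close> by (simp add: d_def)
  moreover have "norm (u y - u x - (y - x) *\<^sub>R v) \<le> e * norm (y - x)" if "y \<in> S" "norm (y - x) < d" for y
  proof -
    have "norm (u y - u x - (y - x) *\<^sub>R v) \<le> C * (y - x)\<^sup>2"
      using assms[of "y - x"] that by (simp add: d_def)
    also have "\<dots> \<le> \<bar>C\<bar> * (\<bar>y - x\<bar> * \<bar>y - x\<bar>)"
      by (simp add: power2_eq_square abs_mult[symmetric] mult_right_mono)
    also have "\<dots> = (\<bar>C\<bar> * \<bar>y - x\<bar>) * \<bar>y - x\<bar>" by simp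
    also have "\<dots> \<le> e * \<bar>y - x\<bar>"
    proof (rule mult_right_mono)
      have "\<bar>C\<bar> * \<bar>y - x\<bar> \<le> (\<bar>C\<bar> + 1) * (e / (\<bar>C\<bar> + 1))"
        using that by (intro mult_mono) (auto simp: d_def)
      also have "\<dots> = e" by simp
      finally show "\<bar>C\<bar> * \<bar>y - x\<bar> \<le> e" .
    qed simp
    finally show ?thesis by simp
  qed
  ultimately show "\<exists>d>0. \<forall>y\<in>S. norm (y - x) < d \<longrightarrow> norm (u y - u x - (y - x) *\<^sub>R v) \<le> e * norm (y - x)"
    by blast
qed (rule bounded_linear_scaleR_left)

section \<open>Integrals of continuous functions with compact support\<close>

lemma has_integral_compact_support:
  fixes f :: "real \<Rightarrow> 'a::banach"
  assumes "continuous_on {a..b} f" "\<And>x. x \<notin> {a..b} \<Longrightarrow> f x = 0"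
  shows "(f has_integral integral {a..b} f) UNIV"
  by (rule has_integral_on_superset[OF integrable_integral[OF integrable_continuous_real[OF assms(1)]]])
    (use assms(2) in auto)

lemma
  fixes f :: "real \<Rightarrow> 'a::banach"
  assumes "continuous_on {a..b} f" "\<And>x. x \<notin> {a..b} \<Longrightarrow> f x = 0"
  shows integrable_compact_support: "f integrable_on UNIV"
    and integral_compact_support: "integral UNIV f = integral {a..b} f"
  using has_integral_compact_support[OF assms] by (auto simp: integral_unique)

lemma integral_affine:
  fixes f :: "real \<Rightarrow> 'a::banach"
  assumes f: "continuous_on {a..b} f" "\<And>x. x \<notin> {a..b} \<Longrightarrow> f x = 0" and m: "m \<noteq> 0"
  shows "integral UNIV (\<lambda>x. f (m * x + c)) = (1 / \<bar>m\<bar>) *\<^sub>R integral UNIV f"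
proof -
  have "(f has_integral integral {a..b} f) (cbox a b)"
    using f(1) by (simp add: integrable_continuous_real integrable_integral)
  from has_integral_affinity[OF this m, of c]
  have "((\<lambda>x. f (m * x + c)) has_integral (1 / \<bar>m\<bar>) *\<^sub>R integral {a..b} f)
          ((\<lambda>x. (1 / m) * x + - ((1 / m) * c)) ` {a..b})" by simp
  then have "((\<lambda>x. f (m * x + c)) has_integral (1 / \<bar>m\<bar>) *\<^sub>R integral {a..b} f) UNIV"
  proof (rule has_integral_on_superset)
    fix x assume *: "x \<notin> (\<lambda>x. (1 / m) * x + - ((1 / m) * c)) ` {a..b}"
    have "x = (1 / m) * (m * x + c) + - ((1 / m) * c)" using m by (simp add: field_simps)
    then have "m * x + c \<notin> {a..b}" using * by blast
    then show "f (m * x + c) = 0" by (rule f(2))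
  qed simp
  then show ?thesis
    using integral_compact_support[OF f] by (simp add: integral_unique)
qed

lemma tests_support: "\<phi> \<in> tests R \<Longrightarrow> x \<notin> {- R..R} \<Longrightarrow> \<phi> x = 0"
  by (rule tests_zero) auto

lemma tests_integral:
  fixes \<phi> :: "real \<Rightarrow> 'a::banach"
  assumes "\<phi> \<in> tests R"
  shows "\<phi> integrable_on UNIV" "integral UNIV \<phi> = integral {- R..R} \<phi>"
  by (rule integrable_compact_support integral_compact_support,
      rule smooth_continuous[OF tests_smooth[OF assms]], erule tests_support[OF assms])+

text \<open>
  The antiderivative from the left vanishes to the left of the support, and to its right it equals
  the integral over the whole line, which is zero.
\<close>

lemma tests_antiderivative:
  fixes \<theta> :: "real \<Rightarrow> 'a::banach"
  assumes \<theta>: "\<theta> \<in> tests R" and "0 < R" and int0: "integral UNIV \<theta> = 0"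
  obtains \<zeta> where "\<zeta> \<in> tests R" "nderiv 1 \<zeta> = \<theta>"
proof -
  define \<zeta> where "\<zeta> x = integral {- R - 1..x} \<theta>" for x
  have cont: "continuous_on S \<theta>" for S
    by (rule smooth_continuous[OF tests_smooth[OF \<theta>]])
  have zero: "\<zeta> x = 0" if "R < \<bar>x\<bar>" for x
  proof (cases "x < 0")
    case True
    have "\<zeta> x = integral {- R - 1..x} (\<lambda>_. 0)"
      unfolding \<zeta>_def using that True tests_zero[OF \<theta>] by (intro integral_cong) auto
    then show ?thesis by simp
  next
    case False
    have "integral UNIV \<theta> = \<zeta> x"
      unfolding \<zeta>_def using that False tests_zero[OF \<theta>]
      by (intro integral_compact_support cont) auto
    then show ?thesis using int0 by simp
  qed
  have deriv: "(\<zeta> has_vector_derivative \<theta> x) (at x)" for x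
  proof (cases "R < \<bar>x\<bar>")
    case True
    have "open {x::real. R < \<bar>x\<bar>}"
      by (intro open_Collect_less continuous_intros)
    then have "(\<zeta> has_vector_derivative 0) (at x)"
      using True zero
      by (rule_tac has_vector_derivative_transform_within_open[where S = "{x. R < \<bar>x\<bar>}" and f = "\<lambda>_. 0"]) simp_all
    then show ?thesis using True tests_zero[OF \<theta>] by simp
  next
    case False
    have "(\<zeta> has_vector_derivative \<theta> x) (at x within {- R - 1..R + 1})"
      unfolding \<zeta>_def[abs_def]
      by (rule integral_has_vector_derivative[OF cont]) (use False in \<open>auto simp: not_less abs_le_iff\<close>)
    moreover have "x \<in> interior {- R - 1..R + 1}"
      using False by (auto simp: not_less abs_le_iff)
    ultimately show ?thesis using at_within_interior[of x "{- R - 1..R + 1}"] by metis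
  qed
  define g where "g n = (case n of 0 \<Rightarrow> \<zeta> | Suc k \<Rightarrow> nderiv k \<theta>)" for n
  have g: "(g n has_vector_derivative g (Suc n) x) (at x)" for n x
    using deriv nderiv_has_vector_derivative[OF tests_smooth[OF \<theta>]]
    by (cases n) (simp_all add: g_def)
  show ?thesis
    using derivative_tower[of g, OF g] zero that[of \<zeta>]
    by (auto simp: g_def tests_def dest: spec[of _ 1])
qed

lemma normed_scaling_mult:
  "normed_scaling ((*) :: 'k \<Rightarrow> 'k \<Rightarrow> 'k::{real_normed_field,euclidean_space})"
  by unfold_locales (auto simp: algebra_simps norm_mult scaleR_conv_of_real)

context normed_scaling
begin

lemma smul_scaleR: "smul (r *\<^sub>R c) x = r *\<^sub>R smul c x" "smul c (r *\<^sub>R x) = r *\<^sub>R smul c x"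
proof -
  show "smul (r *\<^sub>R c) x = r *\<^sub>R smul c x"
    by (simp add: scaleR_conv_of_real scale_scale[symmetric] scale_of_real del: scale_scale)
  show "smul c (r *\<^sub>R x) = r *\<^sub>R smul c x"
    by (simp add: scale_of_real[symmetric] scale_scale mult.commute del: scale_of_real)
qed

lemma bounded_bilinear_smul: "bounded_bilinear smul"
  by unfold_locales (auto simp: scale_left_distrib scale_right_distrib smul_scaleR norm_scale
      intro!: exI[of _ 1])

lemmas bounded_linear_smul = bounded_bilinear.bounded_linear_right[OF bounded_bilinear_smul]

lemma continuous_smul:
  "continuous_on S f \<Longrightarrow> continuous_on S g \<Longrightarrow> continuous_on S (\<lambda>x. smul (f x) (g x))"
  by (rule bounded_bilinear.continuous_on[OF bounded_bilinear_smul])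

text \<open>
  As the kernel has integral 1, the vector \<open>v\<close> is its own average, and only \<open>h - v\<close> has to be
  estimated. The kernel may change sign, which costs the factor \<open>2 * r * P\<close>.
\<close>

lemma kernel_average:
  assumes k: "continuous_on UNIV k" "\<And>y. y \<notin> {c - r..c + r} \<Longrightarrow> k y = 0" "\<And>y. norm (k y) \<le> P"
    and int: "integral UNIV k = 1" and "0 \<le> r"
    and h: "continuous_on UNIV h" "\<And>y. \<bar>y - c\<bar> \<le> r \<Longrightarrow> norm (h y - v) \<le> \<delta>"
  shows "norm (integral UNIV (\<lambda>y. smul (k y) (h y)) - v) \<le> 2 * r * P * \<delta>"
proof -
  let ?I = "{c - r..c + r}"
  have cont: "continuous_on S k" "continuous_on S h" for S
    using k(1) h(1) by (meson continuous_on_subset subset_UNIV)+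
  have cs: "continuous_on ?I (\<lambda>y. smul (k y) (w y))" if "continuous_on ?I w" for w
    by (intro continuous_smul cont that)
  have P: "0 \<le> P" using k(3) norm_ge_zero order_trans by blast
  have v: "v = integral ?I (\<lambda>y. smul (k y) v)"
  proof -
    have "k integrable_on ?I" "integral ?I k = 1"
      using cont integral_compact_support[of "c - r" "c + r" k] k int
      by (auto intro: integrable_continuous_real)
    then show ?thesis
      using integral_linear[OF _ bounded_bilinear.bounded_linear_left[OF bounded_bilinear_smul], of k ?I v]
      by (simp add: o_def)
  qed
  have "integral UNIV (\<lambda>y. smul (k y) (h y)) - v = integral ?I (\<lambda>y. smul (k y) (h y)) - integral ?I (\<lambda>y. smul (k y) v)"
    using k by (subst integral_compact_support[of "c - r" "c + r"]) (auto intro!: cs cont v)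
  also have "\<dots> = integral ?I (\<lambda>y. smul (k y) (h y) - smul (k y) v)"
    by (rule integral_diff[symmetric]; intro integrable_continuous_real cs cont continuous_on_const)
  also have "\<dots> = integral ?I (\<lambda>y. smul (k y) (h y - v))"
    by (simp add: scale_right_diff_distrib)
  also have "norm \<dots> \<le> (P * \<delta>) * (c + r - (c - r))"
  proof (rule integral_bound)
    fix y assume "y \<in> ?I"
    then have "norm (h y - v) \<le> \<delta>" by (intro h(2)) (auto simp: abs_le_iff)
    then show "norm (smul (k y) (h y - v)) \<le> P * \<delta>"
      unfolding norm_scale using k(3) P by (intro mult_mono) auto
  qed (use \<open>0 \<le> r\<close> in \<open>auto intro!: cs continuous_intros cont\<close>)
  finally show ?thesis by (simp add: algebra_simps)
qed

section \<open>Distributions: local estimate and smoothness of convolutions\<close>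

context
  fixes T :: "(real \<Rightarrow> 'k) \<Rightarrow> 'x"
  assumes T: "T \<in> distributions smul"
begin

lemma distribution_add:
  "\<phi> \<in> test_funs \<Longrightarrow> \<psi> \<in> test_funs \<Longrightarrow> T (\<lambda>x. \<phi> x + \<psi> x) = T \<phi> + T \<psi>"
  and distribution_cmult: "\<phi> \<in> test_funs \<Longrightarrow> T (\<lambda>x. c * \<phi> x) = smul c (T \<phi>)"
  and distribution_null_seq: "test_null_seq \<Phi> \<Longrightarrow> (\<lambda>m. T (\<Phi> m)) \<longlonglongrightarrow> 0"
  and distribution_extensional: "T \<in> extensional test_funs"
  using T by (auto simp: distributions_def linear_map_on_def)

lemma distribution_scaleR: "\<phi> \<in> test_funs \<Longrightarrow> T (\<lambda>x. r *\<^sub>R \<phi> x) = r *\<^sub>R T \<phi>"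
  using distribution_cmult[of \<phi> "of_real r"] by (simp add: scaleR_conv_of_real[symmetric] scale_of_real)

lemma distribution_diff:
  assumes "\<phi> \<in> test_funs" "\<psi> \<in> test_funs"
  shows "T (\<lambda>x. \<phi> x - \<psi> x) = T \<phi> - T \<psi>"
  using distribution_add[OF assms(1) test_funs_cmult[OF assms(2), of "-1"]]
    distribution_cmult[OF assms(2), of "-1"] by (simp add: scale_minus_left)

lemma distribution_zero: "T (\<lambda>x. 0) = 0"
  using distribution_cmult[OF tests_test_funs[OF tests_zero_fun], of 0] by simp

text \<open>
  Sequential continuity suffices: if no pair of a constant and a seminorm works, then test functions
  that violate \<open>norm (T \<phi>) \<le> k * Cnorm k \<phi>\<close> for \<open>k = 0, 1, 2, \<dots>\<close>, scaled to
  \<open>norm (T \<phi>) = 1\<close>, form a null sequence.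
\<close>

lemma distribution_local_estimate:
  obtains C m where "0 \<le> C" "\<And>\<phi>. \<phi> \<in> tests R \<Longrightarrow> norm (T \<phi>) \<le> C * Cnorm m \<phi>"
proof -
  have "\<exists>k. \<forall>\<phi>\<in>tests R. norm (T \<phi>) \<le> real k * Cnorm k \<phi>"
  proof (rule ccontr)
    assume "\<not> ?thesis"
    then have "\<forall>k. \<exists>\<phi>. \<phi> \<in> tests R \<and> real k * Cnorm k \<phi> < norm (T \<phi>)"
      by (auto simp: not_le)
    then obtain \<phi> where \<phi>: "\<And>k. \<phi> k \<in> tests R" "\<And>k. real k * Cnorm k (\<phi> k) < norm (T (\<phi> k))"
      by metis
    define \<psi> where "\<psi> k = (\<lambda>x. inverse (norm (T (\<phi> k))) *\<^sub>R \<phi> k x)" for k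
    have pos: "0 < norm (T (\<phi> k))" for k
      using \<phi>(2)[of k] Cnorm_nonneg[OF \<phi>(1), of k] by (meson le_less_trans mult_nonneg_nonneg of_nat_0_le_iff)
    have \<psi>: "\<psi> k \<in> tests R" for k
      unfolding \<psi>_def by (rule tests_scaleR[OF \<phi>(1)])
    have small: "norm (nderiv j (\<psi> k) x) \<le> inverse (real k)" if "j \<le> k" "0 < k" for j k x
    proof -
      have "norm (nderiv j (\<psi> k) x) \<le> Cnorm k (\<psi> k)"
        by (rule norm_nderiv_le_Cnorm[OF \<psi> that(1)])
      also have "\<dots> \<le> inverse (norm (T (\<phi> k))) * Cnorm k (\<phi> k)"
        using Cnorm_scaleR[OF \<phi>(1), of k "inverse (norm (T (\<phi> k)))" k] by (simp add: \<psi>_def)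
      also have "\<dots> \<le> inverse (real k)"
        using \<phi>(2)[of k] pos[of k] that by (simp add: field_simps)
      finally show ?thesis .
    qed
    have "test_null_seq \<psi>"
      unfolding test_null_seq_def
    proof (intro conjI allI exI[of _ "{- R..R}"])
      show "range \<psi> \<subseteq> test_funs" using \<psi> tests_test_funs by blast
      show "{x. \<psi> m x \<noteq> 0} \<subseteq> {- R..R}" for m using tests_support[OF \<psi>] by blast
      show "uniform_limit UNIV (\<lambda>m. nderiv j (\<psi> m)) (\<lambda>_. 0) sequentially" for j
      proof (rule uniform_limitI)
        fix e :: real assume "0 < e"
        have "(\<lambda>k. inverse (real k)) \<longlonglongrightarrow> 0" by (rule lim_inverse_n)
        from order_tendstoD(2)[OF this \<open>0 < e\<close>]
        have "eventually (\<lambda>k. inverse (real k) < e) sequentially" .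
        then show "eventually (\<lambda>k. \<forall>x\<in>UNIV. dist (nderiv j (\<psi> k) x) 0 < e) sequentially"
          using eventually_ge_at_top[of "max j 1"]
        proof eventually_elim
          case (elim k)
          then show ?case using small[of j k] by (auto intro: le_less_trans)
        qed
      qed
    qed simp
    then have "(\<lambda>k. norm (T (\<psi> k))) \<longlonglongrightarrow> 0"
      by (intro tendsto_norm_zero distribution_null_seq)
    moreover have "norm (T (\<psi> k)) = 1" for k
      using distribution_scaleR[OF tests_test_funs[OF \<phi>(1)]] pos[of k] by (simp add: \<psi>_def)
    ultimately show False by (simp add: LIMSEQ_const_iff)
  qed
  then obtain k where "\<forall>\<phi>\<in>tests R. norm (T \<phi>) \<le> real k * Cnorm k \<phi>" ..
  then show ?thesis using that[of "real k" k] by simp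
qed

text \<open>
  The seminorms are invariant under reflection and translation, and for bounded \<open>x\<close> the functions
  \<open>y \<mapsto> \<phi> (x - y)\<close> share a compact support. Nothing is claimed for unbounded \<open>x\<close>: uniformity in
  all \<open>x\<close> is a property of bounded distributions only.
\<close>

lemma dist_conv_local_estimate:
  obtains C m where "0 \<le> C"
    "\<And>\<phi> x. \<phi> \<in> tests R \<Longrightarrow> \<bar>x\<bar> \<le> B \<Longrightarrow> norm (dist_conv T \<phi> x) \<le> C * Cnorm m \<phi>"
proof -
  obtain C m where C: "0 \<le> C" "\<And>\<phi>. \<phi> \<in> tests (R + B) \<Longrightarrow> norm (T \<phi>) \<le> C * Cnorm m \<phi>"
    using distribution_local_estimate by blast
  show ?thesis
  proof (rule that[OF C(1)])
    fix \<phi> :: "real \<Rightarrow> 'k" and x assume \<phi>: "\<phi> \<in> tests R" and x: "\<bar>x\<bar> \<le> B"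
    have "(\<lambda>y. \<phi> (x - y)) \<in> tests (R + B)"
      using tests_reflect[OF \<phi>, of x] x tests_mono[of "R + \<bar>x\<bar>" "R + B"] by auto
    from C(2)[OF this] show "norm (dist_conv T \<phi> x) \<le> C * Cnorm m \<phi>"
      by (simp add: dist_conv_def Cnorm_reflect[OF tests_smooth[OF \<phi>]])
  qed
qed

lemma
  assumes "\<phi> \<in> test_funs" "\<psi> \<in> test_funs"
  shows dist_conv_add: "dist_conv T (\<lambda>y. \<phi> y + \<psi> y) x = dist_conv T \<phi> x + dist_conv T \<psi> x"
    and dist_conv_diff: "dist_conv T (\<lambda>y. \<phi> y - \<psi> y) x = dist_conv T \<phi> x - dist_conv T \<psi> x"
  using test_funs_reflect[OF assms(1), of x] test_funs_reflect[OF assms(2), of x]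
  by (simp_all add: dist_conv_def distribution_add distribution_diff)

lemma dist_conv_scaleR:
  assumes "\<phi> \<in> test_funs"
  shows "dist_conv T (\<lambda>y. c *\<^sub>R \<phi> y) x = c *\<^sub>R dist_conv T \<phi> x"
  using test_funs_reflect[OF assms, of x] by (simp add: dist_conv_def distribution_scaleR)

text \<open>
  The remainder \<open>\<phi> (z + h) - \<phi> z - h * \<phi>' z\<close> and all its derivatives are of size \<open>h\<^sup>2\<close>,
  hence so is the remainder of the convolution by the local estimate.
\<close>

lemma dist_conv_has_vector_derivative:
  assumes "\<phi> \<in> test_funs"
  shows "(dist_conv T \<phi> has_vector_derivative dist_conv T (nderiv 1 \<phi>) x) (at x)"
proof -
  obtain R where \<phi>: "\<phi> \<in> tests R" and "0 < R" using test_funs_tests[OF assms] .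
  obtain C m where C: "0 \<le> C"
    "\<And>\<phi> y. \<phi> \<in> tests (R + 1) \<Longrightarrow> \<bar>y\<bar> \<le> \<bar>x\<bar> \<Longrightarrow> norm (dist_conv T \<phi> y) \<le> C * Cnorm m \<phi>"
    using dist_conv_local_estimate by blast
  show ?thesis
  proof (rule has_vector_derivative_quadratic)
    fix h :: real assume h: "\<bar>h\<bar> \<le> 1"
    have sm: "smooth \<phi>" by (rule tests_smooth[OF \<phi>])
    have t1: "(\<lambda>z. \<phi> (z + h)) \<in> tests (R + 1)"
      using smooth_affine[OF sm, of 1 h] h tests_zero[OF \<phi>] by (auto simp: tests_def)
    have t2: "\<phi> \<in> tests (R + 1)" "nderiv 1 \<phi> \<in> tests (R + 1)"
      using tests_mono[of R "R + 1"] \<phi> tests_nderiv[OF \<phi>] by auto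
    define \<zeta> where "\<zeta> = (\<lambda>z. \<phi> (z + h) - \<phi> z - h *\<^sub>R nderiv 1 \<phi> z)"
    have \<zeta>: "\<zeta> \<in> tests (R + 1)"
      unfolding \<zeta>_def by (intro tests_diff tests_scaleR t1 t2)
    have "dist_conv T \<zeta> x = dist_conv T (\<lambda>z. \<phi> (z + h)) x - dist_conv T \<phi> x - h *\<^sub>R dist_conv T (nderiv 1 \<phi>) x"
      unfolding \<zeta>_def
      using t1 t2 tests_diff[OF t1 t2(1)] tests_scaleR[OF t2(2), of h]
      by (simp add: dist_conv_diff dist_conv_scaleR tests_test_funs)
    also have "dist_conv T (\<lambda>z. \<phi> (z + h)) x = dist_conv T \<phi> (x + h)"
      by (simp add: dist_conv_def algebra_simps)
    finally have "norm (dist_conv T \<phi> (x + h) - dist_conv T \<phi> x - h *\<^sub>R dist_conv T (nderiv 1 \<phi>) x)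
        = norm (dist_conv T \<zeta> x)" by simp
    also have "\<dots> \<le> C * Cnorm m \<zeta>" by (rule C(2)[OF \<zeta>]) simp
    also have "Cnorm m \<zeta> \<le> (real m + 1) * ((3 * Cnorm (m + 2) \<phi>) * h\<^sup>2)"
    proof (rule Cnorm_le)
      fix j z assume j: "j \<le> m"
      have "nderiv j \<zeta> z = nderiv j \<phi> (z + h) - nderiv j \<phi> z - h *\<^sub>R nderiv 1 (nderiv j \<phi>) z"
        unfolding \<zeta>_def
        using sm nderiv_affine[OF sm, of j 1 h] smooth_affine[OF sm, of 1 h]
          nderiv_linear[OF smooth_nderiv[OF sm, of 1] bounded_linear_scaleR_right, of j h]
          smooth_linear[OF smooth_nderiv[OF sm, of 1] bounded_linear_scaleR_right, of h]
        by (simp add: nderiv_diff smooth_diff nderiv_nderiv add.commute)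
      also have "norm \<dots> \<le> Cnorm 2 (nderiv j \<phi>) * h\<^sup>2"
        by (rule tests_Taylor[OF tests_nderiv[OF \<phi>]])
      also have "\<dots> \<le> (3 * Cnorm (m + 2) \<phi>) * h\<^sup>2"
        using Cnorm_nderiv[OF \<phi>, of 2 j] Cnorm_mono[OF \<phi>, of "2 + j" "m + 2"] j
        by (intro mult_right_mono) auto
      finally show "norm (nderiv j \<zeta> z) \<le> (3 * Cnorm (m + 2) \<phi>) * h\<^sup>2" .
    qed
    finally show "norm (dist_conv T \<phi> (x + h) - dist_conv T \<phi> x - h *\<^sub>R dist_conv T (nderiv 1 \<phi>) x)
        \<le> (C * (real m + 1) * (3 * Cnorm (m + 2) \<phi>)) * h\<^sup>2"
      using C(1) by (simp add: mult_left_mono mult.assoc)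
  qed
qed

lemma
  assumes "\<phi> \<in> test_funs"
  shows smooth_dist_conv: "smooth (dist_conv T \<phi>)"
    and nderiv_dist_conv: "nderiv n (dist_conv T \<phi>) = dist_conv T (nderiv n \<phi>)"
proof -
  have "(dist_conv T (nderiv n \<phi>) has_vector_derivative dist_conv T (nderiv (Suc n) \<phi>) x) (at x)" for n x
    using dist_conv_has_vector_derivative[OF test_funs_nderiv[OF assms, of n], of x]
    by (simp add: nderiv_nderiv)
  note * = derivative_tower[where g = "\<lambda>n. dist_conv T (nderiv n \<phi>)", OF this]
  show "smooth (dist_conv T \<phi>)" "nderiv n (dist_conv T \<phi>) = dist_conv T (nderiv n \<phi>)"
    using *(1) *(2)[of n] by simp_all
qed

end

section \<open>Regular distributions\<close>

lemma reg_dist_tests: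
  assumes "\<phi> \<in> tests R" "continuous_on UNIV g"
  shows "((\<lambda>x. smul (\<phi> x) (g x)) has_integral reg_dist smul g \<phi>) {- R..R}"
    and "((\<lambda>x. smul (\<phi> x) (g x)) has_integral reg_dist smul g \<phi>) UNIV"
proof -
  have c: "continuous_on {- R..R} (\<lambda>x. smul (\<phi> x) (g x))"
    by (intro continuous_smul smooth_continuous[OF tests_smooth[OF assms(1)]]
        continuous_on_subset[OF assms(2)]) simp
  have z: "smul (\<phi> x) (g x) = 0" if "x \<notin> {- R..R}" for x
    using tests_support[OF assms(1) that] by simp
  have "reg_dist smul g \<phi> = integral {- R..R} (\<lambda>x. smul (\<phi> x) (g x))"
    using tests_test_funs[OF assms(1)] integral_compact_support[OF c z] by (simp add: reg_dist_def)
  then show "((\<lambda>x. smul (\<phi> x) (g x)) has_integral reg_dist smul g \<phi>) {- R..R}"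
      "((\<lambda>x. smul (\<phi> x) (g x)) has_integral reg_dist smul g \<phi>) UNIV"
    using c has_integral_compact_support[OF c z]
    by (simp_all add: integrable_integral integrable_continuous_real)
qed

lemma dist_conv_reg_dist:
  "\<phi> \<in> test_funs \<Longrightarrow> dist_conv (reg_dist smul g) \<phi> x = integral UNIV (\<lambda>y. smul (\<phi> (x - y)) (g y))"
  by (simp add: dist_conv_def reg_dist_def test_funs_reflect)

lemma reg_dist_add:
  assumes "continuous_on UNIV f" "continuous_on UNIV g" "\<phi> \<in> test_funs"
  shows "reg_dist smul (\<lambda>x. f x + g x) \<phi> = reg_dist smul f \<phi> + reg_dist smul g \<phi>"
proof -
  obtain R where \<phi>: "\<phi> \<in> tests R" using test_funs_tests[OF assms(3)] .
  have "((\<lambda>x. smul (\<phi> x) (f x + g x)) has_integral reg_dist smul f \<phi> + reg_dist smul g \<phi>) UNIV"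
    unfolding scale_right_distrib using assms
    by (intro has_integral_add reg_dist_tests(2)[OF \<phi>])
  then show ?thesis using assms(3) by (simp add: reg_dist_def integral_unique)
qed

lemma reg_dist_diff:
  assumes "continuous_on UNIV f" "continuous_on UNIV g" "\<phi> \<in> test_funs"
  shows "reg_dist smul (\<lambda>x. f x - g x) \<phi> = reg_dist smul f \<phi> - reg_dist smul g \<phi>"
proof -
  obtain R where \<phi>: "\<phi> \<in> tests R" using test_funs_tests[OF assms(3)] .
  have "((\<lambda>x. smul (\<phi> x) (f x - g x)) has_integral reg_dist smul f \<phi> - reg_dist smul g \<phi>) UNIV"
    unfolding scale_right_diff_distrib using assms
    by (intro has_integral_diff reg_dist_tests(2)[OF \<phi>])
  then show ?thesis using assms(3) by (simp add: reg_dist_def integral_unique)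
qed

lemma reg_dist_distributions:
  assumes g: "continuous_on UNIV g"
  shows "reg_dist smul g \<in> distributions smul"
proof -
  let ?S = "reg_dist smul g"
  have "linear_map_on smul test_funs ?S"
    unfolding linear_map_on_def
  proof (intro conjI ballI allI)
    show "?S \<in> extensional test_funs" by (simp add: reg_dist_def)
  next
    fix \<phi> \<psi> :: "real \<Rightarrow> 'k" assume "\<phi> \<in> test_funs" "\<psi> \<in> test_funs"
    then obtain R where *: "\<phi> \<in> tests R" "\<psi> \<in> tests R" using test_funs_common by blast
    have "((\<lambda>x. smul (\<phi> x + \<psi> x) (g x)) has_integral ?S \<phi> + ?S \<psi>) UNIV"
      unfolding scale_left_distrib by (intro has_integral_add reg_dist_tests(2)[OF *(1) g] reg_dist_tests(2)[OF *(2) g])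
    then show "?S (\<lambda>x. \<phi> x + \<psi> x) = ?S \<phi> + ?S \<psi>"
      using tests_test_funs[OF tests_add[OF *]] by (simp add: reg_dist_def integral_unique)
  next
    fix c and \<phi> :: "real \<Rightarrow> 'k" assume "\<phi> \<in> test_funs"
    then obtain R where *: "\<phi> \<in> tests R" using test_funs_tests by blast
    have "((\<lambda>x. smul (c * \<phi> x) (g x)) has_integral smul c (?S \<phi>)) UNIV"
      using has_integral_linear[OF reg_dist_tests(2)[OF * g] bounded_linear_smul[of c]]
      by (simp add: o_def)
    then show "?S (\<lambda>x. c * \<phi> x) = smul c (?S \<phi>)"
      using tests_test_funs[OF tests_cmult[OF *]] by (simp add: reg_dist_def integral_unique)
  qed
  moreover have "(\<lambda>m. ?S (\<phi> m)) \<longlonglongrightarrow> 0" if null: "test_null_seq \<phi>" for \<phi>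
  proof -
    obtain K where K: "compact K" "\<forall>m. {x. \<phi> m x \<noteq> 0} \<subseteq> K"
      using null by (auto simp: test_null_seq_def)
    obtain R where R: "0 < R" "\<And>x. x \<in> K \<Longrightarrow> \<bar>x\<bar> \<le> R"
      using compact_imp_bounded[OF K(1)] by (auto simp: bounded_pos)
    have \<phi>: "\<phi> m \<in> tests R" for m
      using null K(2) R(2) by (force simp: test_null_seq_def tests_def test_funs_def)
    have "compact (g ` {- R..R})"
      by (intro compact_continuous_image continuous_on_subset[OF g]) auto
    from compact_imp_bounded[OF this]
    obtain B where B: "0 < B" "\<And>x. x \<in> {- R..R} \<Longrightarrow> norm (g x) \<le> B"
      by (auto simp: bounded_pos)
    show ?thesis
    proof (rule tendstoI)
      fix e :: real assume "0 < e"
      define d where "d = e / (2 * (B * (2 * R)))"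
      have "0 < d" using \<open>0 < e\<close> B(1) R(1) by (simp add: d_def)
      have "uniform_limit UNIV (\<lambda>m. nderiv 0 (\<phi> m)) (\<lambda>_. 0) sequentially"
        using null by (simp only: test_null_seq_def)
      from uniform_limitD[OF this \<open>0 < d\<close>]
      show "eventually (\<lambda>m. dist (?S (\<phi> m)) 0 < e) sequentially"
      proof eventually_elim
        case (elim m)
        have "norm (?S (\<phi> m)) \<le> (d * B) * measure lborel (cbox (- R) R)"
        proof (rule has_integral_bound)
          show "((\<lambda>x. smul (\<phi> m x) (g x)) has_integral ?S (\<phi> m)) (cbox (- R) R)"
            using reg_dist_tests(1)[OF \<phi> g] by simp
          show "norm (smul (\<phi> m x) (g x)) \<le> d * B" if "x \<in> cbox (- R) R" for x
            unfolding norm_scale using elim B that \<open>0 < d\<close>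
            by (intro mult_mono) (auto simp: less_imp_le)
        qed (use \<open>0 < d\<close> B in simp)
        also have "\<dots> = e / 2" using R(1) B(1) by (simp add: d_def field_simps)
        finally show ?case using \<open>0 < e\<close> by simp
      qed
    qed
  qed
  ultimately show ?thesis by (simp add: distributions_def)
qed

lemma reg_dist_by_parts:
  assumes "smooth g" "\<phi> \<in> test_funs"
  shows "reg_dist smul (nderiv n g) \<phi> = (-1) ^ n *\<^sub>R reg_dist smul g (nderiv n \<phi>)"
  using assms
proof (induction n arbitrary: g)
  case (Suc n)
  obtain R where "0 < R" and \<phi>: "\<phi> \<in> tests R" using test_funs_tests[OF Suc.prems(2)] .
  let ?\<phi> = "nderiv n \<phi>"
  have t: "?\<phi> \<in> tests R" "nderiv (Suc n) \<phi> \<in> tests R" by (rule tests_nderiv[OF \<phi>])+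
  have t': "?\<phi> \<in> tests (R + 1)" "nderiv (Suc n) \<phi> \<in> tests (R + 1)"
    using t tests_mono[of R "R + 1"] by auto
  have z: "?\<phi> (R + 1) = 0" "?\<phi> (- (R + 1)) = 0"
    using \<open>0 < R\<close> by (auto intro!: tests_zero[OF t(1)])
  have "((\<lambda>x. smul (nderiv (Suc n) \<phi> x) (g x)) has_integral
         - reg_dist smul (nderiv 1 g) ?\<phi>) {- (R + 1)..R + 1}"
  proof (rule integration_by_parts[OF bounded_bilinear_smul, of _ _ ?\<phi> g _ "nderiv 1 g"])
    show "(?\<phi> has_vector_derivative nderiv (Suc n) \<phi> x) (at x)" for x
      by (rule nderiv_has_vector_derivative[OF tests_smooth[OF \<phi>]])
    show "(g has_vector_derivative nderiv 1 g x) (at x)" for x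
      using smooth_has_vector_derivative[OF Suc.prems(1)] by simp
    show "((\<lambda>x. smul (?\<phi> x) (nderiv 1 g x)) has_integral
       smul (?\<phi> (R + 1)) (g (R + 1)) - smul (?\<phi> (- (R + 1))) (g (- (R + 1))) -
       - reg_dist smul (nderiv 1 g) ?\<phi>) {- (R + 1)..R + 1}"
      using reg_dist_tests(1)[OF t'(1) smooth_continuous_nderiv[OF Suc.prems(1), of _ 1]] z by simp
  qed (use \<open>0 < R\<close> Suc.prems(1) t in \<open>auto intro: smooth_continuous tests_smooth\<close>)
  then have "reg_dist smul g (nderiv (Suc n) \<phi>) = - reg_dist smul (nderiv 1 g) ?\<phi>"
    using reg_dist_tests(1)[OF t'(2) smooth_continuous[OF Suc.prems(1)]] has_integral_unique by blast
  moreover have "reg_dist smul (nderiv n (nderiv 1 g)) \<phi> = (-1) ^ n *\<^sub>R reg_dist smul (nderiv 1 g) ?\<phi>"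
    by (rule Suc.IH) (use Suc.prems smooth_nderiv in auto)
  ultimately show ?case by (simp add: nderiv_nderiv)
qed simp

end

section \<open>A uniform boundedness principle for test functions\<close>

text \<open>
  The balls of the \<open>C\<^sup>m\<close> topology in terms of the maximum of the derivatives. Unlike a bound on the
  sum \<open>Cnorm\<close>, this condition is a conjunction of pointwise inequalities and so passes to limits
  immediately.
\<close>

definition deriv_bounded :: "nat \<Rightarrow> real \<Rightarrow> (real \<Rightarrow> 'a::real_normed_vector) \<Rightarrow> bool" where
  "deriv_bounded m \<epsilon> f \<longleftrightarrow> (\<forall>j\<le>m. \<forall>x. norm (nderiv j f x) \<le> \<epsilon>)"

lemma nderiv_zero: "nderiv n (\<lambda>_. 0) x = 0"
  by (rule tests_zero[OF tests_nderiv[OF tests_zero_fun[of "- 1"]]]) linarith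

text \<open>
  Uniform limits of the derivatives of all orders form a tower.
\<close>

lemma tests_complete:
  fixes \<Phi> :: "nat \<Rightarrow> real \<Rightarrow> 'a::banach"
  assumes \<Phi>: "\<And>k. \<Phi> k \<in> tests R"
    and Cauchy: "\<And>j. uniformly_Cauchy_on UNIV (\<lambda>k. nderiv j (\<Phi> k))"
  obtains \<phi> where "\<phi> \<in> tests R" "\<And>j x. (\<lambda>k. nderiv j (\<Phi> k) x) \<longlonglongrightarrow> nderiv j \<phi> x"
proof -
  have "\<forall>j. \<exists>g. uniform_limit UNIV (\<lambda>k. nderiv j (\<Phi> k)) g sequentially"
    using Cauchy uniformly_convergent_eq_Cauchy unfolding uniformly_convergent_on_def by metis
  then obtain g where g: "\<And>j. uniform_limit UNIV (\<lambda>k. nderiv j (\<Phi> k)) (g j) sequentially" by metis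
  have lim: "(\<lambda>k. nderiv j (\<Phi> k) x) \<longlonglongrightarrow> g j x" for j x
    using tendsto_uniform_limitI[OF g] by blast
  have "(g j has_vector_derivative g (Suc j) x) (at x)" for j x
  proof -
    have "\<exists>h. \<forall>x\<in>UNIV. (\<lambda>k. nderiv j (\<Phi> k) x) \<longlonglongrightarrow> h x \<and>
        (h has_derivative (\<lambda>t. t *\<^sub>R g (Suc j) x)) (at x within UNIV)"
    proof (rule has_derivative_sequence[where f' = "\<lambda>k x t. t *\<^sub>R nderiv (Suc j) (\<Phi> k) x"])
      show "(nderiv j (\<Phi> k) has_derivative (\<lambda>t. t *\<^sub>R nderiv (Suc j) (\<Phi> k) x)) (at x within UNIV)" for k x
        using nderiv_has_vector_derivative[OF tests_smooth[OF \<Phi>]]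
        by (simp add: has_vector_derivative_def)
      fix e :: real assume "0 < e"
      from uniform_limitD[OF g this, of "Suc j"]
      show "eventually (\<lambda>k. \<forall>x\<in>UNIV. \<forall>t. norm (t *\<^sub>R nderiv (Suc j) (\<Phi> k) x - t *\<^sub>R g (Suc j) x) \<le> e * norm t) sequentially"
      proof eventually_elim
        case (elim k)
        then show ?case
          by (simp add: scaleR_diff_right[symmetric] dist_norm mult.commute[of e] mult_left_mono less_imp_le)
      qed
    qed (use lim in auto)
    then obtain h where h: "\<And>x. (\<lambda>k. nderiv j (\<Phi> k) x) \<longlonglongrightarrow> h x"
        "\<And>x. (h has_derivative (\<lambda>t. t *\<^sub>R g (Suc j) x)) (at x)" by auto
    have "h = g j" using LIMSEQ_unique[OF h(1) lim] by blast
    then show ?thesis using h(2) by (simp add: has_vector_derivative_def)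
  qed
  note tower = derivative_tower[of g, OF this]
  have "g 0 x = 0" if "R < \<bar>x\<bar>" for x
    using lim[of 0 x] tests_zero[OF \<Phi> that] by (simp add: LIMSEQ_const_iff)
  then have "g 0 \<in> tests R" using tower(1) by (simp add: tests_def)
  then show ?thesis using that[of "g 0"] lim tower(2) by simp
qed

text \<open>
  The principle of uniform boundedness by the argument of Baire. The sets
  \<open>{\<phi>. \<forall>i. norm (B i \<phi>) \<le> w N i}\<close> are closed, convex and symmetric, and they cover the space,
  so one of them is a neighbourhood of zero. The weights \<open>w N i\<close> allow the pointwise bound to grow
  with the index \<open>i\<close> in a way that itself depends on \<open>N\<close>; this is what makes the principle
  applicable to bilinear maps, where the index contains the second argument and the bound is one of
  its seminorms.
\<close>

lemma uniform_boundedness: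
  fixes B :: "'i \<Rightarrow> (real \<Rightarrow> 'a::banach) \<Rightarrow> 'b::real_normed_vector" and w :: "nat \<Rightarrow> 'i \<Rightarrow> real"
  assumes diff: "\<And>i \<phi> \<psi>. \<phi> \<in> tests R \<Longrightarrow> \<psi> \<in> tests R \<Longrightarrow> B i (\<lambda>x. \<phi> x - \<psi> x) = B i \<phi> - B i \<psi>"
    and scale: "\<And>i c \<phi>. \<phi> \<in> tests R \<Longrightarrow> B i (\<lambda>x. c *\<^sub>R \<phi> x) = c *\<^sub>R B i \<phi>"
    and cont: "\<And>i. \<exists>C m. \<forall>\<phi>\<in>tests R. norm (B i \<phi>) \<le> C * Cnorm m \<phi>"
    and pointwise: "\<And>\<phi>. \<phi> \<in> tests R \<Longrightarrow> \<exists>N. \<forall>i. norm (B i \<phi>) \<le> w N i"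
  obtains C m N where "0 \<le> C" "\<And>\<phi> i. \<phi> \<in> tests R \<Longrightarrow> norm (B i \<phi>) \<le> C * Cnorm m \<phi> * w N i"
proof -
  have "\<exists>N m \<epsilon>. 0 < \<epsilon> \<and> (\<forall>\<phi>\<in>tests R. deriv_bounded m \<epsilon> \<phi> \<longrightarrow> (\<forall>i. norm (B i \<phi>) \<le> w N i))"
  proof (rule ccontr)
    assume contra: "\<not> ?thesis"
    \<comment> \<open>Every ball contains a smaller ball, of at most half the radius, that misses the \<open>N\<close>-th set.\<close>
    have step: "\<exists>\<psi> m' \<epsilon>'. \<psi> \<in> tests R \<and> deriv_bounded m (\<epsilon> / 2) (\<lambda>x. \<psi> x - \<phi> x) \<and> Suc m \<le> m' \<and>
        0 < \<epsilon>' \<and> \<epsilon>' \<le> \<epsilon> / 2 \<and>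
        (\<forall>\<eta>\<in>tests R. deriv_bounded m' \<epsilon>' (\<lambda>x. \<eta> x - \<psi> x) \<longrightarrow> \<not> (\<forall>i. norm (B i \<eta>) \<le> w N i))"
      if \<phi>: "\<phi> \<in> tests R" and "0 < \<epsilon>" for \<phi> m \<epsilon> N
    proof -
      have "\<exists>\<psi>\<in>tests R. deriv_bounded m (\<epsilon> / 2) (\<lambda>x. \<psi> x - \<phi> x) \<and> (\<exists>i. w N i < norm (B i \<psi>))"
      proof (rule ccontr)
        assume none: "\<not> ?thesis"
        \<comment> \<open>A ball around \<open>\<phi>\<close> inside the \<open>N\<close>-th set could be moved to 0 by convexity and symmetry.\<close>
        have "norm (B i \<xi>) \<le> w N i" if \<xi>: "\<xi> \<in> tests R" "deriv_bounded m (\<epsilon> / 2) \<xi>" for i \<xi>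
        proof -
          have p: "(\<lambda>x. \<phi> x + \<xi> x) \<in> tests R" "(\<lambda>x. \<phi> x - \<xi> x) \<in> tests R"
            using \<phi> \<xi>(1) by (auto intro: tests_add tests_diff)
          have "deriv_bounded m (\<epsilon> / 2) (\<lambda>x. - \<xi> x)"
            using \<xi>(2) nderiv_linear[OF tests_smooth[OF \<xi>(1)], of uminus]
            by (simp add: deriv_bounded_def bounded_linear_minus bounded_linear_ident)
          then have "norm (B i (\<lambda>x. \<phi> x + \<xi> x)) \<le> w N i" "norm (B i (\<lambda>x. \<phi> x - \<xi> x)) \<le> w N i"
            using none p \<xi>(2) by (fastforce simp: not_less)+
          moreover have "2 *\<^sub>R B i \<xi> = B i (\<lambda>x. \<phi> x + \<xi> x) - B i (\<lambda>x. \<phi> x - \<xi> x)"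
            using diff[OF p, of i] scale[OF \<xi>(1), of i 2] by (simp add: scaleR_2)
          then have "2 * norm (B i \<xi>) = norm (B i (\<lambda>x. \<phi> x + \<xi> x) - B i (\<lambda>x. \<phi> x - \<xi> x))"
            by (metis norm_scaleR abs_numeral)
          ultimately show ?thesis
            using norm_triangle_ineq4[of "B i (\<lambda>x. \<phi> x + \<xi> x)" "B i (\<lambda>x. \<phi> x - \<xi> x)"] by linarith
        qed
        then show False using contra \<open>0 < \<epsilon>\<close> half_gt_zero by blast
      qed
      then obtain \<psi> i where \<psi>: "\<psi> \<in> tests R" "deriv_bounded m (\<epsilon> / 2) (\<lambda>x. \<psi> x - \<phi> x)"
        and i: "w N i < norm (B i \<psi>)" by blast
      obtain C n where C: "\<And>\<phi>. \<phi> \<in> tests R \<Longrightarrow> norm (B i \<phi>) \<le> C * Cnorm n \<phi>"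
        using cont by blast
      define gap where "gap = norm (B i \<psi>) - w N i"
      define K where "K = \<bar>C\<bar> * (real n + 1) + 1"
      define d where "d = gap / (2 * K)"
      have gap: "0 < gap" using i by (simp add: gap_def)
      have pos: "0 < K" by (simp add: K_def add_nonneg_pos)
      then have d: "0 < d" using gap by (simp add: d_def)
      have "\<not> (\<forall>i. norm (B i \<eta>) \<le> w N i)"
        if \<eta>: "\<eta> \<in> tests R" "deriv_bounded (max n (Suc m)) (min (\<epsilon> / 2) d) (\<lambda>x. \<eta> x - \<psi> x)" for \<eta>
      proof -
        have t: "(\<lambda>x. \<eta> x - \<psi> x) \<in> tests R" using \<eta>(1) \<psi>(1) by (rule tests_diff)
        have "Cnorm n (\<lambda>x. \<eta> x - \<psi> x) \<le> (real n + 1) * d"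
          using \<eta>(2) by (intro Cnorm_le) (auto simp: deriv_bounded_def)
        then have "C * Cnorm n (\<lambda>x. \<eta> x - \<psi> x) \<le> \<bar>C\<bar> * ((real n + 1) * d)"
          using Cnorm_nonneg[OF t, of n] by (intro mult_mono) auto
        then have "norm (B i (\<lambda>x. \<eta> x - \<psi> x)) \<le> \<bar>C\<bar> * ((real n + 1) * d)"
          using C[OF t] by linarith
        also have "\<dots> \<le> K * d"
          using d by (simp add: K_def algebra_simps)
        also have "\<dots> = gap / 2" using pos by (simp add: d_def)
        finally have "norm (B i \<eta> - B i \<psi>) \<le> gap / 2" by (simp add: diff[OF \<eta>(1) \<psi>(1)])
        then have "w N i < norm (B i \<eta>)"
          using gap norm_triangle_ineq2[of "B i \<psi>" "B i \<eta>"] by (simp add: gap_def norm_minus_commute)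
        then show ?thesis by (auto simp: not_le)
      qed
      then show ?thesis
        using \<psi> d \<open>0 < \<epsilon>\<close> by (intro exI[of _ \<psi>] exI[of _ "max n (Suc m)"] exI[of _ "min (\<epsilon> / 2) d"]) auto
    qed
    \<comment> \<open>A ball is encoded as the triple of its centre, the order of the derivatives, and its radius.\<close>
    define P where "P p \<longleftrightarrow> (case p of (\<phi>, m, \<epsilon>) \<Rightarrow> \<phi> \<in> tests R \<and> 0 < \<epsilon>)" for p :: "(real \<Rightarrow> 'a) \<times> nat \<times> real"
    define Q where "Q N p q \<longleftrightarrow> (case p of (\<phi>, m, \<epsilon>) \<Rightarrow> case q of (\<psi>, m', \<epsilon>') \<Rightarrow>
        deriv_bounded m (\<epsilon> / 2) (\<lambda>x. \<psi> x - \<phi> x) \<and> Suc m \<le> m' \<and> \<epsilon>' \<le> \<epsilon> / 2 \<and>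
        (\<forall>\<eta>\<in>tests R. deriv_bounded m' \<epsilon>' (\<lambda>x. \<eta> x - \<psi> x) \<longrightarrow> \<not> (\<forall>i. norm (B i \<eta>) \<le> w N i)))"
      for N and p q :: "(real \<Rightarrow> 'a) \<times> nat \<times> real"
    have "\<exists>f. \<forall>n. P (f n) \<and> Q n (f n) (f (Suc n))"
    proof (rule dependent_nat_choice)
      show "\<exists>p. P p"
        using tests_zero_fun by (intro exI[of _ "(\<lambda>_. 0, 0, 1)"]) (simp add: P_def)
      show "\<exists>q. P q \<and> Q n p q" if "P p" for p n
      proof -
        obtain \<phi> m \<epsilon> where p: "p = (\<phi>, m, \<epsilon>)" by (cases p)
        with that have "\<phi> \<in> tests R" "0 < \<epsilon>" by (simp_all add: P_def)
        from step[OF this, of m n] obtain \<psi> m' \<epsilon>' where "P (\<psi>, m', \<epsilon>') \<and> Q n p (\<psi>, m', \<epsilon>')"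
          unfolding P_def Q_def p prod.case by blast
        then show ?thesis ..
      qed
    qed
    then obtain f where f: "\<And>n. P (f n)" "\<And>n. Q n (f n) (f (Suc n))" by blast
    define \<Phi> where "\<Phi> n = fst (f n)" for n
    define M where "M n = fst (snd (f n))" for n
    define E where "E n = snd (snd (f n))" for n
    have F: "f n = (\<Phi> n, M n, E n)" for n by (simp add: \<Phi>_def M_def E_def)
    have \<Phi>: "\<Phi> n \<in> tests R" and E: "0 < E n" for n
      using f(1)[of n] by (simp_all add: P_def F)
    have close: "deriv_bounded (M n) (E n / 2) (\<lambda>x. \<Phi> (Suc n) x - \<Phi> n x)"
      and M: "Suc (M n) \<le> M (Suc n)" and E2: "E (Suc n) \<le> E n / 2"
      and avoid: "\<And>\<eta>. \<eta> \<in> tests R \<Longrightarrow> deriv_bounded (M (Suc n)) (E (Suc n)) (\<lambda>x. \<eta> x - \<Phi> (Suc n) x)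
         \<Longrightarrow> \<not> (\<forall>i. norm (B i \<eta>) \<le> w n i)" for n
      using f(2)[of n] by (auto simp: Q_def F)
    have Mn: "n \<le> M n" for n by (induction n) (use M in \<open>auto intro: le_trans\<close>)
    have En: "E n \<le> E 0 * (1 / 2) ^ n" for n
    proof (induction n)
      case (Suc n)
      then show ?case using E2[of n] by simp
    qed simp
    \<comment> \<open>All later centres stay in each ball, and therefore so does their limit.\<close>
    have nested: "norm (nderiv j (\<Phi> (n + d)) x - nderiv j (\<Phi> n) x) \<le> E n" if "j \<le> M n" for n d j x
      using that
    proof (induction d arbitrary: n)
      case 0
      then show ?case using E[of n] by simp
    next
      case (Suc d)
      have "norm (nderiv j (\<Phi> (Suc n + d)) x - nderiv j (\<Phi> (Suc n)) x) \<le> E (Suc n)"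
        using Suc M[of n] by (intro Suc.IH) auto
      moreover have "norm (nderiv j (\<Phi> (Suc n)) x - nderiv j (\<Phi> n) x) \<le> E n / 2"
        using close[of n] Suc.prems by (simp add: deriv_bounded_def nderiv_diff tests_smooth[OF \<Phi>])
      ultimately show ?case
        using E2[of n] norm_triangle_ineq[of "nderiv j (\<Phi> (Suc n + d)) x - nderiv j (\<Phi> (Suc n)) x"
            "nderiv j (\<Phi> (Suc n)) x - nderiv j (\<Phi> n) x"] by simp
    qed
    have "uniformly_Cauchy_on UNIV (\<lambda>k. nderiv j (\<Phi> k))" for j
    proof (rule uniformly_Cauchy_onI')
      fix e :: real assume "0 < e"
      have "(\<lambda>n. E 0 * (1 / 2) ^ n) \<longlonglongrightarrow> E 0 * 0"
        by (intro tendsto_mult_left LIMSEQ_power_zero) simp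
      then have "eventually (\<lambda>n. E 0 * (1 / 2) ^ n < e) sequentially"
        using \<open>0 < e\<close> by (simp add: order_tendstoD(2))
      then obtain n0 where n0: "\<And>n. n0 \<le> n \<Longrightarrow> E 0 * (1 / 2) ^ n < e"
        by (auto simp: eventually_sequentially)
      have "dist (nderiv j (\<Phi> k) x) (nderiv j (\<Phi> l) x) < e" if "max j n0 \<le> k" "k < l" for k l x
      proof -
        have "norm (nderiv j (\<Phi> (k + (l - k))) x - nderiv j (\<Phi> k) x) \<le> E k"
          using that Mn[of k] by (intro nested) auto
        also have "\<dots> < e" using En[of k] n0[of k] that by auto
        finally show ?thesis using that by (simp add: dist_norm norm_minus_commute)
      qed
      then show "\<exists>M. \<forall>x\<in>UNIV. \<forall>m\<ge>M. \<forall>n>m. dist (nderiv j (\<Phi> m) x) (nderiv j (\<Phi> n) x) < e" by blast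
    qed
    with \<Phi> obtain \<phi> where \<phi>: "\<phi> \<in> tests R"
      and lim: "\<And>j x. (\<lambda>k. nderiv j (\<Phi> k) x) \<longlonglongrightarrow> nderiv j \<phi> x"
      using tests_complete by metis
    have inside: "deriv_bounded (M n) (E n) (\<lambda>x. \<phi> x - \<Phi> n x)" for n
    proof -
      have "norm (nderiv j \<phi> x - nderiv j (\<Phi> n) x) \<le> E n" if "j \<le> M n" for j x
      proof (rule tendsto_upperbound)
        show "(\<lambda>d. norm (nderiv j (\<Phi> (n + d)) x - nderiv j (\<Phi> n) x)) \<longlonglongrightarrow> norm (nderiv j \<phi> x - nderiv j (\<Phi> n) x)"
          using LIMSEQ_ignore_initial_segment[OF lim[of j x], of n]
          by (intro tendsto_norm tendsto_diff tendsto_const) (simp add: add.commute)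
      qed (use nested that in auto)
      then show ?thesis
        by (simp add: deriv_bounded_def nderiv_diff tests_smooth[OF \<Phi>] tests_smooth[OF \<phi>])
    qed
    obtain N where "\<forall>i. norm (B i \<phi>) \<le> w N i" using pointwise[OF \<phi>] by blast
    then show False using avoid[OF \<phi> inside] by blast
  qed
  then obtain N m \<epsilon> where \<epsilon>: "0 < \<epsilon>"
    and bound: "\<And>\<phi> i. \<phi> \<in> tests R \<Longrightarrow> deriv_bounded m \<epsilon> \<phi> \<Longrightarrow> norm (B i \<phi>) \<le> w N i" by blast
  have w: "0 \<le> w N i" for i
    using bound[OF tests_zero_fun, of i] \<epsilon> order_trans[OF norm_ge_zero]
    by (force simp: deriv_bounded_def nderiv_zero)
  have "norm (B i \<phi>) \<le> inverse \<epsilon> * Cnorm m \<phi> * w N i" if \<phi>: "\<phi> \<in> tests R" for i \<phi>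
  proof (rule field_le_epsilon)
    fix e :: real assume "0 < e"
    \<comment> \<open>Scaling by \<open>\<epsilon> / s\<close> needs a positive \<open>s\<close>, also when the seminorm of \<open>\<phi>\<close> is 0.\<close>
    define s where "s = Cnorm m \<phi> + e * \<epsilon> / (w N i + 1)"
    have s: "Cnorm m \<phi> < s" "0 < s"
      using \<open>0 < e\<close> \<epsilon> w[of i] Cnorm_nonneg[OF \<phi>, of m] by (simp_all add: s_def add_nonneg_pos)
    have "deriv_bounded m \<epsilon> (\<lambda>x. (\<epsilon> / s) *\<^sub>R \<phi> x)"
      unfolding deriv_bounded_def
    proof (intro allI impI)
      fix j x assume "j \<le> m"
      have "norm (nderiv j \<phi> x) \<le> s"
        using norm_nderiv_le_Cnorm[OF \<phi> \<open>j \<le> m\<close>, of x] s by linarith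
      then show "norm (nderiv j (\<lambda>x. (\<epsilon> / s) *\<^sub>R \<phi> x) x) \<le> \<epsilon>"
        using s \<epsilon> nderiv_linear[OF tests_smooth[OF \<phi>] bounded_linear_scaleR_right, of j "\<epsilon> / s"]
        by (simp add: field_simps)
    qed
    from bound[OF tests_scaleR[OF \<phi>] this, of i]
    have "norm (B i \<phi>) \<le> s * inverse \<epsilon> * w N i"
      using s \<epsilon> by (simp add: scale[OF \<phi>] field_simps)
    also have "\<dots> = inverse \<epsilon> * Cnorm m \<phi> * w N i + e * (w N i / (w N i + 1))"
      using \<epsilon> by (simp add: s_def field_simps)
    also have "\<dots> \<le> inverse \<epsilon> * Cnorm m \<phi> * w N i + e"
      using \<open>0 < e\<close> w[of i] by (simp add: field_simps)
    finally show "norm (B i \<phi>) \<le> inverse \<epsilon> * Cnorm m \<phi> * w N i + e" .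
  qed
  then show ?thesis using \<epsilon> by (intro that[of "inverse \<epsilon>" m N]) auto
qed

section \<open>Mollifiers whose dyadic differences are high derivatives\<close>

text \<open>
  Dyadic dilation that preserves the integral.
\<close>

definition dilate :: "nat \<Rightarrow> (real \<Rightarrow> 'a::real_normed_vector) \<Rightarrow> real \<Rightarrow> 'a" where
  "dilate k f = (\<lambda>x. 2 ^ k *\<^sub>R f (2 ^ k * x))"

lemma dilate_dilate: "dilate k (dilate l f) = dilate (k + l) f"
  by (simp add: dilate_def power_add mult_ac)

lemma dilate_tests: "\<phi> \<in> tests R \<Longrightarrow> dilate k \<phi> \<in> tests (R / 2 ^ k)"
proof -
  assume \<phi>: "\<phi> \<in> tests R"
  have "\<phi> (2 ^ k * x) = 0" if "R / 2 ^ k < \<bar>x\<bar>" for x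
    using that by (intro tests_zero[OF \<phi>]) (simp add: field_simps abs_mult)
  then show ?thesis
    using smooth_linear[OF smooth_affine[OF tests_smooth[OF \<phi>], of "2 ^ k" 0] bounded_linear_scaleR_right, of "2 ^ k"]
    by (simp add: tests_def dilate_def)
qed

lemma dilate_tests_same: "\<phi> \<in> tests R \<Longrightarrow> 0 \<le> R \<Longrightarrow> dilate k \<phi> \<in> tests R"
proof -
  assume *: "\<phi> \<in> tests R" "0 \<le> R"
  have "R / 2 ^ k \<le> R" using *(2) mult_left_mono[of 1 "2 ^ k" R] by (simp add: field_simps)
  then show ?thesis using dilate_tests[OF *(1)] tests_mono by blast
qed

lemma nderiv_dilate:
  assumes "smooth \<phi>"
  shows "nderiv j (dilate k \<phi>) = (\<lambda>x. 2 ^ (k * j) *\<^sub>R dilate k (nderiv j \<phi>) x)"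
  using nderiv_linear[OF smooth_affine[OF assms, of "2 ^ k" 0] bounded_linear_scaleR_right, of j "2 ^ k"]
    nderiv_affine[OF assms, of j "2 ^ k" 0]
  unfolding dilate_def power_mult by (simp add: mult.commute)

lemma Cnorm_dilate:
  assumes "\<phi> \<in> tests R"
  shows "Cnorm m (dilate k \<phi>) \<le> (real m + 1) * (2 ^ (k * (m + 1)) * Cnorm m \<phi>)"
proof (rule Cnorm_le)
  fix j x assume "j \<le> m"
  have "norm (nderiv j (dilate k \<phi>) x) = 2 ^ (k * (j + 1)) * norm (nderiv j \<phi> (2 ^ k * x))"
    unfolding nderiv_dilate[OF tests_smooth[OF assms]] by (simp add: dilate_def power_add)
  also have "\<dots> \<le> 2 ^ (k * (m + 1)) * Cnorm m \<phi>"
    using \<open>j \<le> m\<close> by (intro mult_mono power_increasing norm_nderiv_le_Cnorm[OF assms]) auto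
  finally show "norm (nderiv j (dilate k \<phi>) x) \<le> 2 ^ (k * (m + 1)) * Cnorm m \<phi>" .
qed

lemma integral_tests_affine:
  fixes \<phi> :: "real \<Rightarrow> 'a::banach"
  assumes "\<phi> \<in> tests R" "m \<noteq> 0"
  shows "integral UNIV (\<lambda>x. \<phi> (m * x + c)) = (1 / \<bar>m\<bar>) *\<^sub>R integral UNIV \<phi>"
  by (rule integral_affine[of "- R" R])
    (simp_all add: smooth_continuous[OF tests_smooth[OF assms(1)]] tests_support[OF assms(1)] assms(2))

lemma integral_dilate:
  fixes \<phi> :: "real \<Rightarrow> 'a::banach"
  assumes "\<phi> \<in> tests R"
  shows "integral UNIV (dilate k \<phi>) = integral UNIV \<phi>"
  using integral_tests_affine[OF assms, of "2 ^ k" 0] by (simp add: dilate_def)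

lemma test_fun_integral_1:
  obtains \<sigma> :: "real \<Rightarrow> 'k::{real_normed_field,euclidean_space}"
  where "\<sigma> \<in> tests 1" "integral UNIV \<sigma> = 1"
proof -
  have b: "bump \<in> tests 1"
  proof -
    have "bump x = 0" if "1 < \<bar>x\<bar>" for x
      using bump_pos_iff[of x] that by linarith
    then show ?thesis using smooth_bump by (simp add: tests_def)
  qed
  have "integral {- 1..1} bump \<noteq> 0"
    using integral_eq_0_iff[OF smooth_continuous[OF smooth_bump], of "- 1" 1] bump_nonneg bump_pos_iff[of "1/2"]
    by force
  then have I: "integral UNIV bump \<noteq> 0" using tests_integral(2)[OF b] by simp
  define \<sigma> :: "real \<Rightarrow> 'k" where "\<sigma> x = of_real (inverse (integral UNIV bump) *\<^sub>R bump x)" for x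
  have "\<sigma> \<in> tests 1"
    unfolding \<sigma>_def[abs_def] by (intro tests_linear[OF _ bounded_linear_of_real] tests_scaleR b)
  have "integral UNIV \<sigma> = of_real (integral UNIV (\<lambda>x. inverse (integral UNIV bump) *\<^sub>R bump x))"
    using integral_linear[OF tests_integral(1)[OF tests_scaleR[OF b]] bounded_linear_of_real, of "inverse (integral UNIV bump)"]
    by (simp only: o_def \<sigma>_def[abs_def])
  moreover have "integral UNIV (\<lambda>x. inverse (integral UNIV bump) *\<^sub>R bump x) = 1"
    unfolding integral_cmul using I by simp
  ultimately have "integral UNIV \<sigma> = 1" by (simp only: of_real_1)
  with \<open>\<sigma> \<in> tests 1\<close> show ?thesis by (rule that)
qed

lemma integral_tests_diff:
  fixes \<phi> :: "real \<Rightarrow> 'a::banach"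
  assumes "\<phi> \<in> tests R" "\<psi> \<in> tests R"
  shows "integral UNIV (\<lambda>x. \<phi> x - \<psi> x) = integral UNIV \<phi> - integral UNIV \<psi>"
  by (rule integral_diff[OF tests_integral(1)[OF assms(1)] tests_integral(1)[OF assms(2)]])

text \<open>
  Induction on the order, where \<open>L\<close> denotes \<open>dilate 1\<close>. If \<open>\<rho> - L \<rho>\<close> is the derivative of order
  \<open>N\<close> of \<open>\<theta>\<close>, then \<open>L (\<rho> - L \<rho>)\<close> is \<open>2\<^sup>-\<^sup>N\<close> times the derivative of order \<open>N\<close> of
  \<open>L \<theta>\<close>. For \<open>\<rho>' = (2\<^sup>N * L \<rho> - \<rho>) / (2\<^sup>N - 1)\<close>, which again has integral 1, the difference
  \<open>\<rho>' - L \<rho>'\<close> is therefore a multiple of the derivative of order \<open>N\<close> of \<open>L \<theta> - \<theta>\<close>. The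
  latter function has integral zero, hence it is itself a derivative. In other words, passing from
  \<open>\<rho>\<close> to \<open>\<rho>'\<close> annihilates the \<open>N\<close>-th moment.
\<close>

lemma dyadic_mollifier:
  shows "\<exists>\<rho> \<theta> :: real \<Rightarrow> 'k::{real_normed_field,euclidean_space}. \<rho> \<in> tests 1 \<and> \<theta> \<in> tests 1 \<and>
    integral UNIV \<rho> = 1 \<and> (\<lambda>x. \<rho> x - dilate 1 \<rho> x) = nderiv (Suc n) \<theta>"
proof (induction n)
  case 0
  obtain \<sigma> :: "real \<Rightarrow> 'k" where \<sigma>: "\<sigma> \<in> tests 1" "integral UNIV \<sigma> = 1" by (rule test_fun_integral_1)
  have L: "dilate 1 \<sigma> \<in> tests 1" by (rule dilate_tests_same[OF \<sigma>(1)]) simp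
  have "integral UNIV (\<lambda>x. \<sigma> x - dilate 1 \<sigma> x) = 0"
    unfolding integral_tests_diff[OF \<sigma>(1) L] integral_dilate[OF \<sigma>(1)] by simp
  then obtain \<zeta> where "\<zeta> \<in> tests 1" "nderiv 1 \<zeta> = (\<lambda>x. \<sigma> x - dilate 1 \<sigma> x)"
    by (rule tests_antiderivative[OF tests_diff[OF \<sigma>(1) L] zero_less_one])
  with \<sigma> show ?case by (metis One_nat_def)
next
  case (Suc n)
  let ?N = "Suc n"
  obtain \<rho> \<theta> :: "real \<Rightarrow> 'k" where \<rho>: "\<rho> \<in> tests 1" "integral UNIV \<rho> = 1" and \<theta>: "\<theta> \<in> tests 1"
    and eq: "(\<lambda>x. \<rho> x - dilate 1 \<rho> x) = nderiv ?N \<theta>" using Suc by blast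
  have L: "dilate 1 \<rho> \<in> tests 1" "dilate 1 \<theta> \<in> tests 1"
    by (intro dilate_tests_same \<rho> \<theta> zero_le_one)+
  define c :: real where "c = 1 / (2 ^ ?N - 1)"
  have "(1::real) < 2 ^ ?N" by (rule one_less_power) auto
  then have c: "c * (2 ^ ?N - 1) = 1" by (simp add: c_def)
  define \<rho>' where "\<rho>' = (\<lambda>x. c *\<^sub>R (2 ^ ?N *\<^sub>R dilate 1 \<rho> x - \<rho> x))"
  have \<rho>': "\<rho>' \<in> tests 1"
    unfolding \<rho>'_def by (intro tests_scaleR tests_diff L \<rho>)
  have "integral UNIV \<rho>' = c *\<^sub>R (2 ^ ?N *\<^sub>R 1 - 1)"
    unfolding \<rho>'_def integral_cmul integral_tests_diff[OF tests_scaleR[OF L(1)] \<rho>(1)]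
      integral_dilate[OF \<rho>(1)] \<rho>(2) ..
  also have "\<dots> = (c * (2 ^ ?N - 1)) *\<^sub>R 1" by (simp add: algebra_simps)
  finally have int: "integral UNIV \<rho>' = 1" unfolding c by simp
  have "integral UNIV (\<lambda>x. dilate 1 \<theta> x - \<theta> x) = 0"
    unfolding integral_tests_diff[OF L(2) \<theta>] integral_dilate[OF \<theta>] by simp
  then obtain \<zeta> where \<zeta>: "\<zeta> \<in> tests 1" "nderiv 1 \<zeta> = (\<lambda>x. dilate 1 \<theta> x - \<theta> x)"
    by (rule tests_antiderivative[OF tests_diff[OF L(2) \<theta>] zero_less_one])
  have "\<rho>' x - dilate 1 \<rho>' x = nderiv (Suc ?N) (\<lambda>x. c *\<^sub>R \<zeta> x) x" for x
  proof -
    have "nderiv (Suc ?N) (\<lambda>x. c *\<^sub>R \<zeta> x) x = c *\<^sub>R nderiv ?N (nderiv 1 \<zeta>) x"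
      using nderiv_linear[OF tests_smooth[OF \<zeta>(1)] bounded_linear_scaleR_right, of "Suc ?N" c]
      by (simp add: nderiv_nderiv)
    also have "\<dots> = c *\<^sub>R (2 ^ ?N *\<^sub>R dilate 1 (nderiv ?N \<theta>) x - nderiv ?N \<theta> x)"
      unfolding \<zeta>(2) nderiv_diff[OF tests_smooth[OF L(2)] tests_smooth[OF \<theta>]]
        nderiv_dilate[OF tests_smooth[OF \<theta>]] by simp
    also have "\<dots> = \<rho>' x - dilate 1 \<rho>' x"
      by (simp add: eq[symmetric] \<rho>'_def dilate_def algebra_simps)
    finally show ?thesis by simp
  qed
  then have "(\<lambda>x. \<rho>' x - dilate 1 \<rho>' x) = nderiv (Suc ?N) (\<lambda>x. c *\<^sub>R \<zeta> x)" by blast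
  with \<rho>' int tests_scaleR[OF \<zeta>(1), of c] show ?case by blast
qed

section \<open>Exchanging a distribution with an integral\<close>

context normed_scaling
begin

text \<open>
  Both sides are limits of integrals over \<open>[-R, t]\<close>. As functions of \<open>t\<close> they have the same
  derivative: the integrand is Lipschitz in \<open>y\<close>, uniformly in \<open>z\<close> and together with all derivatives
  in \<open>z\<close>, so that the local estimate for \<open>T\<close> yields a quadratic remainder. The fundamental
  theorem of calculus then replaces a theorem of Fubini type.
\<close>

lemma reg_dist_conv:
  assumes T: "T \<in> distributions smul" and \<phi>: "\<phi> \<in> test_funs" and \<psi>: "\<psi> \<in> test_funs"
  shows "(\<lambda>z. integral UNIV (\<lambda>y. \<psi> y * \<phi> (y - z))) \<in> test_funs"
    and "reg_dist smul (dist_conv T \<phi>) \<psi> = T (\<lambda>z. integral UNIV (\<lambda>y. \<psi> y * \<phi> (y - z)))"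
proof -
  obtain R where "0 < R" and t: "\<phi> \<in> tests R" "\<psi> \<in> tests R" using test_funs_common[OF \<phi> \<psi>] .
  have cont: "continuous_on UNIV (nderiv j \<phi>)" "continuous_on S \<psi>" for j S
    using t by (auto intro: smooth_continuous smooth_continuous_nderiv tests_smooth)
  define W where "W j y z = \<psi> y * ((-1) ^ j *\<^sub>R nderiv j \<phi> (y - z))" for j y z
  define I where "I j t z = integral {- R..t} (\<lambda>y. W j y z)" for j t z
  have contW: "continuous_on S (\<lambda>y. W j y z)" for S j z
    unfolding W_def
    by (intro continuous_intros cont continuous_on_compose2[OF cont(1)]) auto
  have deriv: "(I j t has_vector_derivative I (Suc j) t z) (at z)" for j t z
  proof -
    have "((\<lambda>z. integral (cbox (- R) t) ((\<lambda>z y. W j y z) z)) has_vector_derivative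
        integral (cbox (- R) t) ((\<lambda>z y. W (Suc j) y z) z)) (at z within UNIV)"
    proof (rule leibniz_rule_vector_derivative)
      fix z y
      have "((\<lambda>z. y - z) has_vector_derivative - 1) (at z)"
        by (auto intro!: derivative_eq_intros)
      from vector_diff_chain_at[OF this nderiv_has_vector_derivative[OF tests_smooth[OF t(1)], of j]]
      have "((\<lambda>z. nderiv j \<phi> (y - z)) has_vector_derivative - nderiv (Suc j) \<phi> (y - z)) (at z)"
        by (simp add: o_def)
      from bounded_linear.has_vector_derivative[OF bounded_linear_mult_right
          bounded_linear.has_vector_derivative[OF bounded_linear_scaleR_right this], of "\<psi> y" "(-1) ^ j"]
      show "((\<lambda>z. W j y z) has_vector_derivative W (Suc j) y z) (at z within UNIV)"
        by (simp add: W_def)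
    next
      show "(\<lambda>y. W j y z) integrable_on cbox (- R) t" for z
        using integrable_continuous_real[OF contW] by simp
      show "continuous_on (UNIV \<times> cbox (- R) t) (\<lambda>(z, y). W (Suc j) y z)"
        unfolding W_def split_beta
        by (intro continuous_intros continuous_on_compose2[OF cont(1)] continuous_on_compose2[OF cont(2)[of UNIV]]) auto
    qed auto
    then show ?thesis by (simp add: I_def[abs_def])
  qed
  have I: "smooth (I 0 t)" "nderiv j (I 0 t) = I j t" for j t
    using derivative_tower[where g = "\<lambda>j. I j t", OF deriv] by auto
  have It: "I 0 t \<in> tests (2 * R)" if "t \<le> R" for t
  proof -
    have "I 0 t z = 0" if "2 * R < \<bar>z\<bar>" for z
    proof -
      have "I 0 t z = integral {- R..t} (\<lambda>_. 0)"
        unfolding I_def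
      proof (rule integral_cong)
        fix y assume "y \<in> {- R..t}"
        then have "R < \<bar>y - z\<bar>" using that \<open>t \<le> R\<close> by (auto simp: abs_if split: if_splits)
        then show "W 0 y z = 0" using tests_zero[OF t(1)] by (simp add: W_def)
      qed
      then show ?thesis by simp
    qed
    then show ?thesis using I(1) by (simp add: tests_def)
  qed
  have full: "I 0 R = (\<lambda>z. integral UNIV (\<lambda>y. \<psi> y * \<phi> (y - z)))"
  proof
    fix z
    show "I 0 R z = integral UNIV (\<lambda>y. \<psi> y * \<phi> (y - z))"
      using integral_compact_support[OF contW[of _ 0 z], of "- R" R] tests_support[OF t(2)]
      by (simp add: I_def W_def)
  qed
  show "(\<lambda>z. integral UNIV (\<lambda>y. \<psi> y * \<phi> (y - z))) \<in> test_funs"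
    using tests_test_funs[OF It[of R]] by (simp add: full)
  obtain C m where "0 \<le> C" and C: "\<And>\<phi>. \<phi> \<in> tests (2 * R) \<Longrightarrow> norm (T \<phi>) \<le> C * Cnorm m \<phi>"
    using distribution_local_estimate[OF T] by blast
  define L where "L j = Cnorm 0 \<psi> * Cnorm 1 (nderiv j \<phi>) + Cnorm 1 \<psi> * Cnorm 0 (nderiv j \<phi>)" for j
  define L' where "L' = (\<Sum>j\<le>m. L j)"
  have nn: "0 \<le> Cnorm i \<psi>" "0 \<le> Cnorm i (nderiv j \<phi>)" for i j
    using t by (auto intro: Cnorm_nonneg tests_nderiv)
  have L: "0 \<le> L j" for j by (simp add: L_def nn)
  have LipW: "norm (W j y z - W j s z) \<le> L j * \<bar>y - s\<bar>" for j y s z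
  proof -
    let ?d = "nderiv j \<phi>"
    have "norm (W j y z - W j s z) = norm (\<psi> y * ?d (y - z) - \<psi> s * ?d (s - z))"
      by (simp add: W_def scaleR_diff_right[symmetric])
    also have "\<psi> y * ?d (y - z) - \<psi> s * ?d (s - z) = \<psi> y * (?d (y - z) - ?d (s - z)) + (\<psi> y - \<psi> s) * ?d (s - z)"
      by (simp add: algebra_simps)
    also have "norm \<dots> \<le> Cnorm 0 \<psi> * (Cnorm 1 ?d * \<bar>y - s\<bar>) + (Cnorm 1 \<psi> * \<bar>y - s\<bar>) * Cnorm 0 ?d"
    proof (rule norm_triangle_le, intro add_mono)
      show "norm (\<psi> y * (?d (y - z) - ?d (s - z))) \<le> Cnorm 0 \<psi> * (Cnorm 1 ?d * \<bar>y - s\<bar>)"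
        unfolding norm_mult
        using norm_nderiv_le_Cnorm[OF t(2), of 0 0 y] tests_Lipschitz[OF tests_nderiv[OF t(1)], of j "y - z" "s - z"] nn
        by (intro mult_mono) auto
      show "norm ((\<psi> y - \<psi> s) * ?d (s - z)) \<le> (Cnorm 1 \<psi> * \<bar>y - s\<bar>) * Cnorm 0 ?d"
        unfolding norm_mult
        using norm_nderiv_le_Cnorm[OF tests_nderiv[OF t(1)], of 0 0 j "s - z"] tests_Lipschitz[OF t(2), of y s] nn
        by (intro mult_mono) auto
    qed
    finally show ?thesis by (simp add: L_def algebra_simps)
  qed
  have "((\<lambda>t. T (I 0 t)) has_vector_derivative smul (\<psi> t) (dist_conv T \<phi> t)) (at t within {- R..R})"
    if t_in: "t \<in> {- R..R}" for t
  proof (rule has_vector_derivative_quadratic)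
    fix h assume th: "t + h \<in> {- R..R}"
    define \<zeta> where "\<zeta> = (\<lambda>z. I 0 (t + h) z - I 0 t z - h *\<^sub>R W 0 t z)"
    have refl: "(\<lambda>z. \<phi> (t - z)) \<in> tests (2 * R)"
    proof -
      have "R + \<bar>t\<bar> \<le> 2 * R" using t_in by (auto simp: abs_le_iff)
      then show ?thesis using tests_reflect[OF t(1), of t] tests_mono by blast
    qed
    have Wt: "W 0 t \<in> tests (2 * R)"
      using tests_cmult[OF refl, of "\<psi> t"] by (simp add: W_def[abs_def])
    have tI: "I 0 (t + h) \<in> tests (2 * R)" "I 0 t \<in> tests (2 * R)"
      using t_in th by (auto intro: It)
    have \<zeta>: "\<zeta> \<in> tests (2 * R)"
      unfolding \<zeta>_def by (intro tests_diff tests_scaleR Wt tI)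
    have TW: "T (W 0 t) = smul (\<psi> t) (dist_conv T \<phi> t)"
      using distribution_cmult[OF T tests_test_funs[OF refl], of "\<psi> t"]
      by (simp add: W_def[abs_def] dist_conv_def)
    have "T \<zeta> = T (I 0 (t + h)) - T (I 0 t) - h *\<^sub>R T (W 0 t)"
      unfolding \<zeta>_def
      using distribution_diff[OF T tests_test_funs[OF tests_diff[OF tI]] tests_test_funs[OF tests_scaleR[OF Wt]], of h]
        distribution_diff[OF T tests_test_funs[OF tI(1)] tests_test_funs[OF tI(2)]]
        distribution_scaleR[OF T tests_test_funs[OF Wt], of h] by simp
    then have "norm (T (I 0 (t + h)) - T (I 0 t) - h *\<^sub>R smul (\<psi> t) (dist_conv T \<phi> t)) \<le> C * Cnorm m \<zeta>"
      using C[OF \<zeta>] TW by simp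
    also have "\<dots> \<le> C * ((real m + 1) * (L' * h\<^sup>2))"
    proof (rule mult_left_mono[OF Cnorm_le \<open>0 \<le> C\<close>])
      fix j z assume "j \<le> m"
      have nW: "nderiv j (W 0 t) = W j t"
        using nderiv_linear[OF tests_smooth[OF refl] bounded_linear_mult_right, of j "\<psi> t"]
          nderiv_reflect[OF tests_smooth[OF t(1)], of j t]
        by (simp add: W_def[abs_def])
      have "nderiv j \<zeta> z = I j (t + h) z - I j t z - h *\<^sub>R W j t z"
        unfolding \<zeta>_def
        using nderiv_diff[OF tests_smooth[OF tests_diff[OF tI]] tests_smooth[OF tests_scaleR[OF Wt]], of j h]
          nderiv_diff[OF tests_smooth[OF tI(1)] tests_smooth[OF tI(2)], of j]
          nderiv_linear[OF tests_smooth[OF Wt] bounded_linear_scaleR_right, of j h]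
        by (simp add: I(2) nW)
      also have "norm \<dots> \<le> L j * h\<^sup>2"
      proof -
        let ?S = "closed_segment t (t + h)"
        have sub: "?S \<subseteq> {- R..R}" using t_in th by (simp add: closed_segment_subset)
        have "norm (I j (t + h) z - I j t z - (t + h - t) *\<^sub>R W j t z) \<le> norm (t + h - t) * (L j * \<bar>h\<bar>)"
        proof (rule vector_differentiable_bound_linearization[where S = ?S and f = "\<lambda>s. I j s z"
              and f' = "\<lambda>s. W j s z"])
          show "((\<lambda>s. I j s z) has_vector_derivative W j s z) (at s within ?S)" if "s \<in> ?S" for s
            unfolding I_def
            by (rule has_vector_derivative_within_subset[OF integral_has_vector_derivative[OF contW] sub])
              (use that sub in auto)
          show "norm (W j s z - W j t z) \<le> L j * \<bar>h\<bar>" if "s \<in> ?S" for s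
          proof -
            have "\<bar>s - t\<bar> \<le> \<bar>h\<bar>"
              using that by (auto simp: closed_segment_eq_real_ivl split: if_splits)
            then show ?thesis using LipW[of j s z t] mult_left_mono[OF _ L[of j]] by (meson order_trans)
          qed
        qed auto
        then show ?thesis by (simp add: power2_eq_square mult_ac)
      qed
      also have "\<dots> \<le> L' * h\<^sup>2"
        unfolding L'_def using \<open>j \<le> m\<close> L by (intro mult_right_mono member_le_sum) auto
      finally show "norm (nderiv j \<zeta> z) \<le> L' * h\<^sup>2" .
    qed
    finally show "norm (T (I 0 (t + h)) - T (I 0 t) - h *\<^sub>R smul (\<psi> t) (dist_conv T \<phi> t))
        \<le> (C * (real m + 1) * L') * h\<^sup>2" by (simp add: mult_ac)
  qed
  then have "((\<lambda>t. smul (\<psi> t) (dist_conv T \<phi> t)) has_integral T (I 0 R) - T (I 0 (- R))) {- R..R}"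
    using \<open>0 < R\<close> by (intro fundamental_theorem_of_calculus) auto
  moreover have "I 0 (- R) = (\<lambda>_. 0)" by (simp add: I_def fun_eq_iff)
  ultimately have "((\<lambda>t. smul (\<psi> t) (dist_conv T \<phi> t)) has_integral T (I 0 R)) {- R..R}"
    using distribution_zero[OF T] by simp
  then have "reg_dist smul (dist_conv T \<phi>) \<psi> = T (I 0 R)"
    using reg_dist_tests(1)[OF t(2) smooth_continuous[OF smooth_dist_conv[OF T \<phi>]]] has_integral_unique
    by blast
  then show "reg_dist smul (dist_conv T \<phi>) \<psi> = T (\<lambda>z. integral UNIV (\<lambda>y. \<psi> y * \<phi> (y - z)))"
    by (simp add: full)
qed

section \<open>Mollification\<close>

text \<open>
  The dilated kernel lives on an interval of length \<open>2 / 2 ^ k\<close> and has size \<open>2 ^ k\<close>, so the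
  constant does not depend on \<open>k\<close>.
\<close>

lemma dilate_kernel:
  fixes \<rho> :: "real \<Rightarrow> 'k"
  assumes \<rho>: "\<rho> \<in> tests 1" and int: "integral UNIV \<rho> = 1"
    and h: "continuous_on UNIV h" "\<And>y. \<bar>y - c\<bar> \<le> 1 / 2 ^ k \<Longrightarrow> norm (h y - v) \<le> \<delta>"
  shows "norm (integral UNIV (\<lambda>y. smul (dilate k \<rho> (c - y)) (h y)) - v) \<le> 2 * Cnorm 0 \<rho> * \<delta>"
    and "norm (integral UNIV (\<lambda>y. smul (dilate k \<rho> (y - c)) (h y)) - v) \<le> 2 * Cnorm 0 \<rho> * \<delta>"
proof -
  have D: "dilate k \<rho> \<in> tests (1 / 2 ^ k)" by (rule dilate_tests[OF \<rho>])
  have cont: "continuous_on UNIV (dilate k \<rho>)" by (rule smooth_continuous[OF tests_smooth[OF D]])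
  have bnd: "norm (dilate k \<rho> y) \<le> 2 ^ k * Cnorm 0 \<rho>" for y
    using norm_nderiv_le_Cnorm[OF \<rho>, of 0 0 "2 ^ k * y"] by (simp add: dilate_def)
  have i: "integral UNIV (\<lambda>y. dilate k \<rho> (c - y)) = 1" "integral UNIV (\<lambda>y. dilate k \<rho> (y - c)) = 1"
    using integral_tests_affine[OF D, of "- 1" c] integral_tests_affine[OF D, of 1 "- c"]
      integral_dilate[OF \<rho>, of k] int by simp_all
  have "norm (integral UNIV (\<lambda>y. smul (dilate k \<rho> (c - y)) (h y)) - v) \<le> 2 * (1 / 2 ^ k) * (2 ^ k * Cnorm 0 \<rho>) * \<delta>"
    using h(2) bnd i
    by (intro kernel_average[where c = c] h(1) continuous_on_compose2[OF cont] continuous_intros)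
      (auto intro!: tests_zero[OF D])
  then show "norm (integral UNIV (\<lambda>y. smul (dilate k \<rho> (c - y)) (h y)) - v) \<le> 2 * Cnorm 0 \<rho> * \<delta>" by simp
  have "norm (integral UNIV (\<lambda>y. smul (dilate k \<rho> (y - c)) (h y)) - v) \<le> 2 * (1 / 2 ^ k) * (2 ^ k * Cnorm 0 \<rho>) * \<delta>"
    using h(2) bnd i
    by (intro kernel_average[where c = c] h(1) continuous_on_compose2[OF cont] continuous_intros)
      (auto intro!: tests_zero[OF D])
  then show "norm (integral UNIV (\<lambda>y. smul (dilate k \<rho> (y - c)) (h y)) - v) \<le> 2 * Cnorm 0 \<rho> * \<delta>" by simp
qed

lemma mollify_function:
  fixes \<rho> :: "real \<Rightarrow> 'k"
  assumes \<rho>: "\<rho> \<in> tests 1" "integral UNIV \<rho> = 1" and g: "continuous_on UNIV g"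
  shows "(\<lambda>k. dist_conv (reg_dist smul g) (dilate k \<rho>) x) \<longlonglongrightarrow> g x"
proof (rule tendstoI)
  fix e :: real assume "0 < e"
  define \<delta> where "\<delta> = e / (2 * Cnorm 0 \<rho> + 1)"
  have pos: "0 < 2 * Cnorm 0 \<rho> + 1" using Cnorm_nonneg[OF \<rho>(1), of 0] by simp
  then have \<delta>: "0 < \<delta>" using \<open>0 < e\<close> by (simp add: \<delta>_def)
  have "isCont g x" using g by (simp add: continuous_on_eq_continuous_at)
  then obtain d where d: "0 < d" "\<And>y. \<bar>y - x\<bar> < d \<Longrightarrow> norm (g y - g x) < \<delta>"
    using \<delta> by (auto simp: continuous_at_eps_delta dist_norm)
  have "(\<lambda>k. 1 / 2 ^ k :: real) \<longlonglongrightarrow> 0"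
    using LIMSEQ_power_zero[of "1 / 2 :: real"] by (simp add: power_one_over)
  from order_tendstoD(2)[OF this d(1)]
  show "eventually (\<lambda>k. dist (dist_conv (reg_dist smul g) (dilate k \<rho>) x) (g x) < e) sequentially"
  proof eventually_elim
    case (elim k)
    have t: "dilate k \<rho> \<in> test_funs" by (rule tests_test_funs[OF dilate_tests[OF \<rho>(1)]])
    have "norm (dist_conv (reg_dist smul g) (dilate k \<rho>) x - g x) \<le> 2 * Cnorm 0 \<rho> * \<delta>"
      unfolding dist_conv_reg_dist[OF t]
      by (rule dilate_kernel(1)[OF \<rho> g]) (use d(2) elim in \<open>force intro: less_imp_le\<close>)
    also have "\<dots> < (2 * Cnorm 0 \<rho> + 1) * \<delta>" using \<delta> by (simp add: algebra_simps)
    also have "\<dots> = e" using pos by (simp add: \<delta>_def)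
    finally show ?case by (simp add: dist_norm)
  qed
qed

end

text \<open>
  After the substitution \<open>y = w + z\<close> the derivatives in \<open>z\<close> fall on \<open>\<psi>\<close>, and each of them is
  averaged by a kernel concentrated near \<open>z\<close>.
\<close>

lemma mollify_test_fun:
  fixes \<rho> \<psi> :: "real \<Rightarrow> 'k::{real_normed_field,euclidean_space}"
  assumes \<rho>: "\<rho> \<in> tests 1" "integral UNIV \<rho> = 1" and \<psi>: "\<psi> \<in> test_funs"
  shows "test_null_seq (\<lambda>k z. integral UNIV (\<lambda>y. \<psi> y * dilate k \<rho> (y - z)) - \<psi> z)"
proof -
  interpret K: normed_scaling "(*) :: 'k \<Rightarrow> 'k \<Rightarrow> 'k" by (rule normed_scaling_mult)
  obtain R where "0 < R" and t: "\<psi> \<in> tests R" using test_funs_tests[OF \<psi>] .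
  define M where "M k z = integral UNIV (\<lambda>y. \<psi> y * dilate k \<rho> (y - z))" for k z
  define I where "I j k z = integral {- 1..1} (\<lambda>w. dilate k \<rho> w * nderiv j \<psi> (w + z))" for j k z
  have D: "dilate k \<rho> \<in> tests 1" for k by (rule dilate_tests_same[OF \<rho>(1)]) simp
  have cont: "continuous_on UNIV (nderiv j \<psi>)" "continuous_on S (dilate k \<rho>)" for j k S
    using t D by (auto intro: smooth_continuous smooth_continuous_nderiv tests_smooth)
  have contW: "continuous_on S (\<lambda>w. dilate k \<rho> w * nderiv j \<psi> (w + z))" for S j k z
    by (intro continuous_intros cont continuous_on_compose2[OF cont(1)]) auto
  have IU: "I j k z = integral UNIV (\<lambda>w. dilate k \<rho> w * nderiv j \<psi> (w + z))" for j k z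
    unfolding I_def
    by (rule integral_compact_support[symmetric, OF contW]) (use tests_support[OF D] in auto)
  have MI: "M k = I 0 k" for k
  proof
    fix z
    have "integral UNIV (\<lambda>y. (\<lambda>w. dilate k \<rho> w * \<psi> (w + z)) (1 * y + - z))
        = (1 / \<bar>1\<bar>) *\<^sub>R integral UNIV (\<lambda>w. dilate k \<rho> w * \<psi> (w + z))"
      by (rule integral_affine[of "- 1" 1]) (use contW[of _ k 0 z] tests_support[OF D] in auto)
    then show "M k z = I 0 k z" by (simp add: M_def IU mult.commute)
  qed
  have deriv: "(I j k has_vector_derivative I (Suc j) k z) (at z)" for j k z
  proof -
    have "((\<lambda>z. integral (cbox (- 1) 1) ((\<lambda>z w. dilate k \<rho> w * nderiv j \<psi> (w + z)) z)) has_vector_derivative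
        integral (cbox (- 1) 1) ((\<lambda>z w. dilate k \<rho> w * nderiv (Suc j) \<psi> (w + z)) z)) (at z within UNIV)"
    proof (rule leibniz_rule_vector_derivative)
      fix z w
      have "((\<lambda>z. w + z) has_vector_derivative 1) (at z)"
        by (auto intro!: derivative_eq_intros)
      from vector_diff_chain_at[OF this nderiv_has_vector_derivative[OF tests_smooth[OF t], of j]]
      have "((\<lambda>z. nderiv j \<psi> (w + z)) has_vector_derivative nderiv (Suc j) \<psi> (w + z)) (at z)"
        by (simp add: o_def)
      from bounded_linear.has_vector_derivative[OF bounded_linear_mult_right this]
      show "((\<lambda>z. dilate k \<rho> w * nderiv j \<psi> (w + z)) has_vector_derivative
          dilate k \<rho> w * nderiv (Suc j) \<psi> (w + z)) (at z within UNIV)" by simp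
    next
      show "(\<lambda>w. dilate k \<rho> w * nderiv j \<psi> (w + z)) integrable_on cbox (- 1) 1" for z
        using integrable_continuous_real[OF contW] by simp
      show "continuous_on (UNIV \<times> cbox (- 1) 1) (\<lambda>(z, w). dilate k \<rho> w * nderiv (Suc j) \<psi> (w + z))"
        unfolding split_beta
        by (intro continuous_intros continuous_on_compose2[OF cont(1)] continuous_on_compose2[OF cont(2)[of UNIV]]) auto
    qed auto
    then show ?thesis by (simp add: I_def[abs_def])
  qed
  have I: "smooth (I 0 k)" "nderiv j (I 0 k) = I j k" for j k
    using derivative_tower[where g = "\<lambda>j. I j k", OF deriv] by auto
  have It: "I 0 k \<in> tests (R + 1)" for k
  proof -
    have "I 0 k z = 0" if "R + 1 < \<bar>z\<bar>" for z
    proof -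
      have "I 0 k z = integral {- 1..1::real} (\<lambda>_. 0)"
        unfolding I_def
      proof (rule integral_cong)
        fix w :: real assume "w \<in> {- 1..1}"
        then have "R < \<bar>w + z\<bar>" using that by (auto simp: abs_if split: if_splits)
        then show "dilate k \<rho> w * nderiv 0 \<psi> (w + z) = 0" using tests_zero[OF t] by simp
      qed
      then show ?thesis by simp
    qed
    then show ?thesis using I(1) by (simp add: tests_def)
  qed
  have t': "\<psi> \<in> tests (R + 1)" using t tests_mono[of R "R + 1"] by auto
  have diff: "(\<lambda>z. M k z - \<psi> z) \<in> tests (R + 1)" for k
    unfolding MI by (rule tests_diff[OF It t'])
  have est: "norm (nderiv j (\<lambda>z. M k z - \<psi> z) z) \<le> 2 * Cnorm 0 \<rho> * (Cnorm 1 (nderiv j \<psi>) * (1 / 2 ^ k))" for j k z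
  proof -
    have "nderiv j (\<lambda>z. M k z - \<psi> z) z = I j k z - nderiv j \<psi> z"
      unfolding MI nderiv_diff[OF tests_smooth[OF It] tests_smooth[OF t]] I(2) ..
    also have "I j k z = integral UNIV (\<lambda>w. dilate k \<rho> (w - 0) * nderiv j \<psi> (w + z))"
      by (simp add: IU)
    also have "norm (\<dots> - nderiv j \<psi> z) \<le> 2 * Cnorm 0 \<rho> * (Cnorm 1 (nderiv j \<psi>) * (1 / 2 ^ k))"
    proof (rule K.dilate_kernel(2)[OF \<rho>])
      show "continuous_on UNIV (\<lambda>w. nderiv j \<psi> (w + z))"
        by (intro continuous_intros continuous_on_compose2[OF cont(1)]) auto
      fix w :: real assume "\<bar>w - 0\<bar> \<le> 1 / 2 ^ k"
      then show "norm (nderiv j \<psi> (w + z) - nderiv j \<psi> z) \<le> Cnorm 1 (nderiv j \<psi>) * (1 / 2 ^ k)"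
        using tests_Lipschitz[OF tests_nderiv[OF t], of j "w + z" z]
          mult_left_mono[OF _ Cnorm_nonneg[OF tests_nderiv[OF t], of 1 j], of "\<bar>w\<bar>" "1 / 2 ^ k"] by simp
    qed
    finally show ?thesis .
  qed
  have "test_null_seq (\<lambda>k z. M k z - \<psi> z)"
    unfolding test_null_seq_def
  proof (intro conjI allI exI[of _ "{- (R + 1)..R + 1}"])
    show "range (\<lambda>k z. M k z - \<psi> z) \<subseteq> test_funs" using diff tests_test_funs by blast
    show "{x. M k x - \<psi> x \<noteq> 0} \<subseteq> {- (R + 1)..R + 1}" for k
      using tests_support[OF diff[of k]] by blast
    show "uniform_limit UNIV (\<lambda>k. nderiv j (\<lambda>z. M k z - \<psi> z)) (\<lambda>_. 0) sequentially" for j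
    proof (rule uniform_limitI)
      fix e :: real assume "0 < e"
      have "(\<lambda>k. 2 * Cnorm 0 \<rho> * (Cnorm 1 (nderiv j \<psi>) * (1 / 2 ^ k))) \<longlonglongrightarrow> 2 * Cnorm 0 \<rho> * (Cnorm 1 (nderiv j \<psi>) * 0)"
        using LIMSEQ_power_zero[of "1 / 2 :: real"] by (intro tendsto_intros) (simp add: power_one_over)
      then have "eventually (\<lambda>k. 2 * Cnorm 0 \<rho> * (Cnorm 1 (nderiv j \<psi>) * (1 / 2 ^ k)) < e) sequentially"
        using \<open>0 < e\<close> by (intro order_tendstoD(2)) simp_all
      then show "eventually (\<lambda>k. \<forall>z\<in>UNIV. dist (nderiv j (\<lambda>z. M k z - \<psi> z) z) 0 < e) sequentially"
      proof eventually_elim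
        case (elim k)
        then show ?case
          unfolding dist_norm diff_zero by (intro ballI le_less_trans[OF est])
      qed
    qed
  qed simp
  then show ?thesis by (simp add: M_def)
qed

lemma (in normed_scaling) mollify_distribution:
  fixes \<rho> :: "real \<Rightarrow> 'k"
  assumes T: "T \<in> distributions smul" and \<rho>: "\<rho> \<in> tests 1" "integral UNIV \<rho> = 1" and \<psi>: "\<psi> \<in> test_funs"
  shows "(\<lambda>k. reg_dist smul (dist_conv T (dilate k \<rho>)) \<psi>) \<longlonglongrightarrow> T \<psi>"
proof -
  define M where "M k = (\<lambda>z. integral UNIV (\<lambda>y. \<psi> y * dilate k \<rho> (y - z)))" for k
  have D: "dilate k \<rho> \<in> test_funs" for k by (rule tests_test_funs[OF dilate_tests[OF \<rho>(1)]])
  have "(\<lambda>k. T (\<lambda>z. M k z - \<psi> z)) \<longlonglongrightarrow> 0"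
    using distribution_null_seq[OF T mollify_test_fun[OF \<rho> \<psi>]] by (simp add: M_def)
  moreover have "T (\<lambda>z. M k z - \<psi> z) = reg_dist smul (dist_conv T (dilate k \<rho>)) \<psi> - T \<psi>" for k
    using distribution_diff[OF T reg_dist_conv(1)[OF T D \<psi>] \<psi>, of k] reg_dist_conv(2)[OF T D \<psi>, of k]
    by (simp add: M_def)
  ultimately show ?thesis by (simp add: LIM_zero_iff)
qed

section \<open>Integrability of test functions\<close>

lemma tests_integrable:
  fixes \<phi> :: "real \<Rightarrow> 'k::{real_normed_field,euclidean_space}"
  assumes "\<phi> \<in> tests R"
  shows "integrable lborel \<phi>"
proof -
  have "integrable lborel (\<lambda>x. indicator {- R..R} x *\<^sub>R \<phi> x)"
    by (intro borel_integrable_compact smooth_continuous[OF tests_smooth[OF assms]]) auto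
  also have "(\<lambda>x. indicator {- R..R} x *\<^sub>R \<phi> x) = \<phi>"
    using tests_support[OF assms] by (auto simp: indicator_def fun_eq_iff)
  finally show ?thesis .
qed

lemma test_funs_DL1: "\<phi> \<in> test_funs \<Longrightarrow> \<phi> \<in> DL1"
  by (auto simp: DL1_def test_funs_smooth elim!: test_funs_tests intro: tests_integrable tests_nderiv)

lemma DL1_norm_nderiv: "DL1_norm j (nderiv i \<phi>) = DL1_norm (j + i) \<phi>"
  by (simp add: DL1_norm_def nderiv_nderiv)

lemma DL1_norm_nonneg: "0 \<le> DL1_norm j \<phi>"
  by (simp add: DL1_norm_def)

lemma (in normed_scaling) reg_dist_bound:
  assumes g: "continuous_on UNIV g" "\<And>x. norm (g x) \<le> B" and \<phi>: "\<phi> \<in> test_funs"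
  shows "norm (reg_dist smul g \<phi>) \<le> B * DL1_norm 0 \<phi>"
proof -
  obtain R where t: "\<phi> \<in> tests R" using test_funs_tests[OF \<phi>] .
  have "((\<lambda>x. norm (\<phi> x)) has_integral DL1_norm 0 \<phi>) UNIV"
    using has_integral_integral_lborel[OF integrable_norm[OF tests_integrable[OF t]]]
    by (simp add: DL1_norm_def)
  from has_integral_mult_right[OF this, of B]
  have n: "((\<lambda>x. B * norm (\<phi> x)) has_integral B * DL1_norm 0 \<phi>) UNIV" .
  have "norm (integral UNIV (\<lambda>x. smul (\<phi> x) (g x))) \<le> integral UNIV (\<lambda>x. B * norm (\<phi> x))"
  proof (rule integral_norm_bound_integral)
    show "norm (smul (\<phi> x) (g x)) \<le> B * norm (\<phi> x)" for x
      unfolding norm_scale mult.commute[of B] by (rule mult_left_mono[OF g(2)]) simp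
  qed (use n reg_dist_tests(2)[OF t g(1)] in auto)
  then show ?thesis unfolding integral_unique[OF n] using \<phi> by (simp add: reg_dist_def)
qed

section \<open>Uniform estimates for convolutions\<close>

context normed_scaling
begin

text \<open>
  The function \<open>g\<close> is the pointwise limit of its mollifications. These only depend on the
  distribution of \<open>g\<close>, so they may be computed from an essentially bounded function \<open>f\<close> with the
  same distribution. If the integrand is not integrable, its integral is 0 by convention, which
  satisfies the bound as well.
\<close>

lemma bounded_if_L_infinity:
  assumes g: "continuous_on UNIV g" and L: "reg_dist smul g \<in> L_infinity smul"
  obtains B where "\<And>x. norm (g x) \<le> B"
proof -
  obtain f C where f: "reg_dist smul g = reg_dist smul f" and C: "AE x in lebesgue. norm (f x) \<le> C"
    using L by (auto simp: L_infinity_def)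
  obtain N where N: "negligible N" "\<And>x. x \<notin> N \<Longrightarrow> norm (f x) \<le> C"
    using AE_E3[OF C] by (auto simp: negligible_iff_null_sets)
  obtain \<sigma> :: "real \<Rightarrow> 'k" where \<sigma>: "\<sigma> \<in> tests 1" "integral UNIV \<sigma> = 1" by (rule test_fun_integral_1)
  define P where "P = Cnorm 0 \<sigma>"
  have "0 \<le> P" unfolding P_def by (rule Cnorm_nonneg[OF \<sigma>(1)])
  have bound: "norm (dist_conv (reg_dist smul g) (dilate k \<sigma>) x) \<le> 2 * P * \<bar>C\<bar>" for k x
  proof -
    define r :: real where "r = 1 / 2 ^ k"
    have D: "dilate k \<sigma> \<in> tests r" unfolding r_def by (rule dilate_tests[OF \<sigma>(1)])
    define H where "H y = smul (dilate k \<sigma> (x - y)) (f y)" for y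
    define H' where "H' y = (if y \<in> N then 0 else H y)" for y
    have eq: "dist_conv (reg_dist smul g) (dilate k \<sigma>) x = integral UNIV H'"
    proof -
      have "integral UNIV H = integral UNIV H'"
        by (rule integral_spike[OF N(1)]) (simp add: H'_def)
      then show ?thesis
        unfolding f dist_conv_reg_dist[OF tests_test_funs[OF D]] H_def .
    qed
    have J: "((\<lambda>y. if y \<in> {x - r..x + r} then P * \<bar>C\<bar> * 2 ^ k else 0) has_integral (2 * r) * (P * \<bar>C\<bar> * 2 ^ k)) UNIV"
      unfolding has_integral_restrict_UNIV
      using has_integral_const_real[of "P * \<bar>C\<bar> * 2 ^ k" "x - r" "x + r"] by (simp add: r_def)
    show ?thesis
    proof (cases "H' integrable_on UNIV")
      case True
      have "norm (integral UNIV H') \<le> integral UNIV (\<lambda>y. if y \<in> {x - r..x + r} then P * \<bar>C\<bar> * 2 ^ k else 0)"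
      proof (rule integral_norm_bound_integral[OF True])
        show "(\<lambda>y. if y \<in> {x - r..x + r} then P * \<bar>C\<bar> * 2 ^ k else 0) integrable_on UNIV" using J by blast
        show "norm (H' y) \<le> (if y \<in> {x - r..x + r} then P * \<bar>C\<bar> * 2 ^ k else 0)" for y
        proof -
          have "dilate k \<sigma> (x - y) = 0" if "y \<notin> {x - r..x + r}"
            using that by (intro tests_zero[OF D]) auto
          moreover have "norm (H y) \<le> (2 ^ k * P) * \<bar>C\<bar>" if "y \<notin> N"
            unfolding H_def norm_scale P_def
          proof (rule mult_mono)
            show "norm (dilate k \<sigma> (x - y)) \<le> 2 ^ k * Cnorm 0 \<sigma>"
              using norm_nderiv_le_Cnorm[OF \<sigma>(1), of 0 0 "2 ^ k * (x - y)"] by (simp add: dilate_def)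
            show "norm (f y) \<le> \<bar>C\<bar>" using N(2)[OF that] by linarith
          qed (use \<open>0 \<le> P\<close> P_def in auto)
          ultimately show ?thesis
            using \<open>0 \<le> P\<close> by (auto simp: H'_def H_def mult_ac)
        qed
      qed
      also have "\<dots> = 2 * P * \<bar>C\<bar>" using J by (simp add: integral_unique r_def)
      finally show ?thesis unfolding eq .
    next
      case False
      then show ?thesis using \<open>0 \<le> P\<close> by (simp add: eq not_integrable_integral)
    qed
  qed
  have "norm (g x) \<le> 2 * P * \<bar>C\<bar>" for x
    by (rule tendsto_upperbound[OF tendsto_norm[OF mollify_function[OF \<sigma> g]]]) (use bound in auto)
  then show ?thesis by (rule that)
qed

lemma reg_dist_scaleR: "reg_dist smul (\<lambda>x. c *\<^sub>R f x) \<phi> = c *\<^sub>R reg_dist smul f \<phi>" if "\<phi> \<in> test_funs"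
  using that by (simp add: reg_dist_def smul_scaleR)

context
  fixes T :: "(real \<Rightarrow> 'k) \<Rightarrow> 'x"
  assumes T: "T \<in> distributions smul"
    and bounded: "\<And>\<phi> \<psi>. \<phi> \<in> tests 1 \<Longrightarrow> \<psi> \<in> tests 1 \<Longrightarrow>
      \<exists>C. \<forall>x. norm (dist_conv (reg_dist smul (dist_conv T \<phi>)) \<psi> x) \<le> C"
begin

lemma cont_conv: "\<phi> \<in> tests R \<Longrightarrow> continuous_on S (dist_conv T \<phi>)"
  by (intro smooth_continuous smooth_dist_conv[OF T] tests_test_funs)

lemma conv_distribution: "\<phi> \<in> tests R \<Longrightarrow> reg_dist smul (dist_conv T \<phi>) \<in> distributions smul"
  by (intro reg_dist_distributions cont_conv)

text \<open>
  For fixed \<open>\<phi>\<close> the principle of uniform boundedness, with the points \<open>x\<close> as indices, gives a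
  seminorm that depends on \<open>\<phi>\<close>. A second application, now in \<open>\<phi>\<close> and with the pairs
  \<open>(x, \<psi>)\<close> as indices, makes it independent of \<open>\<phi>\<close>.
\<close>

lemma double_conv_estimate:
  obtains C m M where "0 \<le> C"
    "\<And>\<phi> \<psi> x. \<phi> \<in> tests 1 \<Longrightarrow> \<psi> \<in> tests 1 \<Longrightarrow>
      norm (dist_conv (reg_dist smul (dist_conv T \<phi>)) \<psi> x) \<le> C * Cnorm m \<phi> * Cnorm M \<psi>"
proof -
  let ?S = "\<lambda>\<phi>. reg_dist smul (dist_conv T \<phi>)"
  have first: "\<exists>N::nat. \<forall>\<psi>\<in>tests 1. \<forall>x. norm (dist_conv (?S \<phi>) \<psi> x) \<le> real N * Cnorm N \<psi>"
    if \<phi>: "\<phi> \<in> tests 1" for \<phi>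
  proof -
    note S = conv_distribution[OF \<phi>]
    obtain C m N where "0 \<le> C"
      and C: "\<And>\<psi> x. \<psi> \<in> tests 1 \<Longrightarrow> norm (dist_conv (?S \<phi>) \<psi> x) \<le> C * Cnorm m \<psi> * real N"
    proof (rule uniform_boundedness[where R = 1 and B = "\<lambda>x \<psi>. dist_conv (?S \<phi>) \<psi> x" and w = "\<lambda>N x. real N"])
      show "\<exists>C m. \<forall>\<psi>\<in>tests 1. norm (dist_conv (?S \<phi>) \<psi> x) \<le> C * Cnorm m \<psi>" for x
        using dist_conv_local_estimate[OF S, of 1 "\<bar>x\<bar>"] by (metis order_refl)
      show "\<exists>N. \<forall>x. norm (dist_conv (?S \<phi>) \<psi> x) \<le> real N" if "\<psi> \<in> tests 1" for \<psi>
        using bounded[OF \<phi> that] real_arch_simple by (meson order_trans)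
    qed (auto simp: dist_conv_diff[OF S] dist_conv_scaleR[OF S] tests_test_funs)
    \<comment> \<open>A single number serves as constant and as order, as the weights below demand.\<close>
    define K where "K = max m (nat \<lceil>C * real N\<rceil>)"
    have "norm (dist_conv (?S \<phi>) \<psi> x) \<le> real K * Cnorm K \<psi>" if \<psi>: "\<psi> \<in> tests 1" for \<psi> x
    proof -
      have "norm (dist_conv (?S \<phi>) \<psi> x) \<le> (C * real N) * Cnorm m \<psi>"
        using C[OF \<psi>, of x] by (simp add: mult_ac)
      also have "\<dots> \<le> real K * Cnorm K \<psi>"
        using \<open>0 \<le> C\<close> Cnorm_mono[OF \<psi>, of m K] Cnorm_nonneg[OF \<psi>]
        by (intro mult_mono) (auto simp: K_def, linarith)
      finally show ?thesis .
    qed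
    then show ?thesis by blast
  qed
  \<comment> \<open>Indices with \<open>\<psi>\<close> outside of \<open>tests 1\<close> are made harmless by the value 0.\<close>
  define B where "B i \<phi> = (if snd i \<in> tests 1 then dist_conv (?S \<phi>) (snd i) (fst i) else 0)"
    for i :: "real \<times> (real \<Rightarrow> 'k)" and \<phi>
  define w where "w N i = (if snd i \<in> tests 1 then real N * Cnorm N (snd i) else 0)"
    for N and i :: "real \<times> (real \<Rightarrow> 'k)"
  obtain C m N where "0 \<le> C"
    and C: "\<And>\<phi> i. \<phi> \<in> tests 1 \<Longrightarrow> norm (B i \<phi>) \<le> C * Cnorm m \<phi> * w N i"
  proof (rule uniform_boundedness[where R = 1 and B = B and w = w])
    fix i :: "real \<times> (real \<Rightarrow> 'k)"
    obtain x \<psi> where i: "i = (x, \<psi>)" by (cases i)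
    show "B i (\<lambda>x. \<phi>1 x - \<phi>2 x) = B i \<phi>1 - B i \<phi>2" if "\<phi>1 \<in> tests 1" "\<phi>2 \<in> tests 1" for \<phi>1 \<phi>2
    proof -
      have "dist_conv T (\<lambda>x. \<phi>1 x - \<phi>2 x) = (\<lambda>y. dist_conv T \<phi>1 y - dist_conv T \<phi>2 y)"
        using dist_conv_diff[OF T] that tests_test_funs by blast
      then show ?thesis
        using that by (auto simp: B_def i dist_conv_def[of "reg_dist _ _"] reg_dist_diff cont_conv
            test_funs_reflect tests_test_funs)
    qed
    show "B i (\<lambda>x. c *\<^sub>R \<phi> x) = c *\<^sub>R B i \<phi>" if "\<phi> \<in> tests 1" for c \<phi>
    proof -
      have "dist_conv T (\<lambda>x. c *\<^sub>R \<phi> x) = (\<lambda>y. c *\<^sub>R dist_conv T \<phi> y)"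
        using dist_conv_scaleR[OF T] that tests_test_funs by blast
      then show ?thesis
        using that by (auto simp: B_def i dist_conv_def[of "reg_dist _ _"] reg_dist_scaleR
            test_funs_reflect tests_test_funs)
    qed
    show "\<exists>C m. \<forall>\<phi>\<in>tests 1. norm (B i \<phi>) \<le> C * Cnorm m \<phi>"
    proof (cases "\<psi> \<in> tests 1")
      case True
      define R where "R = 1 + \<bar>x\<bar>"
      obtain C m where "0 \<le> C" and C: "\<And>\<phi> y. \<phi> \<in> tests 1 \<Longrightarrow> \<bar>y\<bar> \<le> R \<Longrightarrow> norm (dist_conv T \<phi> y) \<le> C * Cnorm m \<phi>"
        using dist_conv_local_estimate[OF T, of 1 R] by blast
      have "norm (B i \<phi>) \<le> (Cnorm 0 \<psi> * C * (2 * R)) * Cnorm m \<phi>" if \<phi>: "\<phi> \<in> tests 1" for \<phi>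
      proof -
        have \<eta>: "(\<lambda>y. \<psi> (x - y)) \<in> tests R" unfolding R_def by (rule tests_reflect[OF True])
        have "norm (?S \<phi> (\<lambda>y. \<psi> (x - y))) \<le> (Cnorm 0 \<psi> * (C * Cnorm m \<phi>)) * measure lborel (cbox (- R) R)"
        proof (rule has_integral_bound)
          show "((\<lambda>y. smul (\<psi> (x - y)) (dist_conv T \<phi> y)) has_integral ?S \<phi> (\<lambda>y. \<psi> (x - y))) (cbox (- R) R)"
            using reg_dist_tests(1)[OF \<eta> cont_conv[OF \<phi>]] by simp
          show "norm (smul (\<psi> (x - y)) (dist_conv T \<phi> y)) \<le> Cnorm 0 \<psi> * (C * Cnorm m \<phi>)"
            if "y \<in> cbox (- R) R" for y
            unfolding norm_scale using norm_nderiv_le_Cnorm[OF True, of 0 0 "x - y"] C[OF \<phi>, of y] that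
            by (intro mult_mono) (auto simp: abs_le_iff Cnorm_nonneg[OF True])
        qed (use \<open>0 \<le> C\<close> Cnorm_nonneg[OF \<phi>] Cnorm_nonneg[OF True] in simp)
        also have "measure lborel (cbox (- R) R) = 2 * R" by (simp add: R_def)
        finally show ?thesis using True by (simp add: B_def i dist_conv_def[of "reg_dist _ _"] mult_ac)
      qed
      then show ?thesis by blast
    next
      case False
      then show ?thesis by (intro exI[of _ 0]) (simp add: B_def i)
    qed
  next
    show "\<exists>N. \<forall>i. norm (B i \<phi>) \<le> w N i" if "\<phi> \<in> tests 1" for \<phi>
      using first[OF that] by (auto simp: B_def w_def)
  next
    fix C m N
    assume "0 \<le> C" "\<And>\<phi> i. \<phi> \<in> tests 1 \<Longrightarrow> norm (B i \<phi>) \<le> C * Cnorm m \<phi> * w N i"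
    then show thesis by (rule that)
  qed
  show ?thesis
  proof (rule that[of "C * real N" m N])
    fix \<phi> \<psi> :: "real \<Rightarrow> 'k" and x
    assume "\<phi> \<in> tests 1" "\<psi> \<in> tests 1"
    then show "norm (dist_conv (?S \<phi>) \<psi> x) \<le> (C * real N) * Cnorm m \<phi> * Cnorm N \<psi>"
      using C[of \<phi> "(x, \<psi>)"] by (simp add: B_def w_def mult_ac)
  qed (use \<open>0 \<le> C\<close> in simp)
qed

end

end

text \<open>
  Telescoping of \<open>dyadic_mollifier\<close> over the dyadic scales, with derivatives of order \<open>n = M + 2\<close>.
  Pulling a derivative of order \<open>n\<close> out of the scale \<open>k\<close> gains the factor \<open>2\<^sup>-\<^sup>k\<^sup>n\<close>, whereas
  \<open>Cnorm M\<close> of the dilated function grows at most like \<open>2\<close> to the power \<open>k * (M + 1)\<close>; what remains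
  is the geometric sequence \<open>2\<^sup>-\<^sup>k\<close>.
\<close>

lemma mollifier_corrections:
  obtains \<rho> :: "real \<Rightarrow> 'k::{real_normed_field,euclidean_space}" and c \<Theta> n
  where "\<rho> \<in> tests 1" "integral UNIV \<rho> = 1" "0 \<le> c"
    "\<And>K. \<Theta> K \<in> tests 1" "\<Theta> 0 = (\<lambda>_. 0)"
    "\<And>K x. dilate K \<rho> x = \<rho> x + nderiv n (\<Theta> K) x"
    "\<And>K L. K \<le> L \<Longrightarrow> Cnorm M (\<lambda>x. \<Theta> L x - \<Theta> K x) \<le> c * (1 / 2) ^ K"
proof -
  let ?n = "Suc (Suc M)"
  obtain \<rho> \<theta> :: "real \<Rightarrow> 'k" where \<rho>: "\<rho> \<in> tests 1" "integral UNIV \<rho> = 1" and \<theta>: "\<theta> \<in> tests 1"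
    and eq: "(\<lambda>x. \<rho> x - dilate 1 \<rho> x) = nderiv ?n \<theta>" using dyadic_mollifier by blast
  define \<tau> where "\<tau> k = (\<lambda>x. (1 / 2 ^ (k * ?n)) *\<^sub>R dilate k \<theta> x)" for k
  define \<Theta> where "\<Theta> K x = - (\<Sum>k<K. \<tau> k x)" for K x
  have D: "dilate k \<theta> \<in> tests 1" for k by (rule dilate_tests_same[OF \<theta>]) simp
  have \<tau>: "\<tau> k \<in> tests 1" for k unfolding \<tau>_def by (rule tests_scaleR[OF D])
  have \<Theta>: "\<Theta> K \<in> tests 1" for K
    unfolding \<Theta>_def[abs_def]
    by (rule tests_linear[OF tests_sum[OF finite_lessThan \<tau>] bounded_linear_minus[OF bounded_linear_ident]])
  have \<Theta>_Suc: "\<Theta> (Suc K) = (\<lambda>x. \<Theta> K x - \<tau> K x)" for K by (simp add: \<Theta>_def fun_eq_iff)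
  define c where "c = (real M + 1) * Cnorm M \<theta>"
  have "0 \<le> c" using Cnorm_nonneg[OF \<theta>] by (simp add: c_def)
  have C\<tau>: "Cnorm M (\<tau> k) \<le> c * (1 / 2) ^ k" for k
  proof -
    have "Cnorm M (\<tau> k) \<le> \<bar>1 / 2 ^ (k * ?n)\<bar> * Cnorm M (dilate k \<theta>)"
      unfolding \<tau>_def by (rule Cnorm_scaleR[OF D])
    also have "\<dots> \<le> \<bar>1 / 2 ^ (k * ?n)\<bar> * ((real M + 1) * (2 ^ (k * (M + 1)) * Cnorm M \<theta>))"
      by (intro mult_left_mono Cnorm_dilate[OF \<theta>]) simp
    also have "\<dots> = c * (1 / 2) ^ k"
      by (simp add: c_def field_simps power_add)
    finally show ?thesis .
  qed
  have diff: "(\<lambda>x. \<Theta> (K + d) x - \<Theta> K x) \<in> tests 1" for K d by (intro tests_diff \<Theta>)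
  have step: "Cnorm M (\<lambda>x. \<Theta> (K + d) x - \<Theta> K x) \<le> 2 * c * ((1 / 2) ^ K - (1 / 2) ^ (K + d))" for K d
  proof (induction d)
    case 0
    have "Cnorm M (\<lambda>_. 0 :: 'k) \<le> 0"
      using Cnorm_scaleR[OF \<theta>, of M 0] by simp
    then show ?case by simp
  next
    case (Suc d)
    have "Cnorm M (\<lambda>x. \<Theta> (K + Suc d) x - \<Theta> K x) = Cnorm M (\<lambda>x. (\<Theta> (K + d) x - \<Theta> K x) - \<tau> (K + d) x)"
      by (simp add: \<Theta>_Suc algebra_simps)
    also have "\<dots> \<le> Cnorm M (\<lambda>x. \<Theta> (K + d) x - \<Theta> K x) + Cnorm M (\<tau> (K + d))"
      by (rule Cnorm_triangle(2)[OF diff \<tau>])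
    also have "\<dots> \<le> 2 * c * ((1 / 2) ^ K - (1 / 2) ^ (K + Suc d))"
      using Suc.IH C\<tau>[of "K + d"] by (simp add: algebra_simps)
    finally show ?case .
  qed
  show ?thesis
  proof (rule that[OF \<rho>, of "2 * c" \<Theta> ?n])
    show "\<Theta> 0 = (\<lambda>_. 0)" by (simp add: \<Theta>_def fun_eq_iff)
    show "Cnorm M (\<lambda>x. \<Theta> L x - \<Theta> K x) \<le> 2 * c * (1 / 2) ^ K" if "K \<le> L" for K L
    proof -
      have "2 * c * ((1 / 2) ^ K - (1 / 2) ^ L) \<le> 2 * c * (1 / 2) ^ K"
        using \<open>0 \<le> c\<close> by (intro mult_left_mono) auto
      then show ?thesis using step[of K "L - K"] that by simp
    qed
    show "dilate K \<rho> x = \<rho> x + nderiv ?n (\<Theta> K) x" for K x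
    proof (induction K)
      case 0
      have "\<Theta> 0 = (\<lambda>_. 0)" by (simp add: \<Theta>_def fun_eq_iff)
      then show ?case by (simp add: dilate_def nderiv_zero)
    next
      case (Suc K)
      have "nderiv ?n (\<tau> K) x = (1 / 2 ^ (K * ?n)) *\<^sub>R (2 ^ (K * ?n) *\<^sub>R dilate K (nderiv ?n \<theta>) x)"
        unfolding \<tau>_def
          nderiv_linear[OF tests_smooth[OF D] bounded_linear_scaleR_right] nderiv_dilate[OF tests_smooth[OF \<theta>]] ..
      also have "\<dots> = dilate K (nderiv ?n \<theta>) x" by simp
      also have "\<dots> = dilate K \<rho> x - dilate K (dilate 1 \<rho>) x"
        unfolding eq[symmetric] by (simp add: dilate_def scaleR_diff_right)
      also have "dilate K (dilate 1 \<rho>) = dilate (Suc K) \<rho>" by (simp add: dilate_dilate)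
      finally have "dilate (Suc K) \<rho> x = \<rho> x + nderiv ?n (\<Theta> K) x - nderiv ?n (\<tau> K) x"
        using Suc.IH by (simp add: algebra_simps)
      then show ?case
        unfolding \<Theta>_Suc nderiv_diff[OF tests_smooth[OF \<Theta>] tests_smooth[OF \<tau>]] by (simp add: algebra_simps)
    qed
  qed (use \<open>0 \<le> c\<close> \<Theta> in auto)
qed

context normed_scaling
begin

text \<open>
  With \<open>S = T * \<phi>\<close>, the identity for the mollifiers gives
  \<open>S * \<rho>\<^sub>K = (T * \<phi>) * \<rho> + (T * \<phi>\<^sup>(\<^sup>n\<^sup>)) * \<Theta> K\<close>, because the derivatives of \<open>\<Theta> K\<close> can be
  moved to \<open>\<phi>\<close>. Both terms are controlled by the bilinear estimate, uniformly in \<open>K\<close>, and the left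
  hand side tends to \<open>S\<close>. It is essential here that the seminorm in the second argument does not
  depend on the first one, since \<open>n\<close> is chosen in terms of the former and then enters the latter.
\<close>

lemma conv_estimate:
  assumes T: "T \<in> distributions smul"
    and bounded: "\<And>\<phi> \<psi>. \<phi> \<in> tests 1 \<Longrightarrow> \<psi> \<in> tests 1 \<Longrightarrow>
      \<exists>C. \<forall>x. norm (dist_conv (reg_dist smul (dist_conv T \<phi>)) \<psi> x) \<le> C"
  obtains C m where "0 \<le> C" "\<And>\<phi> x. \<phi> \<in> tests 1 \<Longrightarrow> norm (dist_conv T \<phi> x) \<le> C * Cnorm m \<phi>"
proof -
  let ?S = "\<lambda>\<phi>. reg_dist smul (dist_conv T \<phi>)"
  obtain C m M where "0 \<le> C" and C: "\<And>\<phi> \<psi> x. \<phi> \<in> tests 1 \<Longrightarrow> \<psi> \<in> tests 1 \<Longrightarrow>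
      norm (dist_conv (?S \<phi>) \<psi> x) \<le> C * Cnorm m \<phi> * Cnorm M \<psi>"
    using double_conv_estimate[OF T bounded] by blast
  obtain \<rho> :: "real \<Rightarrow> 'k" and c \<Theta> n where \<rho>: "\<rho> \<in> tests 1" "integral UNIV \<rho> = 1" and "0 \<le> c"
    and \<Theta>: "\<And>K. \<Theta> K \<in> tests 1" "\<Theta> 0 = (\<lambda>_. 0)"
    and dil: "\<And>K x. dilate K \<rho> x = \<rho> x + nderiv n (\<Theta> K) x"
    and c: "\<And>K L. K \<le> L \<Longrightarrow> Cnorm M (\<lambda>x. \<Theta> L x - \<Theta> K x) \<le> c * (1 / 2) ^ K"
    using mollifier_corrections[where M = M] by blast
  define C' where "C' = C * Cnorm M \<rho> + C * (real m + 1) * c"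
  have "norm (dist_conv T \<phi> x) \<le> C' * Cnorm (m + n) \<phi>" if \<phi>: "\<phi> \<in> tests 1" for \<phi> x
  proof -
    have sm: "smooth (dist_conv T \<phi>)" by (rule smooth_dist_conv[OF T tests_test_funs[OF \<phi>]])
    note S = reg_dist_distributions[OF smooth_continuous[OF sm]]
    have n\<phi>: "nderiv n \<phi> \<in> tests 1" by (rule tests_nderiv[OF \<phi>])
    have parts: "dist_conv (?S \<phi>) (nderiv n \<psi>) x = dist_conv (?S (nderiv n \<phi>)) \<psi> x" if "\<psi> \<in> tests 1" for \<psi>
    proof -
      have \<psi>: "\<psi> \<in> test_funs" using that by (rule tests_test_funs)
      let ?\<eta> = "\<lambda>y. \<psi> (x - y)"
      have \<eta>: "?\<eta> \<in> test_funs" by (rule test_funs_reflect[OF \<psi>])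
      have "(\<lambda>y. nderiv n \<psi> (x - y)) = (\<lambda>y. (-1) ^ n *\<^sub>R nderiv n ?\<eta> y)"
        by (simp add: nderiv_reflect[OF test_funs_smooth[OF \<psi>]] power_mult_distrib[symmetric])
      then have "dist_conv (?S \<phi>) (nderiv n \<psi>) x = (-1) ^ n *\<^sub>R ?S \<phi> (nderiv n ?\<eta>)"
        using distribution_scaleR[OF S test_funs_nderiv[OF \<eta>], of "(-1) ^ n" n]
        by (simp add: dist_conv_def[of "reg_dist _ _"])
      also have "\<dots> = reg_dist smul (nderiv n (dist_conv T \<phi>)) ?\<eta>"
        by (rule reg_dist_by_parts[OF sm \<eta>, symmetric])
      also have "\<dots> = dist_conv (?S (nderiv n \<phi>)) \<psi> x"
        by (simp add: nderiv_dist_conv[OF T tests_test_funs[OF \<phi>]] dist_conv_def[of "reg_dist _ _"])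
      finally show ?thesis .
    qed
    have bound: "norm (dist_conv (?S \<phi>) (dilate K \<rho>) x) \<le> C' * Cnorm (m + n) \<phi>" for K
    proof -
      have "dilate K \<rho> = (\<lambda>x. \<rho> x + nderiv n (\<Theta> K) x)" using dil by blast
      then have "dist_conv (?S \<phi>) (dilate K \<rho>) x = dist_conv (?S \<phi>) \<rho> x + dist_conv (?S (nderiv n \<phi>)) (\<Theta> K) x"
        using dist_conv_add[OF S tests_test_funs[OF \<rho>(1)] tests_test_funs[OF tests_nderiv[OF \<Theta>(1)]], of n K x]
          parts[OF \<Theta>(1), of K] by simp
      also have "norm \<dots> \<le> C * Cnorm m \<phi> * Cnorm M \<rho> + C * Cnorm m (nderiv n \<phi>) * Cnorm M (\<Theta> K)"
        by (intro norm_triangle_le add_mono C \<phi> \<rho>(1) n\<phi> \<Theta>(1))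
      also have "\<dots> \<le> C * Cnorm (m + n) \<phi> * Cnorm M \<rho> + C * ((real m + 1) * Cnorm (m + n) \<phi>) * c"
        using \<open>0 \<le> C\<close> Cnorm_mono[OF \<phi>, of m "m + n"] Cnorm_nderiv[OF \<phi>, of m n] c[of 0 K] \<Theta>(2)
          Cnorm_nonneg[OF \<rho>(1)] Cnorm_nonneg[OF \<Theta>(1)] Cnorm_nonneg[OF \<phi>] Cnorm_nonneg[OF n\<phi>]
        by (intro add_mono mult_mono mult_nonneg_nonneg) auto
      also have "\<dots> = C' * Cnorm (m + n) \<phi>" by (simp add: C'_def algebra_simps)
      finally show ?thesis .
    qed
    show ?thesis
      by (rule tendsto_upperbound[OF tendsto_norm[OF mollify_function[OF \<rho> smooth_continuous[OF sm]]]])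
        (use bound in auto)
  qed
  moreover have "0 \<le> C'"
    using \<open>0 \<le> C\<close> \<open>0 \<le> c\<close> Cnorm_nonneg[OF \<rho>(1)] by (simp add: C'_def)
  ultimately show ?thesis using that by blast
qed

section \<open>The structure theorem\<close>

text \<open>
  The limit in \<open>T * \<rho>\<^sub>K = T * \<rho> + (T * \<Theta> K)\<^sup>(\<^sup>n\<^sup>)\<close> is taken for \<open>T * \<Theta> K\<close> in the uniform norm,
  thanks to \<open>conv_estimate\<close>, and for \<open>T * \<rho>\<^sub>K\<close> in the sense of distributions. Boundedness of \<open>F\<close>
  and \<open>G\<close> yields the bound of \<open>T\<close> by \<open>L\<^sup>1\<close> norms. The functions \<open>\<Phi> K\<close> are the mollifications
  \<open>T * \<rho>\<^sub>K\<close>, and \<open>\<epsilon> K\<close> is a bound for the distance of \<open>T * \<Theta> K\<close> to its limit \<open>G\<close>.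
\<close>

lemma structure_theorem:
  assumes A: "A \<subseteq> D'_of smul (L_infinity smul)" and closed: "smooth_uniformly_closed smul A"
    and TA: "T \<in> D'_of smul A"
  obtains F G n \<Phi> \<epsilon> B where
    "continuous_on UNIV F" "reg_dist smul F \<in> A" "continuous_on UNIV G" "reg_dist smul G \<in> A"
    "T = dist_plus (reg_dist smul F) (dist_deriv n (reg_dist smul G))"
    "\<And>\<psi>. \<psi> \<in> test_funs \<Longrightarrow> norm (T \<psi>) \<le> B * (DL1_norm 0 \<psi> + DL1_norm n \<psi>)"
    "\<And>K. smooth (\<Phi> K)" "\<And>K. reg_dist smul (\<Phi> K) \<in> A" "\<epsilon> \<longlonglongrightarrow> 0"
    "\<And>K \<psi>. \<psi> \<in> test_funs \<Longrightarrow> norm (reg_dist smul (\<Phi> K) \<psi> - T \<psi>) \<le> \<epsilon> K * DL1_norm n \<psi>"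
proof -
  have T: "T \<in> distributions smul" and conv: "\<And>\<phi>. \<phi> \<in> test_funs \<Longrightarrow> reg_dist smul (dist_conv T \<phi>) \<in> A"
    using TA by (auto simp: D'_of_def)
  have "\<exists>C. \<forall>x. norm (dist_conv (reg_dist smul (dist_conv T \<phi>)) \<psi> x) \<le> C"
    if "\<phi> \<in> tests 1" "\<psi> \<in> tests 1" for \<phi> \<psi>
  proof -
    have S: "reg_dist smul (dist_conv T \<phi>) \<in> D'_of smul (L_infinity smul)"
      using conv[OF tests_test_funs[OF that(1)]] A by blast
    then have S': "reg_dist smul (dist_conv T \<phi>) \<in> distributions smul" by (simp add: D'_of_def)
    have "reg_dist smul (dist_conv (reg_dist smul (dist_conv T \<phi>)) \<psi>) \<in> L_infinity smul"
      using S tests_test_funs[OF that(2)] by (simp add: D'_of_def)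
    from bounded_if_L_infinity[OF smooth_continuous[OF smooth_dist_conv[OF S' tests_test_funs[OF that(2)]]] this]
    show ?thesis by blast
  qed
  then obtain C m where "0 \<le> C" and C: "\<And>\<phi> x. \<phi> \<in> tests 1 \<Longrightarrow> norm (dist_conv T \<phi> x) \<le> C * Cnorm m \<phi>"
    using conv_estimate[OF T] by blast
  obtain \<rho> :: "real \<Rightarrow> 'k" and c \<Theta> n where \<rho>: "\<rho> \<in> tests 1" "integral UNIV \<rho> = 1" and "0 \<le> c"
    and \<Theta>: "\<And>K. \<Theta> K \<in> tests 1" "\<Theta> 0 = (\<lambda>_. 0)"
    and dil: "\<And>K x. dilate K \<rho> x = \<rho> x + nderiv n (\<Theta> K) x"
    and c: "\<And>K L. K \<le> L \<Longrightarrow> Cnorm m (\<lambda>x. \<Theta> L x - \<Theta> K x) \<le> c * (1 / 2) ^ K"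
    using mollifier_corrections[where M = m] by blast
  define F where "F = dist_conv T \<rho>"
  define g where "g K = dist_conv T (\<Theta> K)" for K
  define \<Phi> where "\<Phi> K = dist_conv T (dilate K \<rho>)" for K
  define e where "e K = C * c * (1 / 2) ^ K" for K
  have e0: "e \<longlonglongrightarrow> 0"
    unfolding e_def using tendsto_mult_right_zero[OF LIMSEQ_power_zero[of "1 / 2 :: real"]] by simp
  have D: "dilate K \<rho> \<in> tests 1" for K by (rule dilate_tests_same[OF \<rho>(1)]) simp
  have smF: "smooth F" and smg: "smooth (g K)" and sm\<Phi>: "smooth (\<Phi> K)" for K
    unfolding F_def g_def \<Phi>_def by (intro smooth_dist_conv[OF T] tests_test_funs[OF \<rho>(1)] tests_test_funs[OF \<Theta>(1)] tests_test_funs[OF D])+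
  have in_A: "reg_dist smul F \<in> A" "reg_dist smul (g K) \<in> A" "reg_dist smul (\<Phi> K) \<in> A" for K
    unfolding F_def g_def \<Phi>_def by (intro conv tests_test_funs[OF \<rho>(1)] tests_test_funs[OF \<Theta>(1)] tests_test_funs[OF D])+
  have g_diff: "norm (g L x - g K x) \<le> e K" if "K \<le> L" for K L x
  proof -
    have "norm (g L x - g K x) = norm (dist_conv T (\<lambda>x. \<Theta> L x - \<Theta> K x) x)"
      unfolding g_def by (simp add: dist_conv_diff[OF T] tests_test_funs[OF \<Theta>(1)])
    also have "\<dots> \<le> C * Cnorm m (\<lambda>x. \<Theta> L x - \<Theta> K x)" by (intro C tests_diff \<Theta>)
    also have "\<dots> \<le> e K" using mult_left_mono[OF c[OF that] \<open>0 \<le> C\<close>] by (simp add: e_def)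
    finally show ?thesis .
  qed
  have "uniformly_Cauchy_on UNIV g"
  proof (rule uniformly_Cauchy_onI')
    fix \<delta> :: real assume "0 < \<delta>"
    then obtain K0 where "\<And>K. K0 \<le> K \<Longrightarrow> e K < \<delta>"
      using order_tendstoD(2)[OF e0] by (auto simp: eventually_sequentially)
    then show "\<exists>M. \<forall>x\<in>UNIV. \<forall>m\<ge>M. \<forall>n>m. dist (g m x) (g n x) < \<delta>"
      using g_diff by (metis dist_norm norm_minus_commute le_less_trans less_imp_le)
  qed
  then obtain G where G: "uniform_limit UNIV g G sequentially"
    using uniformly_convergent_eq_Cauchy uniformly_convergent_on_def by metis
  have contG: "continuous_on UNIV G"
    by (rule uniform_limit_theorem[OF always_eventually G]) (simp_all add: smooth_continuous[OF smg])
  have GA: "reg_dist smul G \<in> A"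
    using closed smg in_A(2) G unfolding smooth_uniformly_closed_def by blast
  have gG: "norm (g K x - G x) \<le> e K" for K x
  proof (rule tendsto_upperbound)
    show "(\<lambda>L. norm (g K x - g L x)) \<longlonglongrightarrow> norm (g K x - G x)"
      using tendsto_uniform_limitI[OF G] by (intro tendsto_intros) auto
    show "eventually (\<lambda>L. norm (g K x - g L x) \<le> e K) sequentially"
      using eventually_ge_at_top[of K] by eventually_elim (subst norm_minus_commute, rule g_diff)
  qed simp
  have g0: "g 0 x = 0" for x
    by (simp add: g_def \<Theta>(2) dist_conv_def distribution_zero[OF T])
  define B where "B = max (C * Cnorm m \<rho>) (e 0)"
  have FB: "norm (F x) \<le> B" and GB: "norm (G x) \<le> B" for x
    using C[OF \<rho>(1), of x] gG[of 0 x] g0[of x] by (auto simp: F_def B_def)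
  have \<Phi>_eq: "reg_dist smul (\<Phi> K) \<psi> = reg_dist smul F \<psi> + (-1) ^ n *\<^sub>R reg_dist smul (g K) (nderiv n \<psi>)"
    if \<psi>: "\<psi> \<in> test_funs" for K \<psi>
  proof -
    have dil': "dilate K \<rho> = (\<lambda>x. \<rho> x + nderiv n (\<Theta> K) x)" using dil by blast
    have "\<Phi> K x = F x + nderiv n (g K) x" for x
      unfolding \<Phi>_def F_def g_def dil' nderiv_dist_conv[OF T tests_test_funs[OF \<Theta>(1)]]
      by (rule dist_conv_add[OF T tests_test_funs[OF \<rho>(1)] tests_test_funs[OF tests_nderiv[OF \<Theta>(1)]]])
    then have "\<Phi> K = (\<lambda>x. F x + nderiv n (g K) x)" by blast
    then show ?thesis
      using reg_dist_add[OF smooth_continuous[OF smF] smooth_continuous_nderiv[OF smg] \<psi>]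
        reg_dist_by_parts[OF smg \<psi>] by simp
  qed
  have gG_reg: "norm (reg_dist smul (g K) \<psi> - reg_dist smul G \<psi>) \<le> e K * DL1_norm 0 \<psi>"
    if \<psi>: "\<psi> \<in> test_funs" for K \<psi>
  proof -
    have "reg_dist smul (g K) \<psi> - reg_dist smul G \<psi> = reg_dist smul (\<lambda>x. g K x - G x) \<psi>"
      by (rule reg_dist_diff[OF smooth_continuous[OF smg] contG \<psi>, symmetric])
    also have "norm \<dots> \<le> e K * DL1_norm 0 \<psi>"
      by (rule reg_dist_bound[OF _ gG \<psi>]) (intro continuous_intros smooth_continuous[OF smg] contG)
    finally show ?thesis .
  qed
  have T_eq: "T \<psi> = reg_dist smul F \<psi> + (-1) ^ n *\<^sub>R reg_dist smul G (nderiv n \<psi>)" if \<psi>: "\<psi> \<in> test_funs" for \<psi>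
  proof (rule LIMSEQ_unique)
    show "(\<lambda>K. reg_dist smul (\<Phi> K) \<psi>) \<longlonglongrightarrow> T \<psi>"
      unfolding \<Phi>_def by (rule mollify_distribution[OF T \<rho> \<psi>])
    have "(\<lambda>K. reg_dist smul (g K) (nderiv n \<psi>) - reg_dist smul G (nderiv n \<psi>)) \<longlonglongrightarrow> 0"
      by (rule Lim_null_comparison[OF always_eventually
            tendsto_mult_left_zero[OF e0, of "DL1_norm 0 (nderiv n \<psi>)"]])
        (simp add: gG_reg[OF test_funs_nderiv[OF \<psi>]])
    then have "(\<lambda>K. reg_dist smul (g K) (nderiv n \<psi>)) \<longlonglongrightarrow> reg_dist smul G (nderiv n \<psi>)"
      by (simp add: LIM_zero_iff)
    then show "(\<lambda>K. reg_dist smul (\<Phi> K) \<psi>) \<longlonglongrightarrow> reg_dist smul F \<psi> + (-1) ^ n *\<^sub>R reg_dist smul G (nderiv n \<psi>)"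
      unfolding \<Phi>_eq[OF \<psi>] by (intro tendsto_intros)
  qed
  have nd: "DL1_norm 0 (nderiv n \<psi>) = DL1_norm n \<psi>" for \<psi> :: "real \<Rightarrow> 'k" by (simp add: DL1_norm_nderiv)
  show ?thesis
  proof (rule that[of F G n B \<Phi> e])
    show "T = dist_plus (reg_dist smul F) (dist_deriv n (reg_dist smul G))"
    proof (rule extensionalityI[OF distribution_extensional[OF T]])
      show "dist_plus (reg_dist smul F) (dist_deriv n (reg_dist smul G)) \<in> extensional test_funs"
        by (simp add: dist_plus_def)
      show "T \<psi> = dist_plus (reg_dist smul F) (dist_deriv n (reg_dist smul G)) \<psi>" if "\<psi> \<in> test_funs" for \<psi>
        using that T_eq by (simp add: dist_plus_def dist_deriv_def)
    qed
    show "norm (T \<psi>) \<le> B * (DL1_norm 0 \<psi> + DL1_norm n \<psi>)" if \<psi>: "\<psi> \<in> test_funs" for \<psi>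
    proof -
      have "norm (T \<psi>) \<le> norm (reg_dist smul F \<psi>) + norm (reg_dist smul G (nderiv n \<psi>))"
        unfolding T_eq[OF \<psi>] by (rule order_trans[OF norm_triangle_ineq]) simp
      also have "\<dots> \<le> B * DL1_norm 0 \<psi> + B * DL1_norm n \<psi>"
        using reg_dist_bound[OF smooth_continuous[OF smF] FB \<psi>]
          reg_dist_bound[OF contG GB test_funs_nderiv[OF \<psi>], of n] by (simp add: nd add_mono)
      finally show ?thesis by (simp add: algebra_simps)
    qed
    show "norm (reg_dist smul (\<Phi> K) \<psi> - T \<psi>) \<le> e K * DL1_norm n \<psi>" if \<psi>: "\<psi> \<in> test_funs" for K \<psi>
    proof -
      have "reg_dist smul (\<Phi> K) \<psi> - T \<psi>
          = (-1) ^ n *\<^sub>R (reg_dist smul (g K) (nderiv n \<psi>) - reg_dist smul G (nderiv n \<psi>))"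
        by (simp add: \<Phi>_eq[OF \<psi>] T_eq[OF \<psi>] scaleR_diff_right)
      then show ?thesis
        using gG_reg[OF test_funs_nderiv[OF \<psi>], of K n] by (simp add: nd)
    qed
  qed (use smooth_continuous[OF smF] contG GA in_A sm\<Phi> e0 in auto)
qed

end

section \<open>Density of the test functions in \<open>\<D>\<^sub>L\<^sub>1\<close>\<close>

lemma DL1_smooth: "\<phi> \<in> DL1 \<Longrightarrow> smooth \<phi>"
  and DL1_integrable: "\<phi> \<in> DL1 \<Longrightarrow> integrable lborel (nderiv j \<phi>)"
  by (simp_all add: DL1_def)

lemma DL1_nderiv: "\<phi> \<in> DL1 \<Longrightarrow> nderiv j \<phi> \<in> DL1"
  by (simp add: DL1_def smooth_nderiv nderiv_nderiv)

lemma DL1_add: "\<phi> \<in> DL1 \<Longrightarrow> \<psi> \<in> DL1 \<Longrightarrow> (\<lambda>x. \<phi> x + \<psi> x) \<in> DL1"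
  and DL1_diff: "\<phi> \<in> DL1 \<Longrightarrow> \<psi> \<in> DL1 \<Longrightarrow> (\<lambda>x. \<phi> x - \<psi> x) \<in> DL1"
  by (simp_all add: DL1_def smooth_add smooth_diff nderiv_add nderiv_diff)

lemma nderiv_cmult:
  fixes \<phi> :: "real \<Rightarrow> 'k::real_normed_algebra"
  shows "smooth \<phi> \<Longrightarrow> nderiv j (\<lambda>x. c * \<phi> x) = (\<lambda>x. c * nderiv j \<phi> x)"
  by (rule nderiv_linear[OF _ bounded_linear_mult_right])

lemma DL1_cmult: "\<phi> \<in> DL1 \<Longrightarrow> (\<lambda>x. c * \<phi> x) \<in> DL1"
  by (simp add: DL1_def smooth_linear[OF _ bounded_linear_mult_right] nderiv_cmult)

lemma
  assumes "\<phi> \<in> DL1" "\<psi> \<in> DL1"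
  shows DL1_norm_add: "DL1_norm j (\<lambda>x. \<phi> x + \<psi> x) \<le> DL1_norm j \<phi> + DL1_norm j \<psi>"
    and DL1_norm_diff: "DL1_norm j (\<lambda>x. \<phi> x - \<psi> x) \<le> DL1_norm j \<phi> + DL1_norm j \<psi>"
proof -
  note i = DL1_integrable[OF assms(1), of j] DL1_integrable[OF assms(2), of j]
  have sum: "(LINT x|lborel. norm (nderiv j \<phi> x) + norm (nderiv j \<psi> x)) = DL1_norm j \<phi> + DL1_norm j \<psi>"
    unfolding DL1_norm_def by (intro Bochner_Integration.integral_add integrable_norm i)
  have "(LINT x|lborel. norm (nderiv j \<phi> x + nderiv j \<psi> x)) \<le> (LINT x|lborel. norm (nderiv j \<phi> x) + norm (nderiv j \<psi> x))"
    by (intro Bochner_Integration.integral_mono integrable_norm Bochner_Integration.integrable_add i norm_triangle_ineq)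
  then show "DL1_norm j (\<lambda>x. \<phi> x + \<psi> x) \<le> DL1_norm j \<phi> + DL1_norm j \<psi>"
    unfolding sum by (simp add: DL1_norm_def nderiv_add DL1_smooth assms)
  have "(LINT x|lborel. norm (nderiv j \<phi> x - nderiv j \<psi> x)) \<le> (LINT x|lborel. norm (nderiv j \<phi> x) + norm (nderiv j \<psi> x))"
    by (intro Bochner_Integration.integral_mono integrable_norm Bochner_Integration.integrable_add
        Bochner_Integration.integrable_diff i norm_triangle_ineq4)
  then show "DL1_norm j (\<lambda>x. \<phi> x - \<psi> x) \<le> DL1_norm j \<phi> + DL1_norm j \<psi>"
    unfolding sum by (simp add: DL1_norm_def nderiv_diff DL1_smooth assms)
qed

lemma DL1_norm_cmult: "\<phi> \<in> DL1 \<Longrightarrow> DL1_norm j (\<lambda>x. c * \<phi> x) = norm c * DL1_norm j \<phi>"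
  by (simp add: DL1_norm_def nderiv_cmult DL1_smooth norm_mult)

lemma DL1_norm_reflect:
  assumes "smooth \<phi>"
  shows "DL1_norm j (\<lambda>y. \<phi> (x - y)) = DL1_norm j \<phi>"
  using lborel_integral_real_affine[of "- 1" "\<lambda>y. norm (nderiv j \<phi> y)" x]
  by (simp add: DL1_norm_def nderiv_reflect[OF assms])

definition truncate :: "(real \<Rightarrow> 'k::real_normed_field) \<Rightarrow> nat \<Rightarrow> (real \<Rightarrow> 'k) \<Rightarrow> real \<Rightarrow> 'k" where
  "truncate \<eta> k \<phi> = (\<lambda>x. \<eta> (inverse (real (Suc k)) * x) * \<phi> x)"

lemma truncate_test_funs:
  assumes "\<eta> \<in> test_funs" "smooth \<phi>"
  shows "truncate \<eta> k \<phi> \<in> test_funs"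
proof -
  obtain R where "0 < R" and \<eta>: "\<eta> \<in> tests R" using test_funs_tests[OF assms(1)] .
  let ?c = "inverse (real (Suc k))"
  have "(\<lambda>x. \<eta> (?c * x)) \<in> tests (R * real (Suc k))"
  proof -
    have "\<eta> (?c * x) = 0" if "R * real (Suc k) < \<bar>x\<bar>" for x
      using that by (intro tests_zero[OF \<eta>]) (simp add: abs_mult field_simps)
    then show ?thesis
      using smooth_affine[OF tests_smooth[OF \<eta>], of ?c 0] by (simp add: tests_def)
  qed
  then show ?thesis
    unfolding truncate_def by (rule tests_test_funs[OF tests_mult[OF _ assms(2)]])
qed

lemma nderiv_1_truncate:
  assumes "smooth \<eta>" "smooth \<phi>"
  shows "nderiv 1 (truncate \<eta> k \<phi>) =
    (\<lambda>x. truncate \<eta> k (nderiv 1 \<phi>) x + of_real (inverse (real (Suc k))) * truncate (nderiv 1 \<eta>) k \<phi> x)"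
proof
  fix x
  let ?c = "inverse (real (Suc k))"
  have "((\<lambda>x. ?c * x) has_vector_derivative ?c) (at x)"
    by (auto intro!: derivative_eq_intros)
  from vector_diff_chain_at[OF this smooth_has_vector_derivative[OF assms(1)]]
  have "((\<lambda>x. \<eta> (?c * x)) has_vector_derivative ?c *\<^sub>R nderiv 1 \<eta> (?c * x)) (at x)"
    by (simp add: o_def)
  from has_vector_derivative_mult[OF this smooth_has_vector_derivative[OF assms(2)]]
  have "(truncate \<eta> k \<phi> has_vector_derivative
      \<eta> (?c * x) * nderiv 1 \<phi> x + ?c *\<^sub>R nderiv 1 \<eta> (?c * x) * \<phi> x) (at x)"
    by (simp add: truncate_def)
  then have "nderiv 1 (truncate \<eta> k \<phi>) x = \<eta> (?c * x) * nderiv 1 \<phi> x + ?c *\<^sub>R nderiv 1 \<eta> (?c * x) * \<phi> x"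
    by (simp add: nderiv_Suc vector_derivative_at)
  then show "nderiv 1 (truncate \<eta> k \<phi>) x =
      truncate \<eta> k (nderiv 1 \<phi>) x + of_real ?c * truncate (nderiv 1 \<eta>) k \<phi> x"
    by (simp add: truncate_def scaleR_conv_of_real)
qed

text \<open>
  The derivative of \<open>truncate \<eta> k \<phi>\<close> is \<open>truncate \<eta> k \<phi>' + truncate \<eta>' k \<phi> / (k + 1)\<close>. The
  induction hypothesis applies to both terms, and it shows in particular that the second one is
  bounded before it is divided by \<open>k + 1\<close>. For this reason \<open>\<eta>\<close> varies in the induction and is not
  required to be constant near 0.
\<close>

lemma truncate_tendsto:
  fixes \<eta> \<phi> :: "real \<Rightarrow> 'k::{real_normed_field,euclidean_space}"
  assumes "\<eta> \<in> test_funs" "\<phi> \<in> DL1"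
  shows "(\<lambda>k. DL1_norm j (\<lambda>x. truncate \<eta> k \<phi> x - \<eta> 0 * \<phi> x)) \<longlonglongrightarrow> 0"
  using assms
proof (induction j arbitrary: \<eta> \<phi>)
  case 0
  obtain R where \<eta>: "\<eta> \<in> tests R" using test_funs_tests[OF 0(1)] .
  have t: "truncate \<eta> k \<phi> \<in> DL1" for k
    by (rule test_funs_DL1[OF truncate_test_funs[OF 0(1) DL1_smooth[OF 0(2)]]])
  note d = DL1_integrable[OF DL1_diff[OF t DL1_cmult[OF 0(2), of "\<eta> 0"]], of 0, simplified]
  have i\<phi>: "integrable lborel \<phi>" using DL1_integrable[OF 0(2), of 0] by simp
  have "(\<lambda>k. LINT x|lborel. norm (truncate \<eta> k \<phi> x - \<eta> 0 * \<phi> x)) \<longlonglongrightarrow> (LINT x|(lborel :: real measure). (0::real))"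
  proof (rule Bochner_Integration.integral_dominated_convergence[where w = "\<lambda>x. 2 * Cnorm 0 \<eta> * norm (\<phi> x)"])
    show "AE x in lborel. (\<lambda>k. norm (truncate \<eta> k \<phi> x - \<eta> 0 * \<phi> x)) \<longlonglongrightarrow> 0"
    proof (rule AE_I2)
      fix x
      have "isCont \<eta> 0"
        using smooth_continuous[OF tests_smooth[OF \<eta>], of UNIV] by (simp add: continuous_on_eq_continuous_at)
      moreover have "(\<lambda>k. inverse (real (Suc k)) * x) \<longlonglongrightarrow> 0"
        by (rule tendsto_mult_left_zero[OF LIMSEQ_inverse_real_of_nat])
      ultimately have "(\<lambda>k. \<eta> (inverse (real (Suc k)) * x)) \<longlonglongrightarrow> \<eta> 0" by (rule isCont_tendsto_compose)
      then have "(\<lambda>k. truncate \<eta> k \<phi> x - \<eta> 0 * \<phi> x) \<longlonglongrightarrow> \<eta> 0 * \<phi> x - \<eta> 0 * \<phi> x"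
        unfolding truncate_def by (intro tendsto_intros)
      then show "(\<lambda>k. norm (truncate \<eta> k \<phi> x - \<eta> 0 * \<phi> x)) \<longlonglongrightarrow> 0"
        by (simp add: tendsto_norm_zero)
    qed
    show "AE x in lborel. norm (norm (truncate \<eta> k \<phi> x - \<eta> 0 * \<phi> x)) \<le> 2 * Cnorm 0 \<eta> * norm (\<phi> x)" for k
    proof (rule AE_I2)
      fix x
      let ?y = "inverse (real (Suc k)) * x"
      have "norm (\<eta> ?y - \<eta> 0) \<le> 2 * Cnorm 0 \<eta>"
        using norm_nderiv_le_Cnorm[OF \<eta>, of 0 0 ?y] norm_nderiv_le_Cnorm[OF \<eta>, of 0 0 0]
          norm_triangle_ineq4[of "\<eta> ?y" "\<eta> 0"] by simp
      then have "norm (\<eta> ?y - \<eta> 0) * norm (\<phi> x) \<le> 2 * Cnorm 0 \<eta> * norm (\<phi> x)"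
        by (rule mult_right_mono) simp
      then show "norm (norm (truncate \<eta> k \<phi> x - \<eta> 0 * \<phi> x)) \<le> 2 * Cnorm 0 \<eta> * norm (\<phi> x)"
        unfolding truncate_def left_diff_distrib[symmetric] norm_mult by simp
    qed
    show "(\<lambda>x. norm (truncate \<eta> k \<phi> x - \<eta> 0 * \<phi> x)) \<in> borel_measurable lborel" for k
      using borel_measurable_integrable[OF d[of k]] by measurable
  qed (use i\<phi> in auto)
  then show ?case by (simp add: DL1_norm_def)
next
  case (Suc j)
  have sm: "smooth \<eta>" "smooth \<phi>" using Suc.prems by (simp_all add: test_funs_smooth DL1_smooth)
  have \<eta>': "nderiv 1 \<eta> \<in> test_funs" and \<phi>': "nderiv 1 \<phi> \<in> DL1"
    using Suc.prems by (simp_all add: test_funs_nderiv DL1_nderiv)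
  let ?u = "\<lambda>k x. truncate \<eta> k (nderiv 1 \<phi>) x - \<eta> 0 * nderiv 1 \<phi> x"
  let ?v = "\<lambda>k x. truncate (nderiv 1 \<eta>) k \<phi> x"
  let ?w = "\<lambda>k x. ?v k x - nderiv 1 \<eta> 0 * \<phi> x"
  let ?c = "\<lambda>k. inverse (real (Suc k))"
  have u: "?u k \<in> DL1" and v: "?v k \<in> DL1" for k
    by (intro DL1_diff DL1_cmult \<phi>' test_funs_DL1[OF truncate_test_funs[OF Suc.prems(1) DL1_smooth[OF \<phi>']]]
        test_funs_DL1[OF truncate_test_funs[OF \<eta>' sm(2)]])+
  have w: "?w k \<in> DL1" for k by (rule DL1_diff[OF v DL1_cmult[OF Suc.prems(2)]])
  have bound: "DL1_norm (Suc j) (\<lambda>x. truncate \<eta> k \<phi> x - \<eta> 0 * \<phi> x) \<le>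
      DL1_norm j (?u k) + ?c k * (DL1_norm j (?w k) + norm (nderiv 1 \<eta> 0) * DL1_norm j \<phi>)" for k
  proof -
    have "nderiv 1 (\<lambda>x. truncate \<eta> k \<phi> x - \<eta> 0 * \<phi> x) = (\<lambda>x. ?u k x + of_real (?c k) * ?v k x)"
      using nderiv_diff[OF test_funs_smooth[OF truncate_test_funs[OF Suc.prems(1) sm(2)]]
          smooth_linear[OF sm(2) bounded_linear_mult_right], of 1 k "\<eta> 0"]
      unfolding nderiv_1_truncate[OF sm] nderiv_cmult[OF sm(2)] by (simp add: algebra_simps)
    then have "DL1_norm (Suc j) (\<lambda>x. truncate \<eta> k \<phi> x - \<eta> 0 * \<phi> x) = DL1_norm j (\<lambda>x. ?u k x + of_real (?c k) * ?v k x)"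
      using DL1_norm_nderiv[of j 1] by (metis Suc_eq_plus1)
    also have "\<dots> \<le> DL1_norm j (?u k) + DL1_norm j (\<lambda>x. of_real (?c k) * ?v k x)"
      by (rule DL1_norm_add[OF u DL1_cmult[OF v]])
    also have "DL1_norm j (\<lambda>x. of_real (?c k) * ?v k x) = ?c k * DL1_norm j (?v k)"
      unfolding DL1_norm_cmult[OF v] norm_of_real by simp
    also have "DL1_norm j (?v k) = DL1_norm j (\<lambda>x. ?w k x + nderiv 1 \<eta> 0 * \<phi> x)" by simp
    also have "\<dots> \<le> DL1_norm j (?w k) + norm (nderiv 1 \<eta> 0) * DL1_norm j \<phi>"
      by (rule order_trans[OF DL1_norm_add[OF w DL1_cmult[OF Suc.prems(2)]]])
        (simp only: DL1_norm_cmult[OF Suc.prems(2)] order_refl)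
    finally show ?thesis by (simp add: mult_left_mono)
  qed
  have "(\<lambda>k. DL1_norm j (?u k) + ?c k * (DL1_norm j (?w k) + norm (nderiv 1 \<eta> 0) * DL1_norm j \<phi>))
      \<longlonglongrightarrow> 0 + 0 * (0 + norm (nderiv 1 \<eta> 0) * DL1_norm j \<phi>)"
    by (intro tendsto_intros LIMSEQ_inverse_real_of_nat Suc.IH Suc.prems \<eta>' \<phi>')
  then have lim: "(\<lambda>k. DL1_norm j (?u k) + ?c k * (DL1_norm j (?w k) + norm (nderiv 1 \<eta> 0) * DL1_norm j \<phi>)) \<longlonglongrightarrow> 0"
    by simp
  show ?case
    by (rule tendsto_sandwich[OF always_eventually always_eventually tendsto_const lim])
      (intro allI DL1_norm_nonneg bound)+
qed

text \<open>
  The bump, which lives on the interval from 0 to 1, is centred at 0 and scaled to have value 1 there.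
\<close>

definition cutoff :: "nat \<Rightarrow> (real \<Rightarrow> 'k::real_normed_field) \<Rightarrow> real \<Rightarrow> 'k" where
  "cutoff = truncate (\<lambda>x. of_real (inverse (bump (1 / 2)) *\<^sub>R bump (x + 1 / 2)))"

lemma
  fixes \<phi> :: "real \<Rightarrow> 'k::{real_normed_field,euclidean_space}"
  assumes "\<phi> \<in> DL1"
  shows cutoff_test_funs: "cutoff k \<phi> \<in> test_funs"
    and cutoff_tendsto: "(\<lambda>k. DL1_norm j (\<lambda>x. cutoff k \<phi> x - \<phi> x)) \<longlonglongrightarrow> 0"
proof -
  let ?\<eta> = "\<lambda>x. of_real (inverse (bump (1 / 2)) *\<^sub>R bump (x + 1 / 2)) :: 'k"
  have "(\<lambda>x. bump (x + 1 / 2)) \<in> tests 1"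
  proof -
    have "bump (x + 1 / 2) = 0" if "1 < \<bar>x\<bar>" for x
      using bump_pos_iff[of "x + 1 / 2"] that by linarith
    then show ?thesis using smooth_affine[OF smooth_bump, of 1 "1 / 2"] by (simp add: tests_def)
  qed
  then have \<eta>: "?\<eta> \<in> test_funs"
    by (intro tests_test_funs[OF tests_linear[OF tests_scaleR bounded_linear_of_real]])
  have "bump (1 / 2) \<noteq> 0" by (simp add: bump_pos_iff)
  then have one: "?\<eta> 0 = 1" by simp
  show "cutoff k \<phi> \<in> test_funs"
    unfolding cutoff_def by (rule truncate_test_funs[OF \<eta> DL1_smooth[OF assms]])
  show "(\<lambda>k. DL1_norm j (\<lambda>x. cutoff k \<phi> x - \<phi> x)) \<longlonglongrightarrow> 0"
    using truncate_tendsto[OF \<eta> assms, of j] unfolding cutoff_def[symmetric] one by simp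
qed

lemma cutoff_linear:
  "cutoff k (\<lambda>x. \<phi> x + \<psi> x) = (\<lambda>x. cutoff k \<phi> x + cutoff k \<psi> x)"
  "cutoff k (\<lambda>x. c * \<phi> x) = (\<lambda>x. c * cutoff k \<phi> x)"
  by (simp_all add: cutoff_def truncate_def algebra_simps)

lemma DL1_norm_cutoff:
  assumes "\<phi> \<in> DL1"
  shows "(\<lambda>k. DL1_norm j (cutoff k \<phi>)) \<longlonglongrightarrow> DL1_norm j \<phi>"
proof -
  have c: "cutoff k \<phi> \<in> DL1" for k by (rule test_funs_DL1[OF cutoff_test_funs[OF assms]])
  have "norm (DL1_norm j (cutoff k \<phi>) - DL1_norm j \<phi>) \<le> DL1_norm j (\<lambda>x. cutoff k \<phi> x - \<phi> x)" for k
  proof -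
    have "DL1_norm j (cutoff k \<phi>) \<le> DL1_norm j (\<lambda>x. cutoff k \<phi> x - \<phi> x) + DL1_norm j \<phi>"
      using DL1_norm_add[OF DL1_diff[OF c assms] assms, of j k] by simp
    moreover have "DL1_norm j \<phi> \<le> DL1_norm j (cutoff k \<phi>) + DL1_norm j (\<lambda>x. cutoff k \<phi> x - \<phi> x)"
      using DL1_norm_diff[OF c DL1_diff[OF c assms], of j k k] by simp
    ultimately show ?thesis by simp
  qed
  then have "(\<lambda>k. DL1_norm j (cutoff k \<phi>) - DL1_norm j \<phi>) \<longlonglongrightarrow> 0"
    by (intro Lim_null_comparison[OF always_eventually cutoff_tendsto[OF assms]]) blast
  then show ?thesis by (simp add: LIM_zero_iff)
qed

section \<open>Extension of distributions to \<open>\<D>\<^sub>L\<^sub>1\<close>\<close>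

context normed_scaling
begin

text \<open>
  By density, an extension is determined by its values on the test functions.
\<close>

lemma extension_tendsto:
  assumes S: "is_DL1_extension smul T S" and \<phi>: "\<phi> \<in> DL1"
  shows "(\<lambda>k. T (cutoff k \<phi>)) \<longlonglongrightarrow> S \<phi>"
proof -
  have lin: "\<And>\<phi> \<psi>. \<phi> \<in> DL1 \<Longrightarrow> \<psi> \<in> DL1 \<Longrightarrow> S (\<lambda>x. \<phi> x + \<psi> x) = S \<phi> + S \<psi>"
    and null: "\<And>\<Phi>. DL1_null_seq \<Phi> \<Longrightarrow> (\<lambda>k. S (\<Phi> k)) \<longlonglongrightarrow> 0"
    and ext: "\<And>\<psi>. \<psi> \<in> test_funs \<Longrightarrow> S \<psi> = T \<psi>"
    using S by (auto simp: is_DL1_extension_def DL1_dual_def linear_map_on_def)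
  have c: "cutoff k \<phi> \<in> DL1" for k by (rule test_funs_DL1[OF cutoff_test_funs[OF \<phi>]])
  have "DL1_null_seq (\<lambda>k x. cutoff k \<phi> x - \<phi> x)"
    unfolding DL1_null_seq_def using DL1_diff[OF c \<phi>] cutoff_tendsto[OF \<phi>] by auto
  from null[OF this] have "(\<lambda>k. S (\<lambda>x. cutoff k \<phi> x - \<phi> x)) \<longlonglongrightarrow> 0" .
  moreover have "S (\<lambda>x. cutoff k \<phi> x - \<phi> x) = T (cutoff k \<phi>) - S \<phi>" for k
    using lin[OF DL1_diff[OF c \<phi>] \<phi>, of k] ext[OF cutoff_test_funs[OF \<phi>], of k] by simp
  ultimately show ?thesis by (simp add: LIM_zero_iff)
qed

lemma DL1_ext_extension:
  assumes "DL1_extendable smul T"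
  shows "is_DL1_extension smul T (DL1_ext smul T)"
  unfolding DL1_ext_def
proof (rule theI'[where P = "is_DL1_extension smul T"])
  have "S = S'" if "is_DL1_extension smul T S" "is_DL1_extension smul T S'" for S S'
  proof (rule extensionalityI[where A = DL1])
    show "S \<in> extensional DL1" "S' \<in> extensional DL1"
      using that by (auto simp: is_DL1_extension_def DL1_dual_def linear_map_on_def)
    show "S \<phi> = S' \<phi>" if "\<phi> \<in> DL1" for \<phi>
      using extension_tendsto \<open>is_DL1_extension smul T S\<close> \<open>is_DL1_extension smul T S'\<close> that
      by (blast intro: LIMSEQ_unique)
  qed
  then show "\<exists>!S. is_DL1_extension smul T S"
    using assms unfolding DL1_extendable_def by blast
qed

lemma
  assumes "DL1_extendable smul T"
  shows DL1_ext_dual: "DL1_ext smul T \<in> DL1_dual smul"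
    and DL1_ext_test_funs: "\<phi> \<in> test_funs \<Longrightarrow> DL1_ext smul T \<phi> = T \<phi>"
  using DL1_ext_extension[OF assms] by (auto simp: is_DL1_extension_def)

lemma DL1_ext_norm_diff_le:
  assumes "DL1_extendable smul T" "DL1_extendable smul S"
    and le: "\<And>\<psi>. \<psi> \<in> test_funs \<Longrightarrow> norm (S \<psi> - T \<psi>) \<le> \<epsilon> * DL1_norm n \<psi>" and \<phi>: "\<phi> \<in> DL1"
  shows "norm (DL1_ext smul S \<phi> - DL1_ext smul T \<phi>) \<le> \<epsilon> * DL1_norm n \<phi>"
proof (rule LIMSEQ_le)
  show "(\<lambda>k. norm (S (cutoff k \<phi>) - T (cutoff k \<phi>))) \<longlonglongrightarrow> norm (DL1_ext smul S \<phi> - DL1_ext smul T \<phi>)"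
    by (intro tendsto_intros extension_tendsto DL1_ext_extension assms)
  show "(\<lambda>k. \<epsilon> * DL1_norm n (cutoff k \<phi>)) \<longlonglongrightarrow> \<epsilon> * DL1_norm n \<phi>"
    by (intro tendsto_intros DL1_norm_cutoff \<phi>)
qed (use le[OF cutoff_test_funs[OF \<phi>]] in blast)

text \<open>
  The values on the cutoffs of an element of \<open>\<D>\<^sub>L\<^sub>1\<close> form a Cauchy sequence; its limit is the
  extension, which inherits linearity and the bound.
\<close>

lemma DL1_extendable_if_bounded:
  assumes T: "T \<in> distributions smul"
    and le: "\<And>\<psi>. \<psi> \<in> test_funs \<Longrightarrow> norm (T \<psi>) \<le> B * (DL1_norm 0 \<psi> + DL1_norm n \<psi>)"
  shows "DL1_extendable smul T"
proof -
  define p where "p \<psi> = DL1_norm 0 \<psi> + DL1_norm n \<psi>" for \<psi> :: "real \<Rightarrow> 'k"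
  have p_diff: "p (\<lambda>x. \<phi> x - \<psi> x) \<le> p \<phi> + p \<psi>" if "\<phi> \<in> DL1" "\<psi> \<in> DL1" for \<phi> \<psi>
    using DL1_norm_diff[OF that, of 0] DL1_norm_diff[OF that, of n] by (simp add: p_def)
  have pos: "0 \<le> p \<psi>" for \<psi> by (simp add: p_def DL1_norm_nonneg)
  have le': "norm (T \<psi>) \<le> \<bar>B\<bar> * p \<psi>" if "\<psi> \<in> test_funs" for \<psi>
    using le[OF that] mult_right_mono[OF abs_ge_self[of B] pos[of \<psi>]] by (simp add: p_def)
  have conv: "convergent (\<lambda>k. T (cutoff k \<phi>))" if \<phi>: "\<phi> \<in> DL1" for \<phi>
  proof -
    note c = cutoff_test_funs[OF \<phi>]
    define q where "q k = p (\<lambda>x. cutoff k \<phi> x - \<phi> x)" for k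
    have "q \<longlonglongrightarrow> 0 + 0" unfolding q_def p_def by (intro tendsto_add cutoff_tendsto \<phi>)
    have d: "norm (T (cutoff k \<phi>) - T (cutoff l \<phi>)) \<le> \<bar>B\<bar> * (q k + q l)" for k l
    proof -
      have t: "(\<lambda>x. cutoff k \<phi> x - cutoff l \<phi> x) \<in> test_funs"
        using test_funs_add[OF c[of k] test_funs_cmult[OF c[of l], of "- 1"]] by simp
      have "T (cutoff k \<phi>) - T (cutoff l \<phi>) = T (\<lambda>x. cutoff k \<phi> x - cutoff l \<phi> x)"
        by (rule distribution_diff[OF T c c, symmetric])
      also have "norm \<dots> \<le> \<bar>B\<bar> * p (\<lambda>x. cutoff k \<phi> x - cutoff l \<phi> x)" by (rule le'[OF t])
      also have "p (\<lambda>x. cutoff k \<phi> x - cutoff l \<phi> x) \<le> q k + q l"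
        using p_diff[OF DL1_diff[OF test_funs_DL1[OF c] \<phi>] DL1_diff[OF test_funs_DL1[OF c] \<phi>], of k l]
        by (simp add: q_def)
      finally show ?thesis by (simp add: mult_left_mono)
    qed
    have "Cauchy (\<lambda>k. T (cutoff k \<phi>))"
    proof (rule CauchyI)
      fix e :: real assume "0 < e"
      define N where "N = \<bar>B\<bar> + 1"
      define \<delta> where "\<delta> = e / (2 * N)"
      have "0 < N" by (simp add: N_def)
      then have "0 < \<delta>" using \<open>0 < e\<close> by (simp add: \<delta>_def)
      then obtain K where K: "\<And>k. K \<le> k \<Longrightarrow> q k < \<delta>"
        using order_tendstoD(2)[OF \<open>q \<longlonglongrightarrow> 0 + 0\<close>] by (auto simp: eventually_sequentially)
      have "norm (T (cutoff k \<phi>) - T (cutoff l \<phi>)) < e" if "K \<le> k" "K \<le> l" for k l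
      proof -
        have "norm (T (cutoff k \<phi>) - T (cutoff l \<phi>)) \<le> \<bar>B\<bar> * (q k + q l)" by (rule d)
        also have "\<dots> \<le> \<bar>B\<bar> * (2 * \<delta>)" using K[OF that(1)] K[OF that(2)] by (intro mult_left_mono) auto
        also have "\<dots> < N * (2 * \<delta>)" using \<open>0 < \<delta>\<close> by (simp add: N_def)
        also have "\<dots> = e" using \<open>0 < N\<close> by (simp add: \<delta>_def)
        finally show ?thesis .
      qed
      then show "\<exists>M. \<forall>m\<ge>M. \<forall>n\<ge>M. norm (T (cutoff m \<phi>) - T (cutoff n \<phi>)) < e" by blast
    qed
    then show ?thesis by (rule Cauchy_convergent)
  qed
  define S where "S = (\<lambda>\<phi>\<in>DL1. lim (\<lambda>k. T (cutoff k \<phi>)))"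
  have S: "(\<lambda>k. T (cutoff k \<phi>)) \<longlonglongrightarrow> S \<phi>" if "\<phi> \<in> DL1" for \<phi>
    using conv[OF that] that by (simp add: S_def convergent_LIMSEQ_iff)
  have S_le: "norm (S \<phi>) \<le> \<bar>B\<bar> * p \<phi>" if \<phi>: "\<phi> \<in> DL1" for \<phi>
  proof (rule LIMSEQ_le[OF tendsto_norm[OF S[OF \<phi>]]])
    show "(\<lambda>k. \<bar>B\<bar> * p (cutoff k \<phi>)) \<longlonglongrightarrow> \<bar>B\<bar> * p \<phi>"
      unfolding p_def by (intro tendsto_intros DL1_norm_cutoff \<phi>)
  qed (use le'[OF cutoff_test_funs[OF \<phi>]] in blast)
  have "linear_map_on smul DL1 S"
    unfolding linear_map_on_def
  proof (intro conjI ballI allI)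
    show "S \<in> extensional DL1" by (simp add: S_def)
    show "S (\<lambda>x. \<phi> x + \<psi> x) = S \<phi> + S \<psi>" if "\<phi> \<in> DL1" "\<psi> \<in> DL1" for \<phi> \<psi>
    proof (rule LIMSEQ_unique[OF S[OF DL1_add[OF that]]])
      show "(\<lambda>k. T (cutoff k (\<lambda>x. \<phi> x + \<psi> x))) \<longlonglongrightarrow> S \<phi> + S \<psi>"
        using tendsto_add[OF S[OF that(1)] S[OF that(2)]]
        by (simp add: cutoff_linear distribution_add[OF T] cutoff_test_funs that)
    qed
    show "S (\<lambda>x. c * \<phi> x) = smul c (S \<phi>)" if "\<phi> \<in> DL1" for c \<phi>
    proof (rule LIMSEQ_unique[OF S[OF DL1_cmult[OF that]]])
      show "(\<lambda>k. T (cutoff k (\<lambda>x. c * \<phi> x))) \<longlonglongrightarrow> smul c (S \<phi>)"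
        using bounded_linear.tendsto[OF bounded_linear_smul S[OF that], of c]
        by (simp add: cutoff_linear distribution_cmult[OF T] cutoff_test_funs that)
    qed
  qed
  moreover have "(\<lambda>m. S (\<Phi> m)) \<longlonglongrightarrow> 0" if "DL1_null_seq \<Phi>" for \<Phi>
  proof -
    have \<Phi>: "\<Phi> m \<in> DL1" "(\<lambda>m. DL1_norm j (\<Phi> m)) \<longlonglongrightarrow> 0" for m j
      using that by (auto simp: DL1_null_seq_def)
    have "(\<lambda>m. \<bar>B\<bar> * p (\<Phi> m)) \<longlonglongrightarrow> \<bar>B\<bar> * (0 + 0)"
      unfolding p_def by (intro tendsto_intros \<Phi>)
    then have "(\<lambda>m. \<bar>B\<bar> * p (\<Phi> m)) \<longlonglongrightarrow> 0" by simp
    then show ?thesis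
      by (rule Lim_null_comparison[rotated]) (simp add: S_le[OF \<Phi>(1)])
  qed
  moreover have "S \<psi> = T \<psi>" if \<psi>: "\<psi> \<in> test_funs" for \<psi>
  proof (rule LIMSEQ_unique[OF S[OF test_funs_DL1[OF \<psi>]]])
    note \<psi>' = test_funs_DL1[OF \<psi>] and c = cutoff_test_funs[OF test_funs_DL1[OF \<psi>]]
    have "(\<lambda>k. \<bar>B\<bar> * p (\<lambda>x. cutoff k \<psi> x - \<psi> x)) \<longlonglongrightarrow> \<bar>B\<bar> * (0 + 0)"
      unfolding p_def by (intro tendsto_intros cutoff_tendsto \<psi>')
    then have lim: "(\<lambda>k. \<bar>B\<bar> * p (\<lambda>x. cutoff k \<psi> x - \<psi> x)) \<longlonglongrightarrow> 0" by simp
    have "norm (T (cutoff k \<psi>) - T \<psi>) \<le> \<bar>B\<bar> * p (\<lambda>x. cutoff k \<psi> x - \<psi> x)" for k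
    proof -
      have "(\<lambda>x. cutoff k \<psi> x - \<psi> x) \<in> test_funs"
        using test_funs_add[OF c[of k] test_funs_cmult[OF \<psi>, of "- 1"]] by simp
      from le'[OF this] show ?thesis by (simp add: distribution_diff[OF T c \<psi>])
    qed
    then have "(\<lambda>k. T (cutoff k \<psi>) - T \<psi>) \<longlonglongrightarrow> 0"
      by (intro Lim_null_comparison[OF always_eventually lim] allI)
    then show "(\<lambda>k. T (cutoff k \<psi>)) \<longlonglongrightarrow> T \<psi>" by (simp add: LIM_zero_iff)
  qed
  ultimately show ?thesis
    unfolding DL1_extendable_def is_DL1_extension_def DL1_dual_def by blast
qed

section \<open>The topology of the dual\<close>

lemma seminorm_le: "(\<And>\<phi>. \<phi> \<in> V \<Longrightarrow> norm (S \<phi>) \<le> c) \<Longrightarrow> DL1_dual_seminorm V S \<le> ennreal c"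
  unfolding DL1_dual_seminorm_def by (intro SUP_least ennreal_leI)

lemma seminorm_lessD:
  assumes "DL1_dual_seminorm V S < ennreal c"
  obtains b where "0 \<le> b" "b < c" "\<And>\<phi>. \<phi> \<in> V \<Longrightarrow> norm (S \<phi>) \<le> b"
proof
  define b where "b = enn2real (DL1_dual_seminorm V S)"
  have fin: "DL1_dual_seminorm V S < top" using assms ennreal_less_top less_trans by blast
  then have b: "DL1_dual_seminorm V S = ennreal b" by (simp add: b_def)
  show "0 \<le> b" by (simp add: b_def)
  then show "b < c" using assms by (simp add: b ennreal_less_iff)
  show "norm (S \<phi>) \<le> b" if "\<phi> \<in> V" for \<phi>
  proof -
    have "ennreal (norm (S \<phi>)) \<le> DL1_dual_seminorm V S"
      unfolding DL1_dual_seminorm_def using that by (rule SUP_upper)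
    then show ?thesis using \<open>0 \<le> b\<close> by (simp add: b)
  qed
qed

lemma DL1_dual_open_ball:
  assumes "S \<in> DL1_dual smul" "DL1_bounded V" "0 < \<epsilon>"
  shows "openin (DL1_dual_topology smul)
      {R \<in> DL1_dual smul. DL1_dual_seminorm V (\<lambda>\<phi>. R \<phi> - S \<phi>) < ennreal \<epsilon>}"
    and "S \<in> {R \<in> DL1_dual smul. DL1_dual_seminorm V (\<lambda>\<phi>. R \<phi> - S \<phi>) < ennreal \<epsilon>}"
proof -
  show "openin (DL1_dual_topology smul)
      {R \<in> DL1_dual smul. DL1_dual_seminorm V (\<lambda>\<phi>. R \<phi> - S \<phi>) < ennreal \<epsilon>}"
    unfolding DL1_dual_topology_def using assms by (intro topology_generated_by_Basis) blast
  have "DL1_dual_seminorm V (\<lambda>\<phi>. S \<phi> - S \<phi>) \<le> ennreal 0" by (rule seminorm_le) simp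
  also have "\<dots> < ennreal \<epsilon>" using assms(3) by (simp add: ennreal_less_iff)
  finally show "S \<in> {R \<in> DL1_dual smul. DL1_dual_seminorm V (\<lambda>\<phi>. R \<phi> - S \<phi>) < ennreal \<epsilon>}"
    using assms(1) by simp
qed

text \<open>
  The open sets of the subbase are balls around arbitrary centres \<open>S'\<close>. If \<open>S\<close> lies in such a ball,
  its seminorm distance \<open>b\<close> to the centre is strictly less than the radius, and the remaining margin
  accommodates the distance of \<open>R k\<close> to \<open>S\<close>.
\<close>

lemma limitin_DL1_dual:
  assumes R: "\<And>k. R k \<in> DL1_dual smul" and S: "S \<in> DL1_dual smul"
    and lim: "\<And>V \<epsilon>. DL1_bounded V \<Longrightarrow> 0 < \<epsilon> \<Longrightarrow> eventually (\<lambda>k. \<forall>\<phi>\<in>V. norm (R k \<phi> - S \<phi>) < \<epsilon>) sequentially"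
  shows "limitin (DL1_dual_topology smul) R S sequentially"
  unfolding limitin_def
proof (intro conjI allI impI)
  have "DL1_bounded ({} :: (real \<Rightarrow> 'k) set)" by (simp add: DL1_bounded_def)
  from DL1_dual_open_ball[OF S this zero_less_one]
  show "S \<in> topspace (DL1_dual_topology smul)" by (auto simp: topspace_def)
  fix U assume "openin (DL1_dual_topology smul) U \<and> S \<in> U"
  then have "generate_topology_on {{R \<in> DL1_dual smul. DL1_dual_seminorm V (\<lambda>\<phi>. R \<phi> - S \<phi>) < ennreal \<epsilon>} | S V \<epsilon>.
        S \<in> DL1_dual smul \<and> DL1_bounded V \<and> 0 < \<epsilon>} U" and "S \<in> U"
    by (simp_all add: DL1_dual_topology_def openin_topology_generated_by_iff)
  then show "eventually (\<lambda>k. R k \<in> U) sequentially"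
  proof (induction rule: generate_topology_on.induct)
    case (Int a b)
    then show ?case by (auto intro: eventually_conj)
  next
    case (UN \<K>)
    then obtain K where K: "K \<in> \<K>" "S \<in> K" by blast
    then have "eventually (\<lambda>k. R k \<in> K) sequentially" using UN by blast
    then show ?case by eventually_elim (use K in blast)
  next
    case (Basis U)
    then obtain S' V \<epsilon> where U: "U = {R \<in> DL1_dual smul. DL1_dual_seminorm V (\<lambda>\<phi>. R \<phi> - S' \<phi>) < ennreal \<epsilon>}"
      and V: "DL1_bounded V" by blast
    obtain b where b: "0 \<le> b" "b < \<epsilon>" "\<And>\<phi>. \<phi> \<in> V \<Longrightarrow> norm (S \<phi> - S' \<phi>) \<le> b"
      using Basis.prems seminorm_lessD unfolding U by blast
    have "0 < (\<epsilon> - b) / 2" using b by simp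
    from lim[OF V this] show ?case
    proof eventually_elim
      case (elim k)
      have "DL1_dual_seminorm V (\<lambda>\<phi>. R k \<phi> - S' \<phi>) \<le> ennreal ((\<epsilon> + b) / 2)"
      proof (rule seminorm_le)
        fix \<phi> assume "\<phi> \<in> V"
        then have "norm (R k \<phi> - S \<phi>) \<le> (\<epsilon> - b) / 2" "norm (S \<phi> - S' \<phi>) \<le> b"
          using elim b(3) by (auto intro: less_imp_le)
        then show "norm (R k \<phi> - S' \<phi>) \<le> (\<epsilon> + b) / 2"
          using norm_triangle_ineq[of "R k \<phi> - S \<phi>" "S \<phi> - S' \<phi>"] by (simp add: field_simps)
      qed
      also have "\<dots> < ennreal \<epsilon>" using b by (intro ennreal_lessI) auto
      finally show ?case using R by (simp add: U)
    qed
  qed simp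
qed

end

section \<open>Membership in \<open>\<D>'\<^sub>\<A>\<close>\<close>

context normed_scaling
begin

lemma D'_of_self:
  assumes "A \<subseteq> distributions smul" "\<forall>F\<in>A. \<forall>\<phi>\<in>test_funs. reg_dist smul (dist_conv F \<phi>) \<in> A"
  shows "A \<subseteq> D'_of smul A"
  using assms by (auto simp: D'_of_def)

text \<open>
  The set of the functions \<open>y \<mapsto> \<phi> (x - y)\<close> is bounded in \<open>\<D>\<^sub>L\<^sub>1\<close> since the \<open>L\<^sup>1\<close> norm is
  invariant under translation and reflection. Approximation of \<open>T\<close> on it is uniform approximation
  of \<open>T * \<phi>\<close> by the smooth functions \<open>F * \<phi>\<close> with \<open>F \<in> A\<close>.
\<close>

lemma D'_of_if_approximable:
  assumes A: "A \<subseteq> distributions smul" "smooth_uniformly_closed smul A"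
      "\<forall>F\<in>A. \<forall>\<phi>\<in>test_funs. reg_dist smul (dist_conv F \<phi>) \<in> A"
    and T: "T \<in> distributions smul"
    and approx: "\<And>U \<epsilon>. U \<subseteq> test_funs \<Longrightarrow> DL1_bounded U \<Longrightarrow> 0 < \<epsilon> \<Longrightarrow> \<exists>F\<in>A. \<forall>\<phi>\<in>U. norm (F \<phi> - T \<phi>) < \<epsilon>"
  shows "T \<in> D'_of smul A"
proof -
  have "reg_dist smul (dist_conv T \<phi>) \<in> A" if \<phi>: "\<phi> \<in> test_funs" for \<phi>
  proof -
    define U where "U = range (\<lambda>x y. \<phi> (x - y))"
    have U: "U \<subseteq> test_funs" unfolding U_def using test_funs_reflect[OF \<phi>] by blast
    have "DL1_bounded U"
      unfolding DL1_bounded_def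
    proof (intro conjI allI)
      show "U \<subseteq> DL1" using U test_funs_DL1 by blast
      show "bdd_above (DL1_norm j ` U)" for j
        unfolding U_def image_image DL1_norm_reflect[OF test_funs_smooth[OF \<phi>]] by simp
    qed
    then have "\<exists>F\<in>A. \<forall>\<phi>\<in>U. norm (F \<phi> - T \<phi>) < inverse (real (Suc k))" for k
      using approx[OF U] by simp
    then obtain F where F: "\<And>k. F k \<in> A"
      and close: "\<And>k \<phi>. \<phi> \<in> U \<Longrightarrow> norm (F k \<phi> - T \<phi>) < inverse (real (Suc k))" by metis
    have "uniform_limit UNIV (\<lambda>k. dist_conv (F k) \<phi>) (dist_conv T \<phi>) sequentially"
    proof (rule uniform_limitI)
      fix e :: real assume "0 < e"
      from order_tendstoD(2)[OF LIMSEQ_inverse_real_of_nat this]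
      show "eventually (\<lambda>k. \<forall>x\<in>UNIV. dist (dist_conv (F k) \<phi> x) (dist_conv T \<phi> x) < e) sequentially"
      proof eventually_elim
        case (elim k)
        have "dist (dist_conv (F k) \<phi> x) (dist_conv T \<phi> x) < inverse (real (Suc k))" for x
          unfolding dist_conv_def dist_norm by (rule close) (simp add: U_def)
        then show ?case using elim by (blast intro: less_trans)
      qed
    qed
    moreover have "\<forall>k. smooth (dist_conv (F k) \<phi>) \<and> reg_dist smul (dist_conv (F k) \<phi>) \<in> A"
      using A(1,3) F \<phi> smooth_dist_conv by blast
    ultimately show ?thesis
      using A(2)[unfolded smooth_uniformly_closed_def, rule_format,
          of "\<lambda>k. dist_conv (F k) \<phi>" "dist_conv T \<phi>"] by blast
  qed
  with T show ?thesis by (simp add: D'_of_def)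
qed

lemma dist_conv_dist_deriv:
  assumes F: "F \<in> distributions smul" and \<phi>: "\<phi> \<in> test_funs"
  shows "dist_conv (dist_deriv n F) \<phi> = dist_conv F (nderiv n \<phi>)"
proof
  fix x
  have r: "(\<lambda>y. \<phi> (x - y)) \<in> test_funs" and r': "(\<lambda>y. nderiv n \<phi> (x - y)) \<in> test_funs"
    using \<phi> by (auto intro: test_funs_reflect test_funs_nderiv)
  show "dist_conv (dist_deriv n F) \<phi> x = dist_conv F (nderiv n \<phi>) x"
    using distribution_scaleR[OF F r', of "(-1) ^ n"] r
    by (simp add: dist_conv_def dist_deriv_def nderiv_reflect[OF test_funs_smooth[OF \<phi>]]
        power_mult_distrib[symmetric])
qed

text \<open>
  The sum is nonempty because \<open>A\<close> may be empty and so need not contain 0.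
\<close>

lemma reg_dist_sum_in:
  fixes f :: "nat \<Rightarrow> real \<Rightarrow> 'x"
  assumes plus: "\<forall>F\<in>A. \<forall>G\<in>A. dist_plus F G \<in> A"
    and f: "\<And>i. i \<in> {1..Suc m} \<Longrightarrow> continuous_on UNIV (f i) \<and> reg_dist smul (f i) \<in> A"
  shows "reg_dist smul (\<lambda>x. \<Sum>i=1..Suc m. f i x) \<in> A"
  using f
proof (induction m)
  case 0
  then show ?case by simp
next
  case (Suc m)
  let ?s = "\<lambda>x. \<Sum>i=1..Suc m. f i x"
  have c: "continuous_on UNIV ?s" "continuous_on UNIV (f (Suc (Suc m)))"
    by (rule continuous_on_sum) (use Suc.prems in simp_all)
  have "reg_dist smul (\<lambda>x. ?s x + f (Suc (Suc m)) x) = dist_plus (reg_dist smul ?s) (reg_dist smul (f (Suc (Suc m))))"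
  proof (rule extensionalityI[where A = test_funs])
    show "reg_dist smul (\<lambda>x. ?s x + f (Suc (Suc m)) x) \<in> extensional test_funs" by (simp add: reg_dist_def)
    show "dist_plus (reg_dist smul ?s) (reg_dist smul (f (Suc (Suc m)))) \<in> extensional test_funs" by (simp add: dist_plus_def)
  qed (simp only: reg_dist_add[OF c] dist_plus_def restrict_apply')
  moreover have "reg_dist smul ?s \<in> A" using Suc by simp
  ultimately show ?case using plus Suc.prems[of "Suc (Suc m)"] by simp
qed

lemma D'_of_sum_derivatives:
  fixes m :: nat and k :: "nat \<Rightarrow> nat"
  assumes A: "A \<subseteq> distributions smul" "\<forall>F\<in>A. \<forall>G\<in>A. dist_plus F G \<in> A"
      "\<forall>F\<in>A. \<forall>\<phi>\<in>test_funs. reg_dist smul (dist_conv F \<phi>) \<in> A"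
    and T: "T \<in> distributions smul" "T = dist_sum (\<lambda>i. dist_deriv (k i) (F i)) {1..m}"
    and F: "1 \<le> m" "\<And>i. i \<in> {1..m} \<Longrightarrow> F i \<in> A"
  shows "T \<in> D'_of smul A"
proof -
  obtain m' where m: "m = Suc m'" using F(1) by (cases m) auto
  have "reg_dist smul (dist_conv T \<phi>) \<in> A" if \<phi>: "\<phi> \<in> test_funs" for \<phi>
  proof -
    have "dist_conv T \<phi> x = (\<Sum>i=1..Suc m'. dist_conv (F i) (nderiv (k i) \<phi>) x)" for x
    proof -
      have "dist_conv T \<phi> x = (\<Sum>i=1..m. dist_conv (dist_deriv (k i) (F i)) \<phi> x)"
        using test_funs_reflect[OF \<phi>, of x] by (simp add: T(2) dist_conv_def dist_sum_def)
      also have "\<dots> = (\<Sum>i=1..m. dist_conv (F i) (nderiv (k i) \<phi>) x)"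
      proof (rule sum.cong[OF refl])
        fix i assume "i \<in> {1..m}"
        then have "F i \<in> distributions smul" using A(1) F(2) by blast
        then show "dist_conv (dist_deriv (k i) (F i)) \<phi> x = dist_conv (F i) (nderiv (k i) \<phi>) x"
          by (simp add: dist_conv_dist_deriv[OF _ \<phi>])
      qed
      finally show ?thesis by (simp only: m)
    qed
    then have eq: "dist_conv T \<phi> = (\<lambda>x. \<Sum>i=1..Suc m'. dist_conv (F i) (nderiv (k i) \<phi>) x)" by blast
    show ?thesis
      unfolding eq
    proof (rule reg_dist_sum_in[OF A(2)])
      fix i assume "i \<in> {1..Suc m'}"
      then have "F i \<in> A" using F(2) m by simp
      then show "continuous_on UNIV (dist_conv (F i) (nderiv (k i) \<phi>)) \<and>
          reg_dist smul (dist_conv (F i) (nderiv (k i) \<phi>)) \<in> A"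
        using A test_funs_nderiv[OF \<phi>] by (blast intro: smooth_continuous smooth_dist_conv)
    qed
  qed
  with T(1) show ?thesis by (simp add: D'_of_def)
qed

end

section \<open>The equivalences\<close>

theorem theorem2p11:
  fixes smul :: "'k::{real_normed_field,euclidean_space} \<Rightarrow> 'x::banach \<Rightarrow> 'x"
    and A :: "((real \<Rightarrow> 'k) \<Rightarrow> 'x) set"
    and T :: "(real \<Rightarrow> 'k) \<Rightarrow> 'x"
  assumes "normed_scaling smul"
    and "A \<subseteq> D'_of smul (L_infinity smul)"
    and "smooth_uniformly_closed smul A"
    and "\<forall>F\<in>A. \<forall>G\<in>A. dist_plus F G \<in> A"
    and "\<forall>F\<in>A. \<forall>\<phi>\<in>test_funs. reg_dist smul (dist_conv F \<phi>) \<in> A"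
    and "T \<in> distributions smul"
  shows
    "(T \<in> D'_of smul A \<longleftrightarrow>
        (\<exists>F G n. continuous_on UNIV F \<and> reg_dist smul F \<in> A \<and>
                 continuous_on UNIV G \<and> reg_dist smul G \<in> A \<and>
                 T = dist_plus (reg_dist smul F) (dist_deriv n (reg_dist smul G)))) \<and>
     (T \<in> D'_of smul A \<longleftrightarrow>
        (\<exists>(m::nat) (k :: nat \<Rightarrow> nat) F. 1 \<le> m \<and> (\<forall>i\<in>{1..m}. F i \<in> A) \<and>
                 T = dist_sum (\<lambda>i. dist_deriv (k i) (F i)) {1..m})) \<and>
     (T \<in> D'_of smul A \<longleftrightarrow>
        DL1_extendable smul T \<and>
        (\<exists>\<phi> :: nat \<Rightarrow> real \<Rightarrow> 'x. (\<forall>n. smooth (\<phi> n) \<and> reg_dist smul (\<phi> n) \<in> A) \<and>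
           limitin (DL1_dual_topology smul)
             (\<lambda>n. DL1_ext smul (reg_dist smul (\<phi> n))) (DL1_ext smul T) sequentially)) \<and>
     (T \<in> D'_of smul A \<longleftrightarrow>
        (\<exists>\<Phi> :: nat \<Rightarrow> (real \<Rightarrow> 'k) \<Rightarrow> 'x. (\<forall>n. \<Phi> n \<in> A) \<and>
           (\<forall>U. U \<subseteq> test_funs \<and> DL1_bounded U \<longrightarrow> uniform_limit U \<Phi> T sequentially))) \<and>
     (T \<in> D'_of smul A \<longleftrightarrow>
        DL1_extendable smul T \<and>
        DL1_ext smul T \<in> DL1_dual_topology smul closure_of (DL1_ext smul ` A))"
    (is "(?a \<longleftrightarrow> ?b) \<and> (?a \<longleftrightarrow> ?c) \<and> (?a \<longleftrightarrow> ?d) \<and> (?a \<longleftrightarrow> ?e) \<and> (?a \<longleftrightarrow> ?f)")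
proof -
  interpret normed_scaling smul by fact
  note T = assms(6)
  let ?\<tau> = "DL1_dual_topology smul" and ?E = "DL1_ext smul"
  have A: "A \<subseteq> distributions smul" using assms(2) by (auto simp: D'_of_def)
  have extendable: "DL1_extendable smul S" if S: "S \<in> D'_of smul A" for S
  proof -
    have "\<exists>B n. \<forall>\<psi>\<in>test_funs. norm (S \<psi>) \<le> B * (DL1_norm 0 \<psi> + DL1_norm n \<psi>)"
      by (rule structure_theorem[OF assms(2,3) S]) blast
    moreover have "S \<in> distributions smul" using S by (simp add: D'_of_def)
    ultimately show ?thesis using DL1_extendable_if_bounded by blast
  qed
  have extA: "DL1_extendable smul S" if "S \<in> A" for S
    using extendable D'_of_self[OF A assms(5)] that by blast
  have ab: ?b if ?a
    by (rule structure_theorem[OF assms(2,3) that]) blast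
  have bc: ?c if b: ?b
  proof -
    obtain F G n where F: "reg_dist smul F \<in> A" and G: "reg_dist smul G \<in> A"
      and eq: "T = dist_plus (reg_dist smul F) (dist_deriv n (reg_dist smul G))" using b by blast
    define k where "k i = (if i = 1 then 0 else n)" for i :: nat
    define H where "H i = (if i = 1 then reg_dist smul F else reg_dist smul G)" for i :: nat
    have "{1..2::nat} = {1, 2}" by auto
    then have "T = dist_sum (\<lambda>i. dist_deriv (k i) (H i)) {1..2}"
      unfolding eq dist_plus_def dist_sum_def by (intro restrict_ext) (simp add: k_def H_def dist_deriv_def)
    then show ?c using F G by (intro exI[of _ 2] exI[of _ k] exI[of _ H]) (simp add: H_def)
  qed
  have ca: ?a if ?c
    using that D'_of_sum_derivatives[OF A assms(4,5) T] by blast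
  have ad: ?d if TA: ?a
  proof -
    have "\<exists>n \<Phi> \<epsilon>. (\<forall>K. smooth (\<Phi> K) \<and> reg_dist smul (\<Phi> K) \<in> A) \<and> \<epsilon> \<longlonglongrightarrow> 0 \<and>
        (\<forall>K. \<forall>\<psi>\<in>test_funs. norm (reg_dist smul (\<Phi> K) \<psi> - T \<psi>) \<le> \<epsilon> K * DL1_norm n \<psi>)"
      by (rule structure_theorem[OF assms(2,3) TA]) blast
    then obtain n \<Phi> \<epsilon> where \<Phi>: "\<And>K. smooth (\<Phi> K)" "\<And>K. reg_dist smul (\<Phi> K) \<in> A" and \<epsilon>: "\<epsilon> \<longlonglongrightarrow> 0"
      and close: "\<And>K \<psi>. \<psi> \<in> test_funs \<Longrightarrow> norm (reg_dist smul (\<Phi> K) \<psi> - T \<psi>) \<le> \<epsilon> K * DL1_norm n \<psi>"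
      by blast
    note extT = extendable[OF TA] and ext\<Phi> = extA[OF \<Phi>(2)]
    have "limitin ?\<tau> (\<lambda>K. ?E (reg_dist smul (\<Phi> K))) (?E T) sequentially"
    proof (rule limitin_DL1_dual[OF DL1_ext_dual[OF ext\<Phi>] DL1_ext_dual[OF extT]])
      fix V :: "(real \<Rightarrow> 'k) set" and \<delta> :: real
      assume V: "DL1_bounded V" and "0 < \<delta>"
      then have "bdd_above (DL1_norm n ` V)" by (simp add: DL1_bounded_def)
      then obtain M where M: "\<And>\<phi>. \<phi> \<in> V \<Longrightarrow> DL1_norm n \<phi> \<le> M"
        unfolding bdd_above_def by blast
      have "(\<lambda>K. \<bar>\<epsilon> K\<bar> * \<bar>M\<bar>) \<longlonglongrightarrow> 0"
        using tendsto_mult_left_zero[OF tendsto_rabs_zero[OF \<epsilon>]] .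
      from order_tendstoD(2)[OF this \<open>0 < \<delta>\<close>]
      show "eventually (\<lambda>K. \<forall>\<phi>\<in>V. norm (?E (reg_dist smul (\<Phi> K)) \<phi> - ?E T \<phi>) < \<delta>) sequentially"
      proof eventually_elim
        case (elim K)
        show ?case
        proof
          fix \<phi> assume "\<phi> \<in> V"
          then have "\<phi> \<in> DL1" using V by (auto simp: DL1_bounded_def)
          have "norm (?E (reg_dist smul (\<Phi> K)) \<phi> - ?E T \<phi>) \<le> \<epsilon> K * DL1_norm n \<phi>"
            by (rule DL1_ext_norm_diff_le[OF extT ext\<Phi> close \<open>\<phi> \<in> DL1\<close>])
          also have "\<dots> \<le> \<bar>\<epsilon> K\<bar> * \<bar>M\<bar>"
            using M[OF \<open>\<phi> \<in> V\<close>] DL1_norm_nonneg[of n \<phi>] by (intro mult_mono) auto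
          finally show "norm (?E (reg_dist smul (\<Phi> K)) \<phi> - ?E T \<phi>) < \<delta>" using elim by simp
        qed
      qed
    qed
    with extT \<Phi> show ?d by (intro conjI exI[of _ \<Phi>] allI) auto
  qed
  have de: ?e if d: ?d
  proof -
    obtain \<Phi> where extT: "DL1_extendable smul T" and \<Phi>: "\<And>n. reg_dist smul (\<Phi> n) \<in> A"
      and lim: "limitin ?\<tau> (\<lambda>n. ?E (reg_dist smul (\<Phi> n))) (?E T) sequentially" using d by blast
    have "uniform_limit U (\<lambda>n. reg_dist smul (\<Phi> n)) T sequentially" if U: "U \<subseteq> test_funs" "DL1_bounded U" for U
    proof (rule uniform_limitI)
      fix \<delta> :: real assume "0 < \<delta>"
      note ball = DL1_dual_open_ball[OF DL1_ext_dual[OF extT] U(2) this]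
      have "eventually (\<lambda>n. DL1_dual_seminorm U (\<lambda>\<phi>. ?E (reg_dist smul (\<Phi> n)) \<phi> - ?E T \<phi>) < ennreal \<delta>) sequentially"
        using lim ball unfolding limitin_def by (auto elim: eventually_mono)
      then show "eventually (\<lambda>n. \<forall>\<phi>\<in>U. dist (reg_dist smul (\<Phi> n) \<phi>) (T \<phi>) < \<delta>) sequentially"
      proof eventually_elim
        case (elim n)
        obtain b where b: "b < \<delta>" "\<And>\<phi>. \<phi> \<in> U \<Longrightarrow> norm (?E (reg_dist smul (\<Phi> n)) \<phi> - ?E T \<phi>) \<le> b"
          using seminorm_lessD[OF elim] by blast
        show ?case
        proof
          fix \<phi> assume \<phi>: "\<phi> \<in> U"
          then have t: "\<phi> \<in> test_funs" using U(1) by blast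
          have "norm (?E (reg_dist smul (\<Phi> n)) \<phi> - ?E T \<phi>) < \<delta>"
            by (rule le_less_trans[OF b(2)[OF \<phi>] b(1)])
          then show "dist (reg_dist smul (\<Phi> n) \<phi>) (T \<phi>) < \<delta>"
            by (simp only: dist_norm DL1_ext_test_funs[OF extT t] DL1_ext_test_funs[OF extA[OF \<Phi>] t])
        qed
      qed
    qed
    with \<Phi> show ?e by (intro exI[of _ "\<lambda>n. reg_dist smul (\<Phi> n)"] conjI allI impI) auto
  qed
  have df: ?f if d: ?d
  proof -
    obtain \<Phi> where extT: "DL1_extendable smul T" and \<Phi>: "\<And>n. reg_dist smul (\<Phi> n) \<in> A"
      and lim: "limitin ?\<tau> (\<lambda>n. ?E (reg_dist smul (\<Phi> n))) (?E T) sequentially" using d by blast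
    have "?E T \<in> ?\<tau> closure_of (?E ` A)"
      unfolding in_closure_of
    proof (intro conjI allI impI)
      show "?E T \<in> topspace ?\<tau>" using lim by (simp add: limitin_def)
      fix U assume "?E T \<in> U \<and> openin ?\<tau> U"
      then have "eventually (\<lambda>n. ?E (reg_dist smul (\<Phi> n)) \<in> U) sequentially"
        using lim by (simp add: limitin_def)
      then obtain n where "?E (reg_dist smul (\<Phi> n)) \<in> U"
        by (auto simp: eventually_sequentially)
      then show "\<exists>S. S \<in> ?E ` A \<and> S \<in> U" using \<Phi> by blast
    qed
    with extT show ?f by blast
  qed
  have ea: ?a if e: ?e
  proof (rule D'_of_if_approximable[OF A assms(3,5) T])
    obtain \<Phi> where \<Phi>: "\<And>n. \<Phi> n \<in> A"
      and lim: "\<And>U. U \<subseteq> test_funs \<Longrightarrow> DL1_bounded U \<Longrightarrow> uniform_limit U \<Phi> T sequentially"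
      using e by blast
    fix U :: "(real \<Rightarrow> 'k) set" and \<epsilon> :: real
    assume "U \<subseteq> test_funs" "DL1_bounded U" "0 < \<epsilon>"
    from eventually_happens[OF uniform_limitD[OF lim[OF this(1,2)] this(3)]]
    show "\<exists>F\<in>A. \<forall>\<phi>\<in>U. norm (F \<phi> - T \<phi>) < \<epsilon>"
      using \<Phi> by (auto simp: dist_norm)
  qed
  have fa: ?a if f: ?f
  proof (rule D'_of_if_approximable[OF A assms(3,5) T])
    have extT: "DL1_extendable smul T" and cl: "?E T \<in> ?\<tau> closure_of (?E ` A)" using f by blast+
    fix U :: "(real \<Rightarrow> 'k) set" and \<epsilon> :: real
    assume U: "U \<subseteq> test_funs" "DL1_bounded U" "0 < \<epsilon>"
    note ball = DL1_dual_open_ball[OF DL1_ext_dual[OF extT] U(2,3)]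
    have "\<forall>W. ?E T \<in> W \<and> openin ?\<tau> W \<longrightarrow> (\<exists>S. S \<in> ?E ` A \<and> S \<in> W)"
      using cl by (simp add: in_closure_of)
    from this[rule_format, OF conjI[OF ball(2,1)]]
    obtain F where F: "F \<in> A" "DL1_dual_seminorm U (\<lambda>\<phi>. ?E F \<phi> - ?E T \<phi>) < ennreal \<epsilon>"
      by auto
    obtain b where b: "b < \<epsilon>" "\<And>\<phi>. \<phi> \<in> U \<Longrightarrow> norm (?E F \<phi> - ?E T \<phi>) \<le> b"
      using seminorm_lessD[OF F(2)] by blast
    have "norm (F \<phi> - T \<phi>) < \<epsilon>" if "\<phi> \<in> U" for \<phi>
    proof -
      have t: "\<phi> \<in> test_funs" using U(1) that by blast
      have "norm (?E F \<phi> - ?E T \<phi>) < \<epsilon>" by (rule le_less_trans[OF b(2)[OF that] b(1)])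
      then show ?thesis
        by (simp only: DL1_ext_test_funs[OF extT t] DL1_ext_test_funs[OF extA[OF F(1)] t])
    qed
    with F(1) show "\<exists>F\<in>A. \<forall>\<phi>\<in>U. norm (F \<phi> - T \<phi>) < \<epsilon>" by blast
  qed
  show ?thesis using ab bc ca ad de df ea fa by blast
qed

end
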